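(* Let $M$ be a $\mathbb{Z}[T^{\pm 1}]$-module (equivalently, an abelian group with an automorphism $T$), and let $X = Q_{M,T}$ be the Alexander quandle. Then there is an isomorphism of abelian groups $$H_2^Q(X) \cong \left( (\Lambda^2 (1-T)M)_T \oplus ((1-T)M)^T \oplus \mathbb{Z}^{\oplus (|M_T| -1)} \right)^{\oplus M_T},$$ where $T$ acts on $\Lambda^2 (1-T)M$ diagonally.
   Context: A quandle is a set $X$ with a binary operation $*$ such that (Q1) $x*x=x$ for all $x$; (Q2) for each $x\in X$ the map $s_x:X\to X$, $s_x(a)=a*x$, is bijective; (Q3) $(x*y)*z=(x*z)*(y*z)$ for all $x,y,z$. The Alexander quandle $Q_{M,T}$ is the set $M$ with operation $x*y = Tx+(1-T)y$. For a $\mathbb{Z}[T^{\pm1}]$-module $N$: $N_T := N/(1-T)N$ and $N^T := \mathrm{Ker}(1-T)\subset N$. $(1-T)M$ denotes the image of $1-T$ on $M$, a submodule. $\Lambda^2$ is the exterior square over $\mathbb{Z}$; the diagonal action is $T(a\wedge b)=Ta\wedge Tb$. $|M_T|$ is the cardinality of $M_T$, which is not assumed finite; if $M_T$ is infinite, then $|M_T|-1=|M_T|$ as cardinals. For a set (or cardinal) $S$, $B^{\oplus S}$ denotes the direct sum of copies of $B$ indexed by $S$. Quandle homology $H_*^Q(X)$ (with $\mathbb{Z}$ coefficients): let $C_n^R(X)$ be the free abelian group on $X^n$, with $$\partial(x_1,\dots,x_n)=\sum_{i=1}^n(-1)^i\bigl[(x_1,\dots,x_{i-1},x_{i+1},\dots,x_n)-(x_1*x_i,\dots,x_{i-1}*x_i,x_{i+1},\dots,x_n)\bigr].$$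 Let $C_n^D(X)\subset C_n^R(X)$ be the subgroup spanned by tuples with $x_i=x_{i+1}$ for some $1\le i<n$ (zero for $n\le 1$); it is a subcomplex. $H_*^Q(X)$ is the homology of $C_*^R(X)/C_*^D(X)$. *)

theory Defs
  imports "HOL-Algebra.Free_Abelian_Groups"
begin

text \<open>
  Abelian groups are written multiplicatively, as in HOL-Algebra: the sum in \<open>M\<close> is
  \<open>\<otimes>\<^bsub>M\<^esub>\<close>, zero is \<open>\<one>\<^bsub>M\<^esub>\<close> and the negative is \<open>inv\<^bsub>M\<^esub>\<close>.  A module over the Laurent
  polynomial ring \<open>\<int>[T, 1/T]\<close> is an abelian group \<open>M\<close> with an automorphism \<open>T \<in> iso M M\<close>.
\<close>

subsection \<open>Quandles\<close>

locale quandle =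
  fixes X :: "'a set" and qop :: "'a \<Rightarrow> 'a \<Rightarrow> 'a" (infixl \<open>\<triangleright>\<close> 70)
  assumes idem: "x \<in> X \<Longrightarrow> x \<triangleright> x = x"
    and bij: "x \<in> X \<Longrightarrow> bij_betw (\<lambda>a. a \<triangleright> x) X X"
    and self_distrib: "\<lbrakk>x \<in> X; y \<in> X; z \<in> X\<rbrakk> \<Longrightarrow> (x \<triangleright> y) \<triangleright> z = (x \<triangleright> z) \<triangleright> (y \<triangleright> z)"

definition one_minus :: "('a, 'm) monoid_scheme \<Rightarrow> ('a \<Rightarrow> 'a) \<Rightarrow> 'a \<Rightarrow> 'a"
  where "one_minus M T x = x \<otimes>\<^bsub>M\<^esub> inv\<^bsub>M\<^esub> (T x)"

definition alexander_op :: "('a, 'm) monoid_scheme \<Rightarrow> ('a \<Rightarrow> 'a) \<Rightarrow> 'a \<Rightarrow> 'a \<Rightarrow> 'a"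
  where "alexander_op M T x y = T x \<otimes>\<^bsub>M\<^esub> one_minus M T y"

lemma quandle_alexander:
  fixes M :: "('a, 'm) monoid_scheme"
  assumes "comm_group M" and T: "T \<in> iso M M"
  shows "quandle (carrier M) (alexander_op M T)"
proof -
  interpret comm_group M by fact
  have hom: "T \<in> hom M M" and bijT: "bij_betw T (carrier M) (carrier M)"
    using T by (auto simp: iso_def)
  interpret T: group_hom M M T
    using hom by unfold_locales
  have bij_mult: "bij_betw (\<lambda>a. a \<otimes>\<^bsub>M\<^esub> c) (carrier M) (carrier M)" if "c \<in> carrier M" for c
    by (rule bij_betw_byWitness[where f' = "\<lambda>a. a \<otimes>\<^bsub>M\<^esub> inv\<^bsub>M\<^esub> c"]) (use that in \<open>auto simp: m_assoc\<close>)
  have cancel: "z \<otimes>\<^bsub>M\<^esub> (p \<otimes>\<^bsub>M\<^esub> (r \<otimes>\<^bsub>M\<^esub> (inv\<^bsub>M\<^esub> z \<otimes>\<^bsub>M\<^esub> (inv\<^bsub>M\<^esub> z \<otimes>\<^bsub>M\<^esub> (q \<otimes>\<^bsub>M\<^esub> inv\<^bsub>M\<^esub> r)))))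
      = p \<otimes>\<^bsub>M\<^esub> (inv\<^bsub>M\<^esub> z \<otimes>\<^bsub>M\<^esub> q)"
    if [simp]: "z \<in> carrier M" "p \<in> carrier M" "q \<in> carrier M" "r \<in> carrier M" for z p q r
  proof -
    have "z \<otimes>\<^bsub>M\<^esub> (p \<otimes>\<^bsub>M\<^esub> (r \<otimes>\<^bsub>M\<^esub> (inv\<^bsub>M\<^esub> z \<otimes>\<^bsub>M\<^esub> (inv\<^bsub>M\<^esub> z \<otimes>\<^bsub>M\<^esub> (q \<otimes>\<^bsub>M\<^esub> inv\<^bsub>M\<^esub> r)))))
        = (z \<otimes>\<^bsub>M\<^esub> inv\<^bsub>M\<^esub> z) \<otimes>\<^bsub>M\<^esub> (r \<otimes>\<^bsub>M\<^esub> inv\<^bsub>M\<^esub> r) \<otimes>\<^bsub>M\<^esub> (p \<otimes>\<^bsub>M\<^esub> (inv\<^bsub>M\<^esub> z \<otimes>\<^bsub>M\<^esub> q))"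
      by (simp only: m_ac m_closed inv_closed that)
    then show ?thesis
      by simp
  qed
  show ?thesis
  proof
    show "alexander_op M T x x = x" if "x \<in> carrier M" for x
      using that by (simp add: alexander_op_def one_minus_def m_lcomm)
    show "bij_betw (\<lambda>a. alexander_op M T a x) (carrier M) (carrier M)" if "x \<in> carrier M" for x
      using bij_betw_trans[OF bijT bij_mult[of "one_minus M T x"]] that
      by (simp add: alexander_op_def one_minus_def comp_def)
    show "alexander_op M T (alexander_op M T x y) z
        = alexander_op M T (alexander_op M T x z) (alexander_op M T y z)"
      if "x \<in> carrier M" "y \<in> carrier M" "z \<in> carrier M" for x y z
      using that by (simp add: alexander_op_def one_minus_def inv_mult m_ac cancel)
  qed
qed

subsection \<open>Quandle homology\<close>

text \<open>
  For a homomorphism \<open>f : G \<rightarrow> H\<close> sending a subgroup \<open>R\<close> of \<open>G\<close> into a subgroup \<open>S\<close> of \<open>H\<close>, the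
  map \<open>induced_map H S f\<close> is the homomorphism \<open>G Mod R \<rightarrow> H Mod S\<close>: it sends the coset \<open>R #> x\<close>
  to \<open>S <#> f ` (R #> x) = S #> f x\<close>.
\<close>
definition induced_map :: "('b, 'm) monoid_scheme \<Rightarrow> 'b set \<Rightarrow> ('a \<Rightarrow> 'b) \<Rightarrow> 'a set \<Rightarrow> 'b set"
  where "induced_map H S f A = S <#>\<^bsub>H\<^esub> (f ` A)"

definition tuples :: "'a set \<Rightarrow> nat \<Rightarrow> 'a list set"
  where "tuples X n = {xs. length xs = n \<and> set xs \<subseteq> X}"

definition rack_chain :: "'a set \<Rightarrow> nat \<Rightarrow> ('a list \<Rightarrow>\<^sub>0 int) monoid"
  where "rack_chain X n = free_Abelian_group (tuples X n)"

text \<open>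
  Entries of a list are numbered from 0, so that \<open>xs ! i\<close> is the entry with the index \<open>i + 1\<close> in
  the usual formula; this explains the sign.
\<close>
definition rack_boundary :: "('a \<Rightarrow> 'a \<Rightarrow> 'a) \<Rightarrow> ('a list \<Rightarrow>\<^sub>0 int) \<Rightarrow> ('a list \<Rightarrow>\<^sub>0 int)"
  where "rack_boundary qop = frag_extend (\<lambda>xs. \<Sum>i<length xs.
    frag_cmul ((-1) ^ Suc i)
      (frag_of (take i xs @ drop (Suc i) xs)
       - frag_of (map (\<lambda>a. qop a (xs ! i)) (take i xs) @ drop (Suc i) xs)))"

definition degenerate :: "'a set \<Rightarrow> nat \<Rightarrow> ('a list \<Rightarrow>\<^sub>0 int) set"
  where "degenerate X n = generate (rack_chain X n)
    {frag_of xs | xs. xs \<in> tuples X n \<and> (\<exists>i. Suc i < n \<and> xs ! i = xs ! Suc i)}"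

definition quandle_chain :: "'a set \<Rightarrow> nat \<Rightarrow> ('a list \<Rightarrow>\<^sub>0 int) set monoid"
  where "quandle_chain X n = rack_chain X n Mod degenerate X n"

text \<open>
  The boundary map from degree \<open>n\<close> to degree \<open>n - 1\<close>.  In degree 0 it is the zero map from
  \<open>quandle_chain X 0\<close> to itself, because \<open>0 - 1 = 0\<close> and the empty tuple has boundary 0; its kernel
  is thus everything, as it should be.
\<close>
definition quandle_boundary ::
    "'a set \<Rightarrow> ('a \<Rightarrow> 'a \<Rightarrow> 'a) \<Rightarrow> nat \<Rightarrow> ('a list \<Rightarrow>\<^sub>0 int) set \<Rightarrow> ('a list \<Rightarrow>\<^sub>0 int) set"
  where "quandle_boundary X qop n =
    induced_map (rack_chain X (n - 1)) (degenerate X (n - 1)) (rack_boundary qop)"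

definition quandle_homology ::
    "'a set \<Rightarrow> ('a \<Rightarrow> 'a \<Rightarrow> 'a) \<Rightarrow> nat \<Rightarrow> ('a list \<Rightarrow>\<^sub>0 int) set set monoid"
  where "quandle_homology X qop n =
    (quandle_chain X n)
      \<lparr>carrier := kernel (quandle_chain X n) (quandle_chain X (n - 1)) (quandle_boundary X qop n)\<rparr>
    Mod (quandle_boundary X qop (Suc n) ` carrier (quandle_chain X (Suc n)))"

subsection \<open>Invariants, coinvariants and the exterior square\<close>

definition one_minus_image :: "('a, 'm) monoid_scheme \<Rightarrow> ('a \<Rightarrow> 'a) \<Rightarrow> ('a, 'm) monoid_scheme"
  where "one_minus_image M T = M\<lparr>carrier := one_minus M T ` carrier M\<rparr>"

definition coinvariants :: "('a, 'm) monoid_scheme \<Rightarrow> ('a \<Rightarrow> 'a) \<Rightarrow> 'a set monoid"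
  where "coinvariants N T = N Mod (one_minus N T ` carrier N)"

definition invariants :: "('a, 'm) monoid_scheme \<Rightarrow> ('a \<Rightarrow> 'a) \<Rightarrow> ('a, 'm) monoid_scheme"
  where "invariants N T = N\<lparr>carrier := kernel N N (one_minus N T)\<rparr>"

text \<open>
  The exterior square over the integers, presented by generators \<open>a \<and> b\<close> (the pairs \<open>(a, b)\<close>)
  subject to biadditivity and \<open>a \<and> a = 0\<close>.
\<close>
definition exterior_relations :: "('a, 'm) monoid_scheme \<Rightarrow> ('a \<times> 'a \<Rightarrow>\<^sub>0 int) set"
  where "exterior_relations N = generate (free_Abelian_group (carrier N \<times> carrier N))
    ({frag_of (a \<otimes>\<^bsub>N\<^esub> a', b) - frag_of (a, b) - frag_of (a', b) | a a' b.
        a \<in> carrier N \<and> a' \<in> carrier N \<and> b \<in> carrier N} \<union>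
     {frag_of (a, b \<otimes>\<^bsub>N\<^esub> b') - frag_of (a, b) - frag_of (a, b') | a b b'.
        a \<in> carrier N \<and> b \<in> carrier N \<and> b' \<in> carrier N} \<union>
     {frag_of (a, a) | a. a \<in> carrier N})"

definition exterior_square :: "('a, 'm) monoid_scheme \<Rightarrow> ('a \<times> 'a \<Rightarrow>\<^sub>0 int) set monoid"
  where "exterior_square N =
    free_Abelian_group (carrier N \<times> carrier N) Mod exterior_relations N"

definition diagonal_action ::
    "('a, 'm) monoid_scheme \<Rightarrow> ('a \<Rightarrow> 'a) \<Rightarrow> ('a \<times> 'a \<Rightarrow>\<^sub>0 int) set \<Rightarrow> ('a \<times> 'a \<Rightarrow>\<^sub>0 int) set"
  where "diagonal_action N T =
    induced_map (free_Abelian_group (carrier N \<times> carrier N)) (exterior_relations N)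
      (frag_extend (\<lambda>(a, b). frag_of (T a, T b)))"

end

theory Submission
  imports Defs "HOL-Algebra.Multiplicative_Group"
begin

text \<open>
  Write \<open>M\<close> additively and put \<open>D = 1 - T\<close>, \<open>N = D M\<close> and \<open>A = M / N\<close>.  In degree two the chains are
  spanned by the edges \<open>(x, y)\<close> from \<open>x\<close> to \<open>x * y\<close>, so that \<open>H\<^sub>2\<close> is the first homology of a
  2-complex on the vertex set \<open>M\<close>: its squares say that the paths \<open>x, x * y, (x * y) * z\<close> and
  \<open>x, x * z, (x * z) * (y * z)\<close> agree, and the loops \<open>(x, x)\<close> are contracted.  The vertices of a
  component form a coset of \<open>N\<close>, and translations of \<open>M\<close> identify all components with the component
  \<open>N\<close> of 0.  It remains to show that the latter has the first homology
  \<open>(\<Lambda>\<^sup>2 N)\<^sub>T \<oplus> N\<^sup>T \<oplus> \<int>\<^sup>(\<^sup>A\<^sup>-\<^sup>0\<^sup>)\<close>.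

  The means is a holonomy.  Let \<open>L = (\<Lambda>\<^sup>2 N)\<^sub>T\<close> and let \<open>F\<close> be free on \<open>A - 0\<close>.  On the set
  \<open>N \<times> F \<times> L\<close> there is a group \<open>\<Gamma>\<close>, a central extension by \<open>L\<close>, with a homomorphism
  \<open>pr : \<Gamma> \<rightarrow> N\<close> such that the commutator of \<open>g\<close> and \<open>g'\<close> is \<open>pr g \<and> pr g'\<close> (\<open>\<Gamma>_commutator\<close>).  It is
  generated by elements \<open>h y\<close>, one for each \<open>y\<close> in \<open>M\<close>, with \<open>pr (h y) = D y\<close> and
  \<open>h a \<cdot> h z = h (T z) \<cdot> h (a + D z)\<close> (\<open>h_relation\<close>).  Choose \<open>vert x\<close> over each \<open>x\<close> in \<open>N\<close> and give the
  edge \<open>(x, y)\<close> the weight \<open>vert x \<cdot> (h x)\<^sup>-\<^sup>1 \<cdot> h y \<cdot> (vert (x * y))\<^sup>-\<^sup>1\<close>.  It lies in the kernel \<open>Z0\<close>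
  of \<open>pr\<close>, which is central, and the relation between the \<open>h y\<close> says precisely that weights are
  compatible with the squares (\<open>weight_cocycle\<close>).  So the sum of weights is a homomorphism \<open>\<psi>\<close> from
  the homology of the component to \<open>Z0\<close>.

  It is onto because the \<open>h y\<close> generate \<open>\<Gamma>\<close> (\<open>\<psi>_surjective\<close>).  It is injective (\<open>\<psi>_injective\<close>)
  because the homology carries enough structure to invert it.  There are loops \<open>\<mu> a b\<close>, with the
  holonomy \<open>h a \<cdot> h b \<cdot> (h (a + b))\<^sup>-\<^sup>1\<close>, which form a 2-cocycle on \<open>M\<close> modulo boundaries
  (\<open>\<mu>_cocycle\<close>).  Their commutators \<open>\<mu> a b - \<mu> b a\<close> depend only on \<open>D a \<and> D b\<close>, hence come from a
  homomorphism defined on \<open>L\<close>.  Modulo commutators the cocycle is symmetric and vanishes when one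
  argument lies in \<open>N\<close>; the abelian group that it defines receives a homomorphism from \<open>\<Gamma>\<close>, by which
  the class of a cycle is recovered from its holonomy.

  Finally \<open>Z0\<close> maps to \<open>F\<close> with the kernel \<open>L \<times> N\<^sup>T\<close>.  The image is a subgroup of a free abelian group,
  hence free, and so \<open>Z0\<close> splits (\<open>Z0_iso\<close>).  The image has the rank of \<open>F\<close>: it contains \<open>2 c - c'\<close>
  with \<open>c' = c + c\<close> in \<open>A\<close>, for each basis element \<open>c\<close>, and if \<open>A\<close> is finite, a nonzero
  multiple of \<open>c\<close>.
\<close>

abbreviation "keys \<equiv> Poly_Mapping.keys"
abbreviation "lookup \<equiv> Poly_Mapping.lookup"

section \<open>Homomorphisms out of free abelian groups\<close>

text \<open>
  Extending along the free abelian group on a whole type makes the laws below free of side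
  conditions on supports.
\<close>
definition free_lift :: "('b, 'm) monoid_scheme \<Rightarrow> ('c \<Rightarrow> 'b) \<Rightarrow> ('c \<Rightarrow>\<^sub>0 int) \<Rightarrow> 'b"
  where "free_lift G f =
    (SOME h. h \<in> hom (free_Abelian_group UNIV) G \<and> (\<forall>x. h (frag_of x) = f x))"

context comm_group
begin

lemma free_lift_hom_and_of:
  assumes "\<And>x. f x \<in> carrier G"
  shows "free_lift G f \<in> hom (free_Abelian_group UNIV) G \<and> (\<forall>x. free_lift G f (frag_of x) = f x)"
proof -
  have "f ` UNIV \<subseteq> carrier G"
    using assms by auto
  then obtain h where "h \<in> hom (free_Abelian_group UNIV) G" "\<And>x. h (frag_of x) = f x"
    using free_Abelian_group_universal[of f UNIV] by auto
  then have "\<exists>h. h \<in> hom (free_Abelian_group UNIV) G \<and> (\<forall>x. h (frag_of x) = f x)"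
    by blast
  from someI_ex[OF this] show ?thesis
    unfolding free_lift_def .
qed

lemma free_lift:
  assumes f: "\<And>x. f x \<in> carrier G"
  shows free_lift_of: "free_lift G f (frag_of x) = f x"
    and free_lift_closed: "free_lift G f u \<in> carrier G"
    and free_lift_add: "free_lift G f (u + v) = free_lift G f u \<otimes> free_lift G f v"
    and free_lift_zero: "free_lift G f 0 = \<one>"
    and free_lift_minus: "free_lift G f (- u) = inv (free_lift G f u)"
    and free_lift_diff: "free_lift G f (u - v) = free_lift G f u \<otimes> inv (free_lift G f v)"
proof -
  have *: "free_lift G f \<in> hom (free_Abelian_group UNIV) G"
    using free_lift_hom_and_of[of f, OF f] by blast
  then interpret h: group_hom "free_Abelian_group UNIV" G "free_lift G f"
    by (intro group_hom.intro group_hom_axioms.intro) (auto simp: is_group)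
  show "free_lift G f (frag_of x) = f x"
    using free_lift_hom_and_of[of f, OF f] by blast
  show "free_lift G f u \<in> carrier G" for u
    using h.hom_closed[of u] by simp
  show add: "free_lift G f (u + v) = free_lift G f u \<otimes> free_lift G f v" for u v
    using h.hom_mult[of u v] by simp
  show "free_lift G f 0 = \<one>"
    using h.hom_one by simp
  show minus: "free_lift G f (- u) = inv (free_lift G f u)" for u
    using h.hom_inv[of u] by simp
  show "free_lift G f (u - v) = free_lift G f u \<otimes> inv (free_lift G f v)"
    using add[of u "- v"] by (simp add: minus)
qed

end

lemma hom_free_Abelian_group_diff:
  assumes "group G" "h \<in> hom (free_Abelian_group S) G"
    and "keys u \<subseteq> S" "keys v \<subseteq> S"
  shows "h (u - v) = h u \<otimes>\<^bsub>G\<^esub> inv\<^bsub>G\<^esub> (h v)"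
proof -
  interpret h: group_hom "free_Abelian_group S" G h
    using assms by (intro group_hom.intro group_hom_axioms.intro) auto
  show ?thesis
    using h.hom_mult[of u "- v"] h.hom_inv[of v] assms by simp
qed

lemma hom_free_Abelian_group_eq:
  assumes "group G" "h \<in> hom (free_Abelian_group S) G" "h' \<in> hom (free_Abelian_group S) G"
    and "\<And>x. x \<in> keys u \<Longrightarrow> h (frag_of x) = h' (frag_of x)" "keys u \<subseteq> S"
  shows "h u = h' u"
proof -
  have zero: "h 0 = \<one>\<^bsub>G\<^esub>" "h' 0 = \<one>\<^bsub>G\<^esub>"
    using hom_one[OF assms(2)] hom_one[OF assms(3)] assms(1) by simp_all
  have "keys u \<subseteq> S \<and> h u = h' u"
    using subset_refl[of "keys u"]
  proof (rule frag_induction)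
    show "keys (a - b) \<subseteq> S \<and> h (a - b) = h' (a - b)"
      if "keys a \<subseteq> S \<and> h a = h' a" "keys b \<subseteq> S \<and> h b = h' b" for a b
      using that keys_diff[of a b] hom_free_Abelian_group_diff[OF assms(1,2), of a b]
        hom_free_Abelian_group_diff[OF assms(1,3), of a b] by auto
  qed (use assms zero in auto)
  then show ?thesis ..
qed

lemma (in comm_group) free_lift_pointwise_mult:
  assumes "\<And>x. f x \<in> carrier G" "\<And>x. g x \<in> carrier G"
  shows "free_lift G (\<lambda>x. f x \<otimes> g x) u = free_lift G f u \<otimes> free_lift G g u"
proof (rule hom_free_Abelian_group_eq[OF is_group, of _ UNIV])
  have "\<And>x. f x \<otimes> g x \<in> carrier G"
    using assms by simp
  note L = free_lift[of f, OF assms(1)] free_lift[of g, OF assms(2)] free_lift[of "\<lambda>x. f x \<otimes> g x", OF this]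
  show "free_lift G (\<lambda>x. f x \<otimes> g x) \<in> hom (free_Abelian_group UNIV) G"
    by (rule homI) (simp_all add: L)
  show "(\<lambda>u. free_lift G f u \<otimes> free_lift G g u) \<in> hom (free_Abelian_group UNIV) G"
    by (rule homI) (simp_all add: L m_ac)
  show "free_lift G (\<lambda>x. f x \<otimes> g x) (frag_of x) = free_lift G f (frag_of x) \<otimes> free_lift G g (frag_of x)" for x
    by (simp add: L)
qed auto

section \<open>Cancellation in groups\<close>

lemma (in group) cancel_inv_left:
  "\<lbrakk>x \<in> carrier G; y \<in> carrier G\<rbrakk> \<Longrightarrow> inv x \<otimes> (x \<otimes> y) = y"
  "\<lbrakk>x \<in> carrier G; y \<in> carrier G\<rbrakk> \<Longrightarrow> x \<otimes> (inv x \<otimes> y) = y"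
  by (simp_all flip: m_assoc)

lemma (in comm_group) diff_diff_eq:
  assumes "a \<in> carrier G" "b \<in> carrier G" "c \<in> carrier G" "d \<in> carrier G"
  shows "a \<otimes> inv b \<otimes> inv (c \<otimes> inv d) = a \<otimes> d \<otimes> inv (c \<otimes> b)"
  using assms by (simp add: inv_mult m_ac)

text \<open>
  The rules of an abelian group, used as ordered rewrite rules, move \<open>inv x\<close> to the right of \<open>x\<close>
  but need not make them neighbours.  These instances bridge the gaps that occur below, so that
  \<open>group_normalize\<close> decides small identities.
\<close>
lemma (in comm_group) cancel_gaps:
  "\<lbrakk>x \<in> carrier G; a \<in> carrier G\<rbrakk> \<Longrightarrow> x \<otimes> (a \<otimes> inv x) = a"
  "\<lbrakk>x \<in> carrier G; a \<in> carrier G\<rbrakk> \<Longrightarrow> x \<otimes> (inv x \<otimes> a) = a"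
  "\<lbrakk>x \<in> carrier G; a \<in> carrier G; b \<in> carrier G\<rbrakk> \<Longrightarrow> x \<otimes> (a \<otimes> (b \<otimes> inv x)) = a \<otimes> b"
  "\<lbrakk>x \<in> carrier G; a \<in> carrier G; b \<in> carrier G\<rbrakk> \<Longrightarrow> x \<otimes> (a \<otimes> (inv x \<otimes> b)) = a \<otimes> b"
  "\<lbrakk>x \<in> carrier G; a \<in> carrier G; b \<in> carrier G; c \<in> carrier G\<rbrakk> \<Longrightarrow> x \<otimes> (a \<otimes> (b \<otimes> (c \<otimes> inv x))) = a \<otimes> (b \<otimes> c)"
  "\<lbrakk>x \<in> carrier G; a \<in> carrier G; b \<in> carrier G; c \<in> carrier G\<rbrakk> \<Longrightarrow> x \<otimes> (a \<otimes> (b \<otimes> (inv x \<otimes> c))) = a \<otimes> (b \<otimes> c)"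
  "\<lbrakk>x \<in> carrier G; a \<in> carrier G; b \<in> carrier G; c \<in> carrier G; d \<in> carrier G\<rbrakk> \<Longrightarrow> x \<otimes> (a \<otimes> (b \<otimes> (c \<otimes> (d \<otimes> inv x)))) = a \<otimes> (b \<otimes> (c \<otimes> d))"
  "\<lbrakk>x \<in> carrier G; a \<in> carrier G; b \<in> carrier G; c \<in> carrier G; d \<in> carrier G\<rbrakk> \<Longrightarrow> x \<otimes> (a \<otimes> (b \<otimes> (c \<otimes> (inv x \<otimes> d)))) = a \<otimes> (b \<otimes> (c \<otimes> d))"
proof -
  have swap: "x \<otimes> (a \<otimes> inv x) = a" if "x \<in> carrier G" "a \<in> carrier G" for x a
    using that m_lcomm[of x a "inv x"] by simp
  have swap': "x \<otimes> (a \<otimes> (inv x \<otimes> b)) = a \<otimes> b" if "x \<in> carrier G" "a \<in> carrier G" "b \<in> carrier G" for x a b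
    using that swap[of x a] by (simp flip: m_assoc)
  show "x \<otimes> (a \<otimes> inv x) = a" if "x \<in> carrier G" "a \<in> carrier G" for x a
    using that by (rule swap)
  show "x \<otimes> (inv x \<otimes> a) = a" if "x \<in> carrier G" "a \<in> carrier G" for x a
    using that by (simp flip: m_assoc)
  show "x \<otimes> (a \<otimes> (b \<otimes> inv x)) = a \<otimes> b" if "x \<in> carrier G" "a \<in> carrier G" "b \<in> carrier G" for x a b
    using that swap[of x "a \<otimes> b"] by (simp add: m_assoc)
  show "x \<otimes> (a \<otimes> (inv x \<otimes> b)) = a \<otimes> b" if "x \<in> carrier G" "a \<in> carrier G" "b \<in> carrier G" for x a b
    using that by (rule swap')
  show "x \<otimes> (a \<otimes> (b \<otimes> (c \<otimes> inv x))) = a \<otimes> (b \<otimes> c)" if "x \<in> carrier G" "a \<in> carrier G" "b \<in> carrier G" "c \<in> carrier G" for x a b c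
    using that swap[of x "a \<otimes> (b \<otimes> c)"] by (simp add: m_assoc)
  show "x \<otimes> (a \<otimes> (b \<otimes> (inv x \<otimes> c))) = a \<otimes> (b \<otimes> c)" if "x \<in> carrier G" "a \<in> carrier G" "b \<in> carrier G" "c \<in> carrier G" for x a b c
    using that swap'[of x "a \<otimes> b" c] by (simp add: m_assoc)
  show "x \<otimes> (a \<otimes> (b \<otimes> (c \<otimes> (d \<otimes> inv x)))) = a \<otimes> (b \<otimes> (c \<otimes> d))" if "x \<in> carrier G" "a \<in> carrier G" "b \<in> carrier G" "c \<in> carrier G" "d \<in> carrier G" for x a b c d
    using that swap[of x "a \<otimes> (b \<otimes> (c \<otimes> d))"] by (simp add: m_assoc)
  show "x \<otimes> (a \<otimes> (b \<otimes> (c \<otimes> (inv x \<otimes> d)))) = a \<otimes> (b \<otimes> (c \<otimes> d))" if "x \<in> carrier G" "a \<in> carrier G" "b \<in> carrier G" "c \<in> carrier G" "d \<in> carrier G" for x a b c d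
    using that swap'[of x "a \<otimes> (b \<otimes> c)" d] by (simp add: m_assoc)
qed

lemmas (in comm_group) group_normalize = m_assoc m_comm m_lcomm inv_mult cancel_gaps

section \<open>Extensions by a cocycle\<close>

text \<open>
  The extension of \<open>G\<close> by \<open>L\<close> with the factor set \<open>f\<close>.  It occurs twice: for the holonomy group,
  where \<open>f\<close> is biadditive and not symmetric, and for an abelian group where \<open>f\<close> is symmetric.
\<close>
definition cocycle_extension ::
    "('b, 'm) monoid_scheme \<Rightarrow> ('c, 'n) monoid_scheme \<Rightarrow> ('b \<Rightarrow> 'b \<Rightarrow> 'c) \<Rightarrow> ('b \<times> 'c) monoid"
  where "cocycle_extension G L f =
    \<lparr>carrier = carrier G \<times> carrier L,
     monoid.mult = \<lambda>x y. (fst x \<otimes>\<^bsub>G\<^esub> fst y, snd x \<otimes>\<^bsub>L\<^esub> snd y \<otimes>\<^bsub>L\<^esub> f (fst x) (fst y)),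
     one = (\<one>\<^bsub>G\<^esub>, \<one>\<^bsub>L\<^esub>)\<rparr>"

lemma cocycle_extension_simps [simp]:
  "carrier (cocycle_extension G L f) = carrier G \<times> carrier L"
  "x \<otimes>\<^bsub>cocycle_extension G L f\<^esub> y =
    (fst x \<otimes>\<^bsub>G\<^esub> fst y, snd x \<otimes>\<^bsub>L\<^esub> snd y \<otimes>\<^bsub>L\<^esub> f (fst x) (fst y))"
  "\<one>\<^bsub>cocycle_extension G L f\<^esub> = (\<one>\<^bsub>G\<^esub>, \<one>\<^bsub>L\<^esub>)"
  by (auto simp: cocycle_extension_def)

locale normalized_cocycle = G: group G + L: comm_group L
  for G :: "('b, 'm) monoid_scheme" and L :: "('c, 'n) monoid_scheme" +
  fixes f :: "'b \<Rightarrow> 'b \<Rightarrow> 'c"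
  assumes f_closed: "\<lbrakk>x \<in> carrier G; y \<in> carrier G\<rbrakk> \<Longrightarrow> f x y \<in> carrier L"
    and f_one_left: "x \<in> carrier G \<Longrightarrow> f \<one>\<^bsub>G\<^esub> x = \<one>\<^bsub>L\<^esub>"
    and cocycle: "\<lbrakk>x \<in> carrier G; y \<in> carrier G; z \<in> carrier G\<rbrakk> \<Longrightarrow>
      f x y \<otimes>\<^bsub>L\<^esub> f (x \<otimes>\<^bsub>G\<^esub> y) z = f y z \<otimes>\<^bsub>L\<^esub> f x (y \<otimes>\<^bsub>G\<^esub> z)"
begin

lemma group_cocycle_extension: "group (cocycle_extension G L f)"
proof (rule groupI)
  let ?E = "cocycle_extension G L f"
  show "x \<otimes>\<^bsub>?E\<^esub> y \<otimes>\<^bsub>?E\<^esub> z = x \<otimes>\<^bsub>?E\<^esub> (y \<otimes>\<^bsub>?E\<^esub> z)"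
    if "x \<in> carrier ?E" "y \<in> carrier ?E" "z \<in> carrier ?E" for x y z
  proof -
    obtain a a' b b' c c' where xyz: "x = (a, a')" "y = (b, b')" "z = (c, c')"
      by (cases x, cases y, cases z)
    have [simp]: "a \<in> carrier G" "b \<in> carrier G" "c \<in> carrier G"
       "a' \<in> carrier L" "b' \<in> carrier L" "c' \<in> carrier L"
      using that by (auto simp: xyz)
    have "a' \<otimes>\<^bsub>L\<^esub> b' \<otimes>\<^bsub>L\<^esub> f a b \<otimes>\<^bsub>L\<^esub> c' \<otimes>\<^bsub>L\<^esub> f (a \<otimes>\<^bsub>G\<^esub> b) c
        = a' \<otimes>\<^bsub>L\<^esub> b' \<otimes>\<^bsub>L\<^esub> c' \<otimes>\<^bsub>L\<^esub> (f a b \<otimes>\<^bsub>L\<^esub> f (a \<otimes>\<^bsub>G\<^esub> b) c)"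
      by (simp add: L.m_ac f_closed)
    also have "\<dots> = a' \<otimes>\<^bsub>L\<^esub> (b' \<otimes>\<^bsub>L\<^esub> c' \<otimes>\<^bsub>L\<^esub> f b c) \<otimes>\<^bsub>L\<^esub> f a (b \<otimes>\<^bsub>G\<^esub> c)"
      by (simp add: cocycle L.m_ac f_closed)
    finally show ?thesis
      by (simp add: xyz G.m_assoc)
  qed
  show "\<exists>y\<in>carrier ?E. y \<otimes>\<^bsub>?E\<^esub> x = \<one>\<^bsub>?E\<^esub>" if "x \<in> carrier ?E" for x
  proof -
    obtain a a' where x: "x = (a, a')"
      by (cases x)
    have [simp]: "a \<in> carrier G" "a' \<in> carrier L"
      using that by (auto simp: x)
    let ?b = "inv\<^bsub>L\<^esub> a' \<otimes>\<^bsub>L\<^esub> inv\<^bsub>L\<^esub> (f (inv\<^bsub>G\<^esub> a) a)"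
    have "?b \<otimes>\<^bsub>L\<^esub> a' \<otimes>\<^bsub>L\<^esub> f (inv\<^bsub>G\<^esub> a) a = (inv\<^bsub>L\<^esub> a' \<otimes>\<^bsub>L\<^esub> a') \<otimes>\<^bsub>L\<^esub> (inv\<^bsub>L\<^esub> (f (inv\<^bsub>G\<^esub> a) a) \<otimes>\<^bsub>L\<^esub> f (inv\<^bsub>G\<^esub> a) a)"
      by (simp only: L.m_ac f_closed G.inv_closed L.inv_closed L.m_closed \<open>a \<in> carrier G\<close> \<open>a' \<in> carrier L\<close>)
    then show ?thesis
      by (intro bexI[of _ "(inv\<^bsub>G\<^esub> a, ?b)"]) (auto simp: x f_closed G.l_inv L.l_inv)
  qed
qed (auto simp: f_closed f_one_left)

end

lemma normalized_cocycle_of_biadditive: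
  assumes "group G" "comm_group L"
    and closed: "\<And>x y. \<lbrakk>x \<in> carrier G; y \<in> carrier G\<rbrakk> \<Longrightarrow> f x y \<in> carrier L"
    and left: "\<And>x x' y. \<lbrakk>x \<in> carrier G; x' \<in> carrier G; y \<in> carrier G\<rbrakk> \<Longrightarrow>
      f (x \<otimes>\<^bsub>G\<^esub> x') y = f x y \<otimes>\<^bsub>L\<^esub> f x' y"
    and right: "\<And>x y y'. \<lbrakk>x \<in> carrier G; y \<in> carrier G; y' \<in> carrier G\<rbrakk> \<Longrightarrow>
      f x (y \<otimes>\<^bsub>G\<^esub> y') = f x y \<otimes>\<^bsub>L\<^esub> f x y'"
  shows "normalized_cocycle G L f"
proof -
  interpret G: group G by fact
  interpret L: comm_group L by fact
  show ?thesis
  proof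
    show "f \<one>\<^bsub>G\<^esub> x = \<one>\<^bsub>L\<^esub>" if "x \<in> carrier G" for x
      using left[of "\<one>\<^bsub>G\<^esub>" "\<one>\<^bsub>G\<^esub>" x] closed[of "\<one>\<^bsub>G\<^esub>" x] that L.l_cancel_one' by (metis G.l_one G.one_closed)
  qed (auto simp: closed left right L.m_ac)
qed

lemma (in normalized_cocycle) comm_group_cocycle_extension:
  assumes "comm_group G" and sym: "\<And>x y. \<lbrakk>x \<in> carrier G; y \<in> carrier G\<rbrakk> \<Longrightarrow> f x y = f y x"
  shows "comm_group (cocycle_extension G L f)"
proof -
  interpret C: comm_group G by fact
  interpret E: group "cocycle_extension G L f" by (rule group_cocycle_extension)
  show ?thesis
    by (rule E.group_comm_groupI) (auto simp: C.m_comm L.m_comm sym)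
qed

section \<open>Splitting off a free quotient\<close>

text \<open>
  The complement of the kernel is the image of the section \<open>s\<close>.
\<close>
lemma split_iso:
  assumes "comm_group G" "group F" and h: "h \<in> hom G F" and s: "s \<in> hom F G"
    and hs: "\<And>x. x \<in> carrier F \<Longrightarrow> h (s x) = x"
  shows "G \<cong> G\<lparr>carrier := kernel G F h\<rparr> \<times>\<times> F"
proof -
  interpret G: comm_group G by fact
  interpret F: group F by fact
  interpret h: group_hom G F h using h by unfold_locales
  interpret s: group_hom F G s using s by unfold_locales
  have "(\<lambda>g. (g \<otimes>\<^bsub>G\<^esub> inv\<^bsub>G\<^esub> (s (h g)), h g)) \<in> iso G (G\<lparr>carrier := kernel G F h\<rparr> \<times>\<times> F)"
  proof (rule isoI)
    show "(\<lambda>g. (g \<otimes>\<^bsub>G\<^esub> inv\<^bsub>G\<^esub> (s (h g)), h g)) \<in> hom G (G\<lparr>carrier := kernel G F h\<rparr> \<times>\<times> F)"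
      by (rule homI) (auto simp: kernel_def hs DirProd_def G.inv_mult G.m_ac)
    show "bij_betw (\<lambda>g. (g \<otimes>\<^bsub>G\<^esub> inv\<^bsub>G\<^esub> (s (h g)), h g)) (carrier G)
        (carrier (G\<lparr>carrier := kernel G F h\<rparr> \<times>\<times> F))"
      by (rule bij_betw_byWitness[where f' = "\<lambda>(k, x). k \<otimes>\<^bsub>G\<^esub> s x"])
        (auto simp: kernel_def hs G.m_assoc G.r_inv G.l_inv)
  qed
  then show ?thesis
    by (auto simp: is_iso_def)
qed

corollary split_iso_free:
  assumes "comm_group G" and h: "h \<in> hom G F" and surj: "h ` carrier G = carrier F"
    and F: "group F" "free_Abelian_group S \<cong> F"
  shows "G \<cong> G\<lparr>carrier := kernel G F h\<rparr> \<times>\<times> F"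
proof -
  interpret G: comm_group G by fact
  interpret F: group F by fact
  interpret h: group_hom G F h using h by unfold_locales
  obtain i where i: "i \<in> iso (free_Abelian_group S) F"
    using F by (auto simp: is_iso_def)
  define g where "g a = (SOME x. x \<in> carrier G \<and> h x = i (frag_of a))" for a
  have g: "g a \<in> carrier G" "h (g a) = i (frag_of a)" if "a \<in> S" for a
  proof -
    have "i (frag_of a) \<in> h ` carrier G"
      using i that by (auto simp: iso_def hom_def surj)
    then have "\<exists>x. x \<in> carrier G \<and> h x = i (frag_of a)" by auto
    from someI_ex[OF this] show "g a \<in> carrier G" "h (g a) = i (frag_of a)"
      by (auto simp: g_def)
  qed
  then obtain t where t: "t \<in> hom (free_Abelian_group S) G" "\<And>x. x \<in> S \<Longrightarrow> t (frag_of x) = g x"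
    using G.free_Abelian_group_universal[of g S] by blast
  interpret t: group_hom "free_Abelian_group S" G t
    using t by (intro group_hom.intro group_hom_axioms.intro) (auto simp: G.is_group)
  interpret i: group_hom "free_Abelian_group S" F i
    using i by (intro group_hom.intro group_hom_axioms.intro) (auto simp: F.is_group iso_def)
  have ht: "h (t u) = i u" if "keys u \<subseteq> S" for u
  proof -
    have "keys u \<subseteq> S \<and> h (t u) = i u"
      using that
    proof (induction u rule: frag_induction)
      case zero
      then show ?case using t.hom_one i.hom_one by simp
    next
      case (one x)
      then show ?case by (simp add: t g)
    next
      case (diff a b)
      then have "keys (a - b) \<subseteq> S"
        using keys_diff[of a b] by blast
      moreover have "t (a - b) = t a \<otimes>\<^bsub>G\<^esub> inv\<^bsub>G\<^esub> (t b)" "i (a - b) = i a \<otimes>\<^bsub>F\<^esub> inv\<^bsub>F\<^esub> (i b)"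
        using diff t.hom_mult[of a "- b"] t.hom_inv[of b] i.hom_mult[of a "- b"] i.hom_inv[of b] by auto
      moreover have "t a \<in> carrier G" "t b \<in> carrier G"
        using diff t.hom_closed by auto
      ultimately show ?case
        using diff by simp
    qed
    then show ?thesis ..
  qed
  let ?j = "inv_into (carrier (free_Abelian_group S)) i"
  have j: "?j \<in> iso F (free_Abelian_group S)"
    using i by (intro group.iso_set_sym) auto
  then have j': "?j \<in> hom F (free_Abelian_group S)"
    by (auto simp: iso_def)
  show ?thesis
  proof (rule split_iso[OF assms(1) F(1) h, of "t \<circ> ?j"])
    show "t \<circ> ?j \<in> hom F G"
      using hom_compose[OF j' t(1)] by simp
    show "h ((t \<circ> ?j) x) = x" if "x \<in> carrier F" for x
    proof -
      have "?j x \<in> carrier (free_Abelian_group S)"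
        using j' that by (rule hom_in_carrier)
      moreover have "i (?j x) = x"
        using i that by (intro f_inv_into_f) (auto simp: iso_def bij_betw_def)
      ultimately show ?thesis
        by (simp add: ht)
    qed
  qed
qed

lemma DirProd_assoc_iso: "(G \<times>\<times> H) \<times>\<times> K \<cong> G \<times>\<times> H \<times>\<times> K"
proof -
  have "(\<lambda>((x, y), z). (x, y, z)) \<in> iso ((G \<times>\<times> H) \<times>\<times> K) (G \<times>\<times> H \<times>\<times> K)"
    by (intro isoI homI bij_betw_byWitness[where f' = "\<lambda>(x, y, z). ((x, y), z)"]) (auto simp: DirProd_def)
  then show ?thesis
    by (auto simp: is_iso_def)
qed

section \<open>Subgroups of free abelian groups\<close>

text \<open>
  The well-ordering theorem as a strict order.
\<close>
lemma well_ordered_universe: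
  obtains lt :: "'a \<Rightarrow> 'a \<Rightarrow> bool"
  where "wfP lt" "\<And>x y z. lt x y \<Longrightarrow> lt y z \<Longrightarrow> lt x z" "\<And>x y. x = y \<or> lt x y \<or> lt y x" "\<And>x. \<not> lt x x"
proof -
  obtain r :: "('a \<times> 'a) set" where r: "well_order_on UNIV r"
    using well_order_on by blast
  then have lin: "linear_order_on UNIV r" and wf: "wf (r - Id)"
    by (auto simp: well_order_on_def)
  from lin have tot: "total_on UNIV r" and tr: "trans r" and anti: "antisym r"
    by (auto simp: linear_order_on_def partial_order_on_def preorder_on_def)
  show thesis
  proof (rule that[of "\<lambda>x y. (x, y) \<in> r - Id"])
    show "wfP (\<lambda>x y. (x, y) \<in> r - Id)"
      using wf unfolding wfp_def by (rule back_subst[where P = wf]) auto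
    show "(x, z) \<in> r - Id" if "(x, y) \<in> r - Id" "(y, z) \<in> r - Id" for x y z
      using that tr anti by (auto dest: transD antisymD)
    show "x = y \<or> (x, y) \<in> r - Id \<or> (y, x) \<in> r - Id" for x y
      using tot by (auto simp: total_on_def)
    show "(x, x) \<notin> r - Id" for x
      by simp
  qed
qed

lemma subgroup_free_Abelian_group_iff:
  "subgroup K (free_Abelian_group S) \<longleftrightarrow>
    (\<forall>v\<in>K. keys v \<subseteq> S) \<and> 0 \<in> K \<and> (\<forall>u\<in>K. \<forall>v\<in>K. u - v \<in> K)"
proof
  assume K: "subgroup K (free_Abelian_group S)"
  have keys: "keys v \<subseteq> S" if "v \<in> K" for v
    using subgroup.subset[OF K] that carrier_free_Abelian_group_iff[of v S] by blast
  have "u - v \<in> K" if "u \<in> K" "v \<in> K" for u v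
    using subgroup.m_closed[OF K that(1) subgroup.m_inv_closed[OF K that(2)]] keys[OF that(2)] by simp
  then show "(\<forall>v\<in>K. keys v \<subseteq> S) \<and> 0 \<in> K \<and> (\<forall>u\<in>K. \<forall>v\<in>K. u - v \<in> K)"
    using keys subgroup.one_closed[OF K] by auto
next
  assume *: "(\<forall>v\<in>K. keys v \<subseteq> S) \<and> 0 \<in> K \<and> (\<forall>u\<in>K. \<forall>v\<in>K. u - v \<in> K)"
  have neg: "- v \<in> K" if "v \<in> K" for v
    using * that diff_0 by metis
  have add: "u + v \<in> K" if "u \<in> K" "v \<in> K" for u v
    using * that neg[of v] by (metis diff_minus_eq_add)
  show "subgroup K (free_Abelian_group S)"
    using * neg add by (auto intro!: subgroup.intro)
qed

lemma subgroup_frag_cmul: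
  assumes "subgroup K (free_Abelian_group S)" "v \<in> K"
  shows "frag_cmul n v \<in> K"
  using assms by (intro frag_closure_minus_cmul[where P = "\<lambda>v. v \<in> K"]) (auto simp: subgroup_free_Abelian_group_iff)

text \<open>
  Well-order the basis and call the largest basis element in the support of \<open>v\<close> its leading element.
  Among the elements of \<open>K\<close> with the leading element \<open>c\<close>, let \<open>g c\<close> have the smallest leading
  coefficient in absolute value; it divides the leading coefficient of all others, and well-founded
  induction on the leading element shows that the \<open>g c\<close> form a basis of \<open>K\<close>.  The index set \<open>S'\<close>
  consists of the leading elements that occur; the last clause records that \<open>c\<close> occurs if a nonzero
  multiple of it lies in \<open>K\<close>.
\<close>
theorem subgroup_of_free_Abelian_group:
  assumes K: "subgroup K (free_Abelian_group S)"
  obtains S' g where "S' \<subseteq> S" "frag_extend g \<in> iso (free_Abelian_group S') ((free_Abelian_group S)\<lparr>carrier := K\<rparr>)"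
    "\<And>c n. frag_cmul n (frag_of c) \<in> K \<Longrightarrow> n \<noteq> 0 \<Longrightarrow> c \<in> S'"
proof -
  obtain lt :: "'a \<Rightarrow> 'a \<Rightarrow> bool" where wf: "wfP lt" and trans: "\<And>x y z. lt x y \<Longrightarrow> lt y z \<Longrightarrow> lt x z"
    and total: "\<And>x y. x = y \<or> lt x y \<or> lt y x" and irrefl: "\<And>x. \<not> lt x x"
    by (rule well_ordered_universe) blast
  have greatest: "\<exists>c\<in>keys w. \<forall>x\<in>keys w. x = c \<or> lt x c"
    if "w \<noteq> 0" for w :: "'a \<Rightarrow>\<^sub>0 int"
  proof -
    have "transp_on (keys w) lt" "totalp_on (keys w) lt"
      using trans total unfolding transp_on_def totalp_on_def by blast+
    then show ?thesis
      using Finite_Set.bex_greatest_element[of "keys w" lt] that by auto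
  qed
  define below where "below c = {d. d = c \<or> lt d c}" for c
  define S' where "S' = {c. \<exists>v\<in>K. keys v \<subseteq> below c \<and> lookup v c \<noteq> 0}"
  have keysK: "keys v \<subseteq> S" if "v \<in> K" for v
    using K that by (auto simp: subgroup_free_Abelian_group_iff)
  have diffK: "u - v \<in> K" if "u \<in> K" "v \<in> K" for u v
    using K that by (auto simp: subgroup_free_Abelian_group_iff)
  have zeroK: "0 \<in> K"
    using K by (auto simp: subgroup_free_Abelian_group_iff)
  have "\<exists>g. g \<in> K \<and> keys g \<subseteq> below c \<and> lookup g c \<noteq> 0 \<and>
      (\<forall>v\<in>K. keys v \<subseteq> below c \<longrightarrow> lookup g c dvd lookup v c)"
    if c: "c \<in> S'" for c
  proof -
    let ?P = "\<lambda>v. v \<in> K \<and> keys v \<subseteq> below c \<and> lookup v c \<noteq> 0"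
    define m where "m v = nat \<bar>lookup v c\<bar>" for v
    obtain v0 where "?P v0"
      using c by (auto simp: S'_def)
    then obtain g where g: "?P g" and min: "\<And>v. ?P v \<Longrightarrow> m g \<le> m v"
      using ex_has_least_nat[of ?P v0 m] by blast
    have "lookup g c dvd lookup v c"
      if v: "v \<in> K" "keys v \<subseteq> below c" for v
    proof (rule ccontr)
      let ?d = "lookup g c"
      assume nd: "\<not> ?d dvd lookup v c"
      \<comment> \<open>Division with remainder by the minimal leading coefficient.\<close>
      define w where "w = v - frag_cmul (lookup v c div ?d) g"
      have lw: "lookup w c = lookup v c mod ?d"
        by (simp add: w_def lookup_minus minus_div_mult_eq_mod)
      have "w \<in> K"
        unfolding w_def using v g by (intro diffK subgroup_frag_cmul[OF K]) auto
      moreover have "keys w \<subseteq> below c"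
        unfolding w_def using keys_diff[of v] keys_cmul[of _ g] v g by blast
      moreover have "lookup w c \<noteq> 0"
        using nd by (simp add: lw dvd_eq_mod_eq_0)
      ultimately have "m g \<le> m w"
        using min by blast
      then show False
        using g abs_mod_less[of ?d "lookup v c"] by (simp add: m_def lw)
    qed
    then show ?thesis
      using g by blast
  qed
  then obtain g where gK: "\<And>c. c \<in> S' \<Longrightarrow> g c \<in> K"
    and gb: "\<And>c. c \<in> S' \<Longrightarrow> keys (g c) \<subseteq> below c"
    and g0: "\<And>c. c \<in> S' \<Longrightarrow> lookup (g c) c \<noteq> 0"
    and gdvd: "\<And>c v. c \<in> S' \<Longrightarrow> v \<in> K \<Longrightarrow> keys v \<subseteq> below c \<Longrightarrow>
      lookup (g c) c dvd lookup v c"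
    by metis
  have S': "S' \<subseteq> S"
  proof
    fix c assume "c \<in> S'"
    then have "c \<in> keys (g c)"
      using g0 by (simp add: in_keys_iff)
    then show "c \<in> S"
      using keysK[OF gK] \<open>c \<in> S'\<close> by blast
  qed
  have into: "frag_extend g u \<in> K" if "keys u \<subseteq> S'" for u
    using that by (induction u rule: frag_induction) (auto simp: frag_extend_diff zeroK diffK gK)
  have onto: "\<exists>u. keys u \<subseteq> S' \<and> v = frag_extend g u"
    if "v \<in> K" "keys v \<subseteq> below c" for v c
    using wf that
  proof (induction c arbitrary: v rule: wfp_induct_rule)
    case (less c)
    \<comment> \<open>Below \<open>c\<close> the induction hypothesis applies to the leading element.\<close>
    have lower: "\<exists>u. keys u \<subseteq> S' \<and> w = frag_extend g u"
      if w: "w \<in> K" "keys w \<subseteq> below c" "lookup w c = 0" for w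
    proof (cases "w = 0")
      case True
      then show ?thesis by (intro exI[of _ 0]) simp
    next
      case False
      then obtain d where d: "d \<in> keys w" "\<And>x. x \<in> keys w \<Longrightarrow> x = d \<or> lt x d"
        using greatest by blast
      then have "lt d c" "keys w \<subseteq> below d"
        using w by (auto simp: below_def in_keys_iff)
      then show ?thesis
        using less.IH w by blast
    qed
    show ?case
    proof (cases "lookup v c = 0")
      case True
      then show ?thesis using lower less.prems by blast
    next
      case False
      then have c: "c \<in> S'"
        using less.prems by (auto simp: S'_def)
      then obtain q where q: "lookup v c = lookup (g c) c * q"
        using gdvd[OF c less.prems] unfolding dvd_def by blast
      define w where "w = v - frag_cmul q (g c)"
      have "w \<in> K"
        unfolding w_def using less.prems gK[OF c] by (intro diffK subgroup_frag_cmul[OF K])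
      moreover have "keys w \<subseteq> below c"
        unfolding w_def using keys_diff[of v] keys_cmul[of _ "g c"] less.prems gb[OF c] by blast
      moreover have "lookup w c = 0"
        by (simp add: w_def lookup_minus q)
      ultimately obtain u where u: "keys u \<subseteq> S'" "w = frag_extend g u"
        using lower by blast
      have "v = frag_extend g (u + frag_cmul q (frag_of c))"
        using u(2) by (simp add: frag_extend_add frag_extend_cmul w_def algebra_simps)
      moreover have "keys (u + frag_cmul q (frag_of c)) \<subseteq> S'"
        using u(1) c keys_add[of u] keys_cmul[of q "frag_of c"] by (auto dest!: subsetD[OF keys_add])
      ultimately show ?thesis by blast
    qed
  qed
  have inj: "u = 0" if u: "keys u \<subseteq> S'" "frag_extend g u = 0" for u
  proof (rule ccontr)
    assume "u \<noteq> 0"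
    then obtain c where c: "c \<in> keys u" "\<And>x. x \<in> keys u \<Longrightarrow> x = c \<or> lt x c"
      using greatest by blast
    have "lookup (g d) c = 0" if "d \<in> keys u - {c}" for d
    proof -
      have "lt d c" "d \<in> S'"
        using c(2) that u by auto
      then have "c \<notin> below d"
        using trans irrefl by (auto simp: below_def)
      then show ?thesis
        using gb[OF \<open>d \<in> S'\<close>] by (auto simp: in_keys_iff)
    qed
    then have "lookup (frag_extend g u) c = lookup u c * lookup (g c) c"
      using c(1) by (simp add: frag_extend_def lookup_sum lookup_add sum.remove)
    also have "\<dots> \<noteq> 0"
      using c(1) u(1) g0 by (auto simp: in_keys_iff)
    finally show False
      using u(2) by simp
  qed
  have "frag_extend g \<in> iso (free_Abelian_group S') ((free_Abelian_group S)\<lparr>carrier := K\<rparr>)"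
  proof (rule isoI)
    show "frag_extend g \<in> hom (free_Abelian_group S') ((free_Abelian_group S)\<lparr>carrier := K\<rparr>)"
      by (rule homI) (auto simp: frag_extend_add into)
    have "inj_on (frag_extend g) {u. keys u \<subseteq> S'}"
    proof (rule inj_onI)
      fix u v assume *: "u \<in> {u. keys u \<subseteq> S'}" "v \<in> {u. keys u \<subseteq> S'}"
        "frag_extend g u = frag_extend g v"
      then have "keys (u - v) \<subseteq> S'"
        using keys_diff[of u v] by auto
      then show "u = v"
        using inj[of "u - v"] * by (simp add: frag_extend_diff)
    qed
    moreover have "frag_extend g ` {u. keys u \<subseteq> S'} = K"
    proof
      show "K \<subseteq> frag_extend g ` {u. keys u \<subseteq> S'}"
      proof
        fix v assume v: "v \<in> K"
        show "v \<in> frag_extend g ` {u. keys u \<subseteq> S'}"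
        proof (cases "v = 0")
          case True
          then show ?thesis by (intro image_eqI[of _ _ 0]) auto
        next
          case False
          then obtain c where c: "c \<in> keys v" "\<And>x. x \<in> keys v \<Longrightarrow> x = c \<or> lt x c"
            using greatest by blast
          then have "keys v \<subseteq> below c"
            by (auto simp: below_def)
          then show ?thesis
            using onto[OF v] by blast
        qed
      qed
    qed (auto simp: into)
    ultimately show "bij_betw (frag_extend g) (carrier (free_Abelian_group S'))
        (carrier ((free_Abelian_group S)\<lparr>carrier := K\<rparr>))"
      by (simp add: bij_betw_def free_Abelian_group_def)
  qed
  moreover have "c \<in> S'" if "frag_cmul n (frag_of c) \<in> K" "n \<noteq> 0" for c n
  proof -
    have "keys (frag_cmul n (frag_of c)) \<subseteq> below c"
      using keys_cmul[of n "frag_of c"] by (auto simp: below_def)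
    moreover have "lookup (frag_cmul n (frag_of c)) c \<noteq> 0"
      using that by simp
    ultimately show ?thesis
      unfolding S'_def using that by blast
  qed
  ultimately show thesis
    using that S' by blast
qed

text \<open>
  If \<open>S\<close> is finite then each basis element is a leading element.  If \<open>S\<close> is infinite then it is
  the union of the finite supports of a basis of \<open>K\<close>, which therefore has as many elements as \<open>S\<close>.
\<close>
lemma subgroup_of_free_Abelian_group_same_rank:
  assumes K: "subgroup K (free_Abelian_group S)"
    and fin: "\<And>c. finite S \<Longrightarrow> c \<in> S \<Longrightarrow> \<exists>n. n \<noteq> 0 \<and> frag_cmul n (frag_of c) \<in> K"
    and supp: "\<And>c. c \<in> S \<Longrightarrow> \<exists>v\<in>K. c \<in> keys v"
  shows "free_Abelian_group S \<cong> (free_Abelian_group S)\<lparr>carrier := K\<rparr>"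
proof -
  obtain S' g where S': "S' \<subseteq> S" and g: "frag_extend g \<in> iso (free_Abelian_group S') ((free_Abelian_group S)\<lparr>carrier := K\<rparr>)"
    and mult: "\<And>c n. frag_cmul n (frag_of c) \<in> K \<Longrightarrow> n \<noteq> 0 \<Longrightarrow> c \<in> S'"
    using subgroup_of_free_Abelian_group[OF K] by metis
  have "S \<approx> S'"
  proof (cases "finite S")
    case True
    then have "S' = S"
      using fin mult S' by blast
    then show ?thesis by simp
  next
    case False
    have sub: "S \<subseteq> (\<Union>c\<in>S'. keys (g c))"
    proof
      fix c assume "c \<in> S"
      then obtain v where v: "v \<in> K" "c \<in> keys v"
        using supp by blast
      have "v \<in> frag_extend g ` carrier (free_Abelian_group S')"
        using g v by (auto simp: iso_def bij_betw_def)
      then obtain u where "keys u \<subseteq> S'" "v = frag_extend g u"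
        by auto
      then show "c \<in> (\<Union>c\<in>S'. keys (g c))"
        using v(2) keys_frag_extend[of g u] by blast
    qed
    have inf: "infinite S'"
    proof
      assume "finite S'"
      then have "finite (\<Union>c\<in>S'. keys (g c))"
        by simp
      then show False
        using sub False finite_subset by blast
    qed
    have "|keys (g c)| \<le>o |S'|" for c
      using inf by (intro ordLess_imp_ordLeq) (simp add: finite_ordLess_infinite2)
    then have "|\<Union>c\<in>S'. keys (g c)| \<le>o |S'|"
      using inf by (intro card_of_UNION_ordLeq_infinite) auto
    then have "(\<Union>c\<in>S'. keys (g c)) \<lesssim> S'"
      by (simp add: lepoll_def card_of_ordLeq)
    then have "S \<lesssim> S'"
      using subset_imp_lepoll[OF sub] lepoll_trans by blast
    then show ?thesis
      using S' subset_imp_lepoll lepoll_antisym by blast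
  qed
  then have "free_Abelian_group S \<cong> free_Abelian_group S'"
    by (simp add: isomorphic_free_Abelian_groups)
  also have "\<dots> \<cong> (free_Abelian_group S)\<lparr>carrier := K\<rparr>"
    using g by (auto simp: is_iso_def)
  finally show ?thesis .
qed

text \<open>
  Any total order serves: it only breaks the symmetry between two basis elements.
\<close>
definition some_order :: "'b \<Rightarrow> 'b \<Rightarrow> bool"
  where "some_order = (SOME lt. (\<forall>x y. x = y \<or> lt x y \<or> lt y x) \<and> (\<forall>x y. lt x y \<longrightarrow> \<not> lt y x))"

lemma some_order:
  fixes x y :: 'b
  shows "x = y \<or> some_order x y \<or> some_order y x" "some_order x y \<Longrightarrow> \<not> some_order y x"
proof -
  obtain lt :: "'b \<Rightarrow> 'b \<Rightarrow> bool" where "\<And>x y z. lt x y \<Longrightarrow> lt y z \<Longrightarrow> lt x z"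
    "\<And>x y. x = y \<or> lt x y \<or> lt y x" "\<And>x. \<not> lt x x"
    by (rule well_ordered_universe) blast
  then have "\<exists>lt :: 'b \<Rightarrow> 'b \<Rightarrow> bool. (\<forall>x y. x = y \<or> lt x y \<or> lt y x) \<and> (\<forall>x y. lt x y \<longrightarrow> \<not> lt y x)"
    by (intro exI[of _ lt]) blast
  from someI_ex[OF this] have *: "(\<forall>x y. x = y \<or> some_order x y \<or> some_order y (x :: 'b)) \<and> (\<forall>x y. some_order x y \<longrightarrow> \<not> some_order y (x :: 'b))"
    unfolding some_order_def[symmetric] .
  show "x = y \<or> some_order x y \<or> some_order y x"
    using * by blast
  show "some_order x y \<Longrightarrow> \<not> some_order y x"
    using * by blast
qed

section \<open>Quotient groups\<close>

lemma iso_of_surjections_with_equal_kernels: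
  assumes "group G" "group H" "group K" and h: "h \<in> hom G H" and k: "k \<in> hom G K"
    and surj: "h ` carrier G = carrier H" "k ` carrier G = carrier K"
    and ker: "kernel G H h = kernel G K k"
  shows "H \<cong> K"
proof -
  interpret h: group_hom G H h
    using assms by (intro group_hom.intro group_hom_axioms.intro)
  interpret k: group_hom G K k
    using assms by (intro group_hom.intro group_hom_axioms.intro)
  have "G Mod kernel G H h \<cong> H" "G Mod kernel G H h \<cong> K"
    using h.FactGroup_iso k.FactGroup_iso surj ker by auto
  moreover have "group (G Mod kernel G H h)"
    by (intro normal.factorgroup_is_group h.normal_kernel)
  ultimately show ?thesis
    using group.iso_sym iso_trans by blast
qed

lemma (in comm_group) subgroup_comm_group:
  assumes "subgroup H G"
  shows "comm_group (G\<lparr>carrier := H\<rparr>)"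
  using subgroup_imp_group[OF assms] subgroup.mem_carrier[OF assms]
  by (intro group.group_comm_groupI) (auto simp: m_comm)

lemma induced_map_coset:
  assumes "group G" "group H" and f: "f \<in> hom G H" and R: "subgroup R G" and S: "subgroup S H"
    and RS: "f ` R \<subseteq> S" and x: "x \<in> carrier G"
  shows "induced_map H S f (R #>\<^bsub>G\<^esub> x) = S #>\<^bsub>H\<^esub> f x"
proof -
  interpret G: group G by fact
  interpret H: group H by fact
  interpret f: group_hom G H f using f by unfold_locales
  interpret S: subgroup S H by fact
  interpret R: subgroup R G by fact
  show ?thesis
  proof
    show "induced_map H S f (R #>\<^bsub>G\<^esub> x) \<subseteq> S #>\<^bsub>H\<^esub> f x"
    proof
      fix y assume "y \<in> induced_map H S f (R #>\<^bsub>G\<^esub> x)"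
      then obtain s r where "s \<in> S" "r \<in> R" "y = s \<otimes>\<^bsub>H\<^esub> f (r \<otimes>\<^bsub>G\<^esub> x)"
        by (auto simp: induced_map_def set_mult_def r_coset_def)
      then have "y = (s \<otimes>\<^bsub>H\<^esub> f r) \<otimes>\<^bsub>H\<^esub> f x" "s \<otimes>\<^bsub>H\<^esub> f r \<in> S"
        using x RS by (auto simp: H.m_assoc)
      then show "y \<in> S #>\<^bsub>H\<^esub> f x"
        by (auto simp: r_coset_def)
    qed
    show "S #>\<^bsub>H\<^esub> f x \<subseteq> induced_map H S f (R #>\<^bsub>G\<^esub> x)"
    proof
      fix y assume "y \<in> S #>\<^bsub>H\<^esub> f x"
      then obtain s where "s \<in> S" "y = s \<otimes>\<^bsub>H\<^esub> f (\<one>\<^bsub>G\<^esub> \<otimes>\<^bsub>G\<^esub> x)"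
        using x by (auto simp: r_coset_def)
      then show "y \<in> induced_map H S f (R #>\<^bsub>G\<^esub> x)"
        unfolding induced_map_def set_mult_def r_coset_def using R.one_closed by blast
    qed
  qed
qed

lemma rcoset_eq_iff:
  assumes "group G" "subgroup R G" "x \<in> carrier G" "y \<in> carrier G"
  shows "R #>\<^bsub>G\<^esub> x = R #>\<^bsub>G\<^esub> y \<longleftrightarrow> x \<otimes>\<^bsub>G\<^esub> inv\<^bsub>G\<^esub> y \<in> R"
proof -
  interpret G: group G by fact
  interpret R: subgroup R G by fact
  show ?thesis
  proof
    assume "R #>\<^bsub>G\<^esub> x = R #>\<^bsub>G\<^esub> y"
    then have "x \<in> R #>\<^bsub>G\<^esub> y"
      using G.rcos_self[OF assms(3,2)] by blast
    then obtain r where "r \<in> R" "x = r \<otimes>\<^bsub>G\<^esub> y"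
      by (auto simp: r_coset_def)
    then show "x \<otimes>\<^bsub>G\<^esub> inv\<^bsub>G\<^esub> y \<in> R"
      using assms by (simp add: G.m_assoc)
  next
    assume "x \<otimes>\<^bsub>G\<^esub> inv\<^bsub>G\<^esub> y \<in> R"
    moreover have "x = (x \<otimes>\<^bsub>G\<^esub> inv\<^bsub>G\<^esub> y) \<otimes>\<^bsub>G\<^esub> y"
      using assms by (simp add: G.m_assoc)
    ultimately have "x \<in> R #>\<^bsub>G\<^esub> y"
      unfolding r_coset_def by blast
    then show "R #>\<^bsub>G\<^esub> x = R #>\<^bsub>G\<^esub> y"
      using G.repr_independence[of x R y] assms by blast
  qed
qed

text \<open>
  Two subgroups of chains will be divided out, so the properties of the quotient map are collected
  once.
\<close>
lemma frag_quotient: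
  fixes B :: "('b \<Rightarrow>\<^sub>0 int) set"
  defines "G \<equiv> free_Abelian_group (UNIV :: 'b set)"
  assumes "subgroup B G"
  shows "comm_group (G Mod B)"
    and "B #>\<^bsub>G\<^esub> u \<in> carrier (G Mod B)"
    and "B #>\<^bsub>G\<^esub> (u + w) = (B #>\<^bsub>G\<^esub> u) \<otimes>\<^bsub>G Mod B\<^esub> (B #>\<^bsub>G\<^esub> w)"
    and "B #>\<^bsub>G\<^esub> (u - w) = (B #>\<^bsub>G\<^esub> u) \<otimes>\<^bsub>G Mod B\<^esub> inv\<^bsub>G Mod B\<^esub> (B #>\<^bsub>G\<^esub> w)"
    and "B #>\<^bsub>G\<^esub> 0 = \<one>\<^bsub>G Mod B\<^esub>"
    and "B #>\<^bsub>G\<^esub> u = B #>\<^bsub>G\<^esub> w \<longleftrightarrow> u - w \<in> B"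
proof -
  interpret G: comm_group G
    unfolding G_def by (rule abelian_free_Abelian_group)
  show Q: "comm_group (G Mod B)"
    by (rule G.abelian_FactGroup[OF assms(2)])
  then have gQ: "group (G Mod B)"
    by (rule comm_group.axioms)
  have "B \<lhd> G"
    using assms(2) by (simp add: G.normal_iff_subgroup)
  then have hom: "(\<lambda>u. B #>\<^bsub>G\<^esub> u) \<in> hom G (G Mod B)"
    by (rule normal.r_coset_hom_Mod)
  show "B #>\<^bsub>G\<^esub> u \<in> carrier (G Mod B)"
    using hom_in_carrier[OF hom, of u] by (simp add: G_def)
  show "B #>\<^bsub>G\<^esub> (u + w) = (B #>\<^bsub>G\<^esub> u) \<otimes>\<^bsub>G Mod B\<^esub> (B #>\<^bsub>G\<^esub> w)"
    using hom_mult[OF hom, of u w] by (simp add: G_def)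
  show "B #>\<^bsub>G\<^esub> (u - w) = (B #>\<^bsub>G\<^esub> u) \<otimes>\<^bsub>G Mod B\<^esub> inv\<^bsub>G Mod B\<^esub> (B #>\<^bsub>G\<^esub> w)"
    using hom_free_Abelian_group_diff[OF gQ[unfolded G_def] hom[unfolded G_def], of u w] by (simp add: G_def)
  show "B #>\<^bsub>G\<^esub> 0 = \<one>\<^bsub>G Mod B\<^esub>"
    using hom_one[OF hom G.is_group gQ] by (simp add: G_def)
  show "B #>\<^bsub>G\<^esub> u = B #>\<^bsub>G\<^esub> w \<longleftrightarrow> u - w \<in> B"
    using rcoset_eq_iff[OF G.is_group assms(2), of u w] by (simp add: G_def)
qed

section \<open>Quandle homology in degree two\<close>

definition cycles where
  "cycles X qop = {v. keys v \<subseteq> tuples X 2 \<and> rack_boundary qop v = 0}"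

text \<open>
  The boundaries of the normalized complex, lifted to the unnormalized one: degenerate chains count
  as boundaries.
\<close>
definition boundaries where
  "boundaries X qop = {d + rack_boundary qop t | d t.
     d \<in> degenerate X 2 \<and> keys t \<subseteq> tuples X 3}"

lemma rack_boundary_add: "rack_boundary qop (u + v) = rack_boundary qop u + rack_boundary qop v"
  and rack_boundary_diff: "rack_boundary qop (u - v) = rack_boundary qop u - rack_boundary qop v"
  and rack_boundary_zero [simp]: "rack_boundary qop 0 = 0"
  by (simp_all add: rack_boundary_def frag_extend_add frag_extend_diff)

lemma rack_boundary_2: "rack_boundary qop (frag_of [x, y]) = frag_of [x] - frag_of [qop x y]"
  by (simp add: rack_boundary_def lessThan_Suc numeral_2_eq_2)

lemma rack_boundary_3: "rack_boundary qop (frag_of [x, y, z]) =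
    frag_of [x, z] - frag_of [qop x y, z] - (frag_of [x, y] - frag_of [qop x z, qop y z])"
  by (simp add: rack_boundary_def lessThan_Suc numeral_2_eq_2 numeral_3_eq_3)

lemma tuples_2: "tuples X 2 = {[x, y] | x y. x \<in> X \<and> y \<in> X}"
  by (auto simp: tuples_def numeral_2_eq_2 length_Suc_conv)

lemma tuples_3: "tuples X 3 = {[x, y, z] | x y z. x \<in> X \<and> y \<in> X \<and> z \<in> X}"
  by (auto simp: tuples_def numeral_3_eq_3 length_Suc_conv)

lemma subgroup_degenerate: "subgroup (degenerate X n) (rack_chain X n)"
  unfolding degenerate_def
  by (rule group.generate_is_subgroup) (auto simp: rack_chain_def)

lemma degenerate_induct [consumes 1, case_names zero gen diff]:
  assumes "v \<in> degenerate X n" and "P 0"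
    and "\<And>xs i. xs \<in> tuples X n \<Longrightarrow> Suc i < n \<Longrightarrow> xs ! i = xs ! Suc i \<Longrightarrow> P (frag_of xs)"
    and "\<And>u v. P u \<Longrightarrow> P v \<Longrightarrow> P (u - v)"
  shows "P v"
  using assms(1) unfolding degenerate_def
proof (induction rule: generate.induct)
  case one
  then show ?case by (simp add: rack_chain_def assms(2))
next
  case (incl h)
  then show ?case using assms(3) by auto
next
  case (inv h)
  then obtain xs i where "h = frag_of xs" "xs \<in> tuples X n" "Suc i < n" "xs ! i = xs ! Suc i"
    by auto
  then show ?case
    using assms(4)[OF assms(2) assms(3)[of xs i]] by (simp add: rack_chain_def)
next
  case (eng h1 h2)
  then have "P (h1 - (0 - h2))"
    using assms(2,4) by blast
  then show ?case by (simp add: rack_chain_def)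
qed

context quandle
begin

lemma degenerate_1: "degenerate X 1 = {0}"
proof -
  have "v = 0" if "v \<in> degenerate X 1" for v
    using that by (induction rule: degenerate_induct) auto
  moreover have "0 \<in> degenerate X 1"
    using subgroup.one_closed[OF subgroup_degenerate[of X 1]] by (simp add: rack_chain_def)
  ultimately show ?thesis by blast
qed

lemma op_closed: "x \<in> X \<Longrightarrow> y \<in> X \<Longrightarrow> qop x y \<in> X"
  using bij by (auto simp: bij_betw_def)

lemma frag_of_degenerate: "x \<in> X \<Longrightarrow> frag_of [x, x] \<in> degenerate X 2"
  unfolding degenerate_def tuples_2 by (rule generate.incl) (auto intro!: exI[of _ "[x, x]"] exI[of _ 0])

lemma degenerate_closed:
  assumes "u \<in> degenerate X n" "v \<in> degenerate X n"
  shows "u - v \<in> degenerate X n" "u + v \<in> degenerate X n" "- v \<in> degenerate X n" "0 \<in> degenerate X n"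
proof -
  have *: "\<And>u v. u \<in> degenerate X n \<Longrightarrow> v \<in> degenerate X n \<Longrightarrow> u - v \<in> degenerate X n"
    using subgroup_degenerate[of X n] unfolding rack_chain_def subgroup_free_Abelian_group_iff by blast
  show "u - v \<in> degenerate X n" by (rule *[OF assms])
  show z: "0 \<in> degenerate X n" using *[OF assms(1,1)] by simp
  show n: "- v \<in> degenerate X n" using *[OF z assms(2)] by simp
  show "u + v \<in> degenerate X n" using *[OF assms(1) n] by simp
qed

lemma boundary_degenerate_2: "v \<in> degenerate X 2 \<Longrightarrow> rack_boundary qop v = 0"
proof (induction rule: degenerate_induct)
  case (gen xs i)
  then obtain x where "xs = [x, x]" "x \<in> X" by (auto simp: tuples_2)
  then show ?case by (simp add: rack_boundary_2 idem)
qed (auto simp: rack_boundary_diff)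

lemma boundary_degenerate_3: "v \<in> degenerate X 3 \<Longrightarrow> rack_boundary qop v \<in> degenerate X 2"
proof (induction rule: degenerate_induct)
  case zero
  then show ?case using subgroup_degenerate[of X 2] by (simp add: rack_chain_def subgroup_free_Abelian_group_iff)
next
  case (gen xs i)
  then obtain x y z where xs: "xs = [x, y, z]" and [simp]: "x \<in> X" "y \<in> X" "z \<in> X"
    by (auto simp: tuples_3)
  have "i = 0 \<or> i = 1" using gen by auto
  then show ?case
  proof
    assume "i = 0"
    then have [simp]: "y = x" using gen by (simp add: xs)
    have "rack_boundary qop (frag_of xs) = frag_of [qop x z, qop x z] - frag_of [x, x]"
      by (simp add: xs rack_boundary_3 idem)
    then show ?thesis
      using degenerate_closed(1)[OF frag_of_degenerate frag_of_degenerate] op_closed by simp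
  next
    assume "i = 1"
    then have [simp]: "z = y" using gen by (simp add: xs)
    have "rack_boundary qop (frag_of xs) = 0"
      by (simp add: xs rack_boundary_3 idem)
    then show ?thesis
      using degenerate_closed(4)[OF frag_of_degenerate[OF \<open>x \<in> X\<close>] frag_of_degenerate[OF \<open>x \<in> X\<close>]] by simp
  qed
qed (auto simp: rack_boundary_diff degenerate_closed)

lemma boundary_boundary: "keys t \<subseteq> tuples X 3 \<Longrightarrow> rack_boundary qop (rack_boundary qop t) = 0"
  by (induction t rule: frag_induction)
    (auto simp: rack_boundary_diff tuples_3 rack_boundary_3 rack_boundary_2 self_distrib)

lemma keys_boundary_3: "keys t \<subseteq> tuples X 3 \<Longrightarrow> keys (rack_boundary qop t) \<subseteq> tuples X 2"
proof (induction t rule: frag_induction)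
  case (one xs)
  then obtain x y z where xs: "xs = [x, y, z]" and [simp]: "x \<in> X" "y \<in> X" "z \<in> X"
    by (auto simp: tuples_3)
  show ?case
    unfolding xs rack_boundary_3
    by (intro order_trans[OF keys_diff] Un_least) (auto simp: keys_frag_of tuples_2 op_closed)
next
  case (diff a b)
  then show ?case
    unfolding rack_boundary_diff by (intro order_trans[OF keys_diff] Un_least)
qed auto

lemma keys_boundary_2: "keys v \<subseteq> tuples X 2 \<Longrightarrow> keys (rack_boundary qop v) \<subseteq> tuples X 1"
proof (induction v rule: frag_induction)
  case (one xs)
  then obtain x y where xs: "xs = [x, y]" and [simp]: "x \<in> X" "y \<in> X"
    by (auto simp: tuples_2)
  show ?case
    unfolding xs rack_boundary_2
    by (intro order_trans[OF keys_diff] Un_least) (auto simp: keys_frag_of tuples_def op_closed)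
next
  case (diff a b)
  then show ?case
    unfolding rack_boundary_diff by (intro order_trans[OF keys_diff] Un_least)
qed auto

lemma hom_boundary: 
  "rack_boundary qop \<in> hom (rack_chain X 3) (rack_chain X 2)"
  "rack_boundary qop \<in> hom (rack_chain X 2) (rack_chain X 1)"
  using keys_boundary_3 keys_boundary_2
  by (auto simp: hom_def rack_chain_def rack_boundary_add simp del: One_nat_def)

lemma subgroup_cycles: "subgroup (cycles X qop) (rack_chain X 2)"
  unfolding rack_chain_def subgroup_free_Abelian_group_iff
  by (auto simp: cycles_def rack_boundary_diff dest!: subsetD[OF keys_diff])

text \<open>
  The homology group is a quotient of a subgroup of a quotient.  Since degenerate 1-chains vanish
  and degenerate 2-chains have boundary 0, its cycles lift to honest cycles, and the group is the
  quotient of those by \<open>boundaries\<close>; so any surjection with that kernel computes it.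
\<close>
theorem quandle_homology_2_iso:
  assumes "group G" and \<psi>: "\<psi> \<in> hom ((rack_chain X 2)\<lparr>carrier := cycles X qop\<rparr>) G"
    and surj: "\<psi> ` cycles X qop = carrier G"
    and ker: "\<And>v. v \<in> cycles X qop \<Longrightarrow> \<psi> v = \<one>\<^bsub>G\<^esub> \<longleftrightarrow> v \<in> boundaries X qop"
  shows "quandle_homology X qop 2 \<cong> G"
proof -
  let ?F = "rack_chain X 2" and ?D = "degenerate X 2" and ?C = "quandle_chain X 2"
  let ?Z = "?F\<lparr>carrier := cycles X qop\<rparr>" and ?d = "rack_boundary qop"
  let ?K = "kernel ?C (quandle_chain X 1) (quandle_boundary X qop 2)"
  let ?H = "?C\<lparr>carrier := ?K\<rparr>" and ?I = "quandle_boundary X qop 3 ` carrier (quandle_chain X 3)"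
  interpret F: comm_group ?F
    by (simp add: rack_chain_def abelian_free_Abelian_group)
  interpret Z: group ?Z
    by (rule F.subgroup_imp_group[OF subgroup_cycles])
  have gC: "group (quandle_chain X n)" for n
    unfolding quandle_chain_def
    by (rule comm_group.axioms) (auto simp: rack_chain_def intro!: comm_group.abelian_FactGroup abelian_free_Abelian_group subgroup_degenerate[unfolded rack_chain_def])
  interpret C: comm_group ?C
    unfolding quandle_chain_def by (rule F.abelian_FactGroup[OF subgroup_degenerate])
  have diff_2_1: "2 - 1 = (1::nat)" and diff_3_1: "3 - 1 = (2::nat)"
    by simp_all
  have d2: "quandle_boundary X qop 2 (?D #>\<^bsub>?F\<^esub> v) = {?d v}" if "v \<in> carrier ?F" for v
  proof -
    have "quandle_boundary X qop 2 (?D #>\<^bsub>?F\<^esub> v) = degenerate X 1 #>\<^bsub>rack_chain X 1\<^esub> ?d v"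
      unfolding quandle_boundary_def diff_2_1 using that
      by (intro induced_map_coset[OF F.is_group _ hom_boundary(2) subgroup_degenerate subgroup_degenerate])
        (auto simp: boundary_degenerate_2 degenerate_1 rack_chain_def simp del: One_nat_def)
    also have "\<dots> = {?d v}"
      unfolding degenerate_1 by (simp add: r_coset_def rack_chain_def)
    finally show ?thesis .
  qed
  have d3: "quandle_boundary X qop 3 (degenerate X 3 #>\<^bsub>rack_chain X 3\<^esub> t) = ?D #>\<^bsub>?F\<^esub> ?d t"
    if "t \<in> carrier (rack_chain X 3)" for t
    unfolding quandle_boundary_def diff_3_1 using that
    by (intro induced_map_coset[OF _ F.is_group hom_boundary(1) subgroup_degenerate subgroup_degenerate])
      (auto simp: boundary_degenerate_3 rack_chain_def)
  have one1: "\<one>\<^bsub>quandle_chain X 1\<^esub> = {0}"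
    by (simp add: quandle_chain_def degenerate_1 del: One_nat_def)
  have carrierC: "carrier (quandle_chain X n) = (\<lambda>v. degenerate X n #>\<^bsub>rack_chain X n\<^esub> v) ` carrier (rack_chain X n)" for n
    by (simp add: quandle_chain_def carrier_FactGroup)
  have K: "?K = (\<lambda>v. ?D #>\<^bsub>?F\<^esub> v) ` cycles X qop"
    unfolding kernel_def one1 carrierC using d2 by (auto simp: cycles_def rack_chain_def)
  have q1: "(\<lambda>v. ?D #>\<^bsub>?F\<^esub> v) \<in> hom ?F ?C"
    unfolding quandle_chain_def by (rule normal.r_coset_hom_Mod)
      (simp add: F.normal_iff_subgroup subgroup_degenerate)
  then have q: "(\<lambda>v. ?D #>\<^bsub>?F\<^esub> v) \<in> hom ?Z ?H"
    using subgroup.subset[OF subgroup_cycles]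
    by (intro homI) (auto simp: K hom_mult[OF q1] subset_iff simp del: One_nat_def)
  interpret q1: group_hom ?F ?C "\<lambda>v. ?D #>\<^bsub>?F\<^esub> v"
    using q1 by unfold_locales
  have sK: "subgroup ?K ?C"
    unfolding K by (rule q1.subgroup_img_is_subgroup[OF subgroup_cycles])
  interpret H: comm_group ?H
    by (rule C.subgroup_comm_group[OF sK])
  interpret q: group_hom ?Z ?H "\<lambda>v. ?D #>\<^bsub>?F\<^esub> v"
    using q by unfold_locales
  have I: "?I = (\<lambda>v. ?D #>\<^bsub>?F\<^esub> v) ` ?d ` carrier (rack_chain X 3)"
    unfolding carrierC image_image using d3 by auto
  have "subgroup (?d ` carrier (rack_chain X 3)) ?Z"
  proof -
    have "?d \<in> hom (rack_chain X 3) ?Z"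
      using hom_boundary(1) by (auto simp: hom_def cycles_def boundary_boundary rack_chain_def Pi_def)
    then interpret d: group_hom "rack_chain X 3" ?Z ?d
      by (intro group_hom.intro group_hom_axioms.intro) (auto simp: rack_chain_def Z.is_group[unfolded rack_chain_def])
    show ?thesis by (rule d.img_is_subgroup)
  qed
  then have subI: "subgroup ?I ?H"
    unfolding I by (rule q.subgroup_img_is_subgroup)
  have nI: "?I \<lhd> ?H"
    using subI H.normal_iff_subgroup by blast
  have homol: "quandle_homology X qop 2 = ?H Mod ?I"
    by (simp add: quandle_homology_def)
  have p: "(\<lambda>A. ?I #>\<^bsub>?H\<^esub> A) \<in> hom ?H (?H Mod ?I)"
    by (rule normal.r_coset_hom_Mod[OF nI])
  let ?k = "\<lambda>v. ?I #>\<^bsub>?H\<^esub> (?D #>\<^bsub>?F\<^esub> v)"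
  have k: "?k \<in> hom ?Z (?H Mod ?I)"
    using hom_compose[OF q p] by (simp add: comp_def)
  have ksurj: "?k ` carrier ?Z = carrier (?H Mod ?I)"
    unfolding carrier_FactGroup using K by (auto simp: image_image simp del: One_nat_def)
  have kker: "?k v = ?I \<longleftrightarrow> v \<in> boundaries X qop" if v: "v \<in> cycles X qop" for v
  proof -
    have vF: "v \<in> carrier ?F" using v by (simp add: cycles_def rack_chain_def)
    have "?D #>\<^bsub>?F\<^esub> v \<in> carrier ?H"
      using q.hom_closed[of v] v by simp
    then have "?k v = ?I \<longleftrightarrow> ?D #>\<^bsub>?F\<^esub> v \<in> ?I"
      using H.coset_join1[of ?I "?D #>\<^bsub>?F\<^esub> v"] subgroup.subset[OF subI] subI H.coset_join2[OF _ subI] by blast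
    also have "\<dots> \<longleftrightarrow> (\<exists>t. t \<in> carrier (rack_chain X 3) \<and> ?D #>\<^bsub>?F\<^esub> v = ?D #>\<^bsub>?F\<^esub> ?d t)"
      unfolding I by auto
    also have "\<dots> \<longleftrightarrow> (\<exists>t. t \<in> carrier (rack_chain X 3) \<and> v - ?d t \<in> ?D)"
      using rcoset_eq_iff[OF F.is_group subgroup_degenerate[of X 2] vF] hom_boundary(1)
      by (auto simp: hom_def Pi_def rack_chain_def)
    also have "\<dots> \<longleftrightarrow> v \<in> boundaries X qop"
    proof -
      have "(\<exists>d. v = d + w \<and> d \<in> ?D) \<longleftrightarrow> v - w \<in> ?D" for w
        by (metis add_diff_cancel diff_add_cancel)
      then show ?thesis
        unfolding boundaries_def by (simp add: rack_chain_def) blast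
    qed
    finally show ?thesis .
  qed
  have "kernel ?Z (?H Mod ?I) ?k = kernel ?Z G \<psi>"
    using kker ker by (auto simp: kernel_def)
  then show ?thesis
    unfolding homol
    by (intro iso_of_surjections_with_equal_kernels[OF Z.is_group normal.factorgroup_is_group[OF nI] \<open>group G\<close> k \<psi> ksurj])
      (auto simp: surj)
qed

end

section \<open>Coinvariants of the exterior square\<close>

text \<open>
  For \<open>N\<close> with an endomorphism \<open>T\<close>, the coinvariants of \<open>\<Lambda>\<^sup>2 N\<close> are characterized below by the
  biadditive, alternating and \<open>T\<close>-invariant map \<open>wedge\<close> from \<open>N \<times> N\<close>, which generates them
  (\<open>wedge_generate\<close>) and is universal (\<open>wedge_universal\<close>).  Later sections work with
  these properties instead of cosets.
\<close>
locale group_endomorphism = N: comm_group N for N :: "('a, 'm) monoid_scheme" (structure) +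
  fixes T :: "'a \<Rightarrow> 'a"
  assumes T_hom: "T \<in> hom N N"
begin

sublocale T: group_hom N N T
  using T_hom by unfold_locales

lemma one_minus_closed [simp]: "x \<in> carrier N \<Longrightarrow> one_minus N T x \<in> carrier N"
  by (simp add: one_minus_def)

lemma one_minus_hom: "one_minus N T \<in> hom N N"
  by (rule homI) (auto simp: one_minus_def N.inv_mult N.m_ac)

sublocale one_minus: group_hom N N "one_minus N T"
  using one_minus_hom by unfold_locales

lemma subgroup_one_minus_image: "subgroup (one_minus N T ` carrier N) N"
  by (rule one_minus.img_is_subgroup)

lemma comm_group_coinvariants: "comm_group (coinvariants N T)"
  unfolding coinvariants_def by (rule N.abelian_FactGroup[OF subgroup_one_minus_image])

end

context group_endomorphism
begin

abbreviation "E2 \<equiv> exterior_square N"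
abbreviation "Rel \<equiv> exterior_relations N"
abbreviation "FN \<equiv> free_Abelian_group (carrier N \<times> carrier N)"
abbreviation "\<tau> \<equiv> diagonal_action N T"

definition wedge_coinvariants :: "('a \<times> 'a \<Rightarrow>\<^sub>0 int) set set monoid"
  where "wedge_coinvariants = coinvariants E2 \<tau>"

definition wedge0 where "wedge0 a b = Rel #>\<^bsub>FN\<^esub> frag_of (a, b)"

definition wedge where
  "wedge a b = one_minus E2 \<tau> ` carrier E2 #>\<^bsub>E2\<^esub> wedge0 a b"

lemma subgroup_exterior_relations: "subgroup (Rel) FN"
  unfolding exterior_relations_def
  by (rule group.generate_is_subgroup) (auto dest!: subsetD[OF keys_diff] simp: keys_frag_of)

lemma exterior_relations:
  "\<lbrakk>a \<in> carrier N; a' \<in> carrier N; b \<in> carrier N\<rbrakk> \<Longrightarrow>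
     frag_of (a \<otimes> a', b) - frag_of (a, b) - frag_of (a', b) \<in> Rel"
  "\<lbrakk>a \<in> carrier N; b \<in> carrier N; b' \<in> carrier N\<rbrakk> \<Longrightarrow>
     frag_of (a, b \<otimes> b') - frag_of (a, b) - frag_of (a, b') \<in> Rel"
  "a \<in> carrier N \<Longrightarrow> frag_of (a, a) \<in> Rel"
  unfolding exterior_relations_def by (rule generate.incl; blast)+

lemma comm_group_exterior_square: "comm_group E2"
  unfolding exterior_square_def
  by (rule comm_group.abelian_FactGroup[OF abelian_free_Abelian_group subgroup_exterior_relations])

lemma wedge0_hom: "(\<lambda>v. Rel #>\<^bsub>FN\<^esub> v) \<in> hom FN E2"
  unfolding exterior_square_def
  by (rule normal.r_coset_hom_Mod)
    (use comm_group.normal_iff_subgroup[OF abelian_free_Abelian_group] subgroup_exterior_relations in blast)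

lemma exterior_square_universal:
  fixes G :: "('g, 'n) monoid_scheme"
  assumes "comm_group G" and f: "\<And>a b. \<lbrakk>a \<in> carrier N; b \<in> carrier N\<rbrakk> \<Longrightarrow> f a b \<in> carrier G"
    and left: "\<And>a a' b. \<lbrakk>a \<in> carrier N; a' \<in> carrier N; b \<in> carrier N\<rbrakk> \<Longrightarrow>
      f (a \<otimes> a') b = f a b \<otimes>\<^bsub>G\<^esub> f a' b"
    and right: "\<And>a b b'. \<lbrakk>a \<in> carrier N; b \<in> carrier N; b' \<in> carrier N\<rbrakk> \<Longrightarrow>
      f a (b \<otimes> b') = f a b \<otimes>\<^bsub>G\<^esub> f a b'"
    and alt: "\<And>a. a \<in> carrier N \<Longrightarrow> f a a = \<one>\<^bsub>G\<^esub>"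
  obtains g where "g \<in> hom E2 G"
    "\<And>a b. \<lbrakk>a \<in> carrier N; b \<in> carrier N\<rbrakk> \<Longrightarrow> g (wedge0 a b) = f a b"
proof -
  interpret G: comm_group G by fact
  have "(\<lambda>(a, b). f a b) ` (carrier N \<times> carrier N) \<subseteq> carrier G"
    using f by auto
  then obtain h where h: "h \<in> hom FN G" "\<And>x. x \<in> carrier N \<times> carrier N \<Longrightarrow> h (frag_of x) = (\<lambda>(a, b). f a b) x"
    using G.free_Abelian_group_universal by metis
  interpret h: group_hom FN G h
    using h by (intro group_hom.intro group_hom_axioms.intro) (auto simp: G.is_group)
  note hdiff = hom_free_Abelian_group_diff[OF G.is_group h(1)]
  have cancel: "x \<otimes>\<^bsub>G\<^esub> y \<otimes>\<^bsub>G\<^esub> inv\<^bsub>G\<^esub> x \<otimes>\<^bsub>G\<^esub> inv\<^bsub>G\<^esub> y = \<one>\<^bsub>G\<^esub>"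
    if "x \<in> carrier G" "y \<in> carrier G" for x y
    using that by (simp add: G.m_comm[of x y] G.m_assoc)
  have "Rel \<subseteq> kernel FN G h"
    unfolding exterior_relations_def
  proof (rule group.generate_subgroup_incl[OF group_free_Abelian_group _ h.subgroup_kernel], clarify, elim UnE)
    fix r
    assume "r \<in> {frag_of (a \<otimes> a', b) - frag_of (a, b) - frag_of (a', b) |a a' b.
      a \<in> carrier N \<and> a' \<in> carrier N \<and> b \<in> carrier N}"
    then obtain a a' b where r: "r = frag_of (a \<otimes> a', b) - frag_of (a, b) - frag_of (a', b)"
      and [simp]: "a \<in> carrier N" "a' \<in> carrier N" "b \<in> carrier N"
      by blast
    have k: "keys (frag_of (a \<otimes> a', b) - frag_of (a, b)) \<subseteq> carrier N \<times> carrier N"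
      by (rule order_trans[OF keys_diff]) (simp add: keys_frag_of)
    moreover have "keys r \<subseteq> carrier N \<times> carrier N"
      unfolding r by (rule order_trans[OF keys_diff]) (use k in \<open>simp add: keys_frag_of\<close>)
    ultimately show "r \<in> kernel FN G h"
      by (simp add: kernel_def, simp add: r hdiff keys_frag_of h(2) left f cancel)
  next
    fix r
    assume "r \<in> {frag_of (a, b \<otimes> b') - frag_of (a, b) - frag_of (a, b') |a b b'.
      a \<in> carrier N \<and> b \<in> carrier N \<and> b' \<in> carrier N}"
    then obtain a b b' where r: "r = frag_of (a, b \<otimes> b') - frag_of (a, b) - frag_of (a, b')"
      and [simp]: "a \<in> carrier N" "b \<in> carrier N" "b' \<in> carrier N"
      by blast
    have k: "keys (frag_of (a, b \<otimes> b') - frag_of (a, b)) \<subseteq> carrier N \<times> carrier N"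
      by (rule order_trans[OF keys_diff]) (simp add: keys_frag_of)
    moreover have "keys r \<subseteq> carrier N \<times> carrier N"
      unfolding r by (rule order_trans[OF keys_diff]) (use k in \<open>simp add: keys_frag_of\<close>)
    ultimately show "r \<in> kernel FN G h"
      by (simp add: kernel_def, simp add: r hdiff keys_frag_of h(2) right f cancel)
  qed (auto simp: kernel_def h(2) alt)
  then obtain g where "g \<in> hom (FN Mod Rel) G"
    "\<And>x. x \<in> carrier FN \<Longrightarrow> g (Rel #>\<^bsub>FN\<^esub> x) = h x"
    using h.FactGroup_universal_kernel[of "Rel"] subgroup_exterior_relations
      comm_group.normal_iff_subgroup[OF abelian_free_Abelian_group] by metis
  then show thesis
    using that[of g] h(2) by (auto simp: exterior_square_def wedge0_def)
qed

text \<open>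
  The diagonal action before relations are divided out.
\<close>
abbreviation "\<phi> \<equiv> frag_extend (\<lambda>(a, b). frag_of (T a, T b))"

lemma keys_\<phi>: "keys v \<subseteq> carrier N \<times> carrier N \<Longrightarrow> keys (\<phi> v) \<subseteq> carrier N \<times> carrier N"
  using keys_frag_extend[of "\<lambda>(a, b). frag_of (T a, T b)" v] by (fastforce simp: keys_frag_of)

lemma hom_\<phi>: "\<phi> \<in> hom FN FN"
  using keys_\<phi> by (auto simp: hom_def frag_extend_add)

lemma \<phi>_exterior_relations: "\<phi> ` Rel \<subseteq> Rel"
proof -
  interpret \<phi>: group_hom FN FN \<phi>
    using hom_\<phi> by (intro group_hom.intro group_hom_axioms.intro) auto
  have "\<phi> ` Rel = generate FN (\<phi> `
      ({frag_of (a \<otimes> a', b) - frag_of (a, b) - frag_of (a', b) | a a' b.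
          a \<in> carrier N \<and> a' \<in> carrier N \<and> b \<in> carrier N} \<union>
       {frag_of (a, b \<otimes> b') - frag_of (a, b) - frag_of (a, b') | a b b'.
          a \<in> carrier N \<and> b \<in> carrier N \<and> b' \<in> carrier N} \<union>
       {frag_of (a, a) | a. a \<in> carrier N}))" (is "_ = generate FN (\<phi> ` ?R)")
    unfolding exterior_relations_def
    by (rule \<phi>.generate_img[symmetric]) (auto dest!: subsetD[OF keys_diff] simp: keys_frag_of)
  also have "\<dots> \<subseteq> Rel"
  proof (rule group.generate_subgroup_incl[OF group_free_Abelian_group _ subgroup_exterior_relations])
    show "\<phi> ` ?R \<subseteq> Rel"
      by (auto simp: frag_extend_diff exterior_relations)
  qed
  finally show ?thesis .
qed

lemma diagonal_action_coset:
  "v \<in> carrier FN \<Longrightarrow> \<tau> (Rel #>\<^bsub>FN\<^esub> v) = Rel #>\<^bsub>FN\<^esub> \<phi> v"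
  unfolding diagonal_action_def
  by (rule induced_map_coset) (simp_all add: hom_\<phi> \<phi>_exterior_relations subgroup_exterior_relations)

lemma carrier_exterior_square:
  "carrier E2 = (\<lambda>v. Rel #>\<^bsub>FN\<^esub> v) ` carrier FN"
  by (simp add: exterior_square_def carrier_FactGroup)

lemma group_endomorphism_exterior_square: "group_endomorphism E2 \<tau>"
proof -
  interpret E: comm_group "E2"
    by (rule comm_group_exterior_square)
  have "\<tau> \<in> hom E2 E2"
  proof (rule homI)
    show "\<tau> x \<in> carrier E2" if "x \<in> carrier E2" for x
      using that keys_\<phi> by (auto simp: carrier_exterior_square diagonal_action_coset simp del: carrier_free_Abelian_group_iff) (auto intro!: image_eqI)
    show "\<tau> (x \<otimes>\<^bsub>E2\<^esub> y) = \<tau> x \<otimes>\<^bsub>E2\<^esub> \<tau> y"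
      if xy: "x \<in> carrier E2" "y \<in> carrier E2" for x y
    proof -
      obtain u v where u: "u \<in> carrier FN" "x = Rel #>\<^bsub>FN\<^esub> u"
        and v: "v \<in> carrier FN" "y = Rel #>\<^bsub>FN\<^esub> v"
        using xy by (auto simp: carrier_exterior_square simp del: carrier_free_Abelian_group_iff)
      have uv: "u + v \<in> carrier FN"
        using u(1) v(1) keys_add[of u v] by auto
      have \<phi>uv: "\<phi> u \<in> carrier FN" "\<phi> v \<in> carrier FN"
        using u(1) v(1) keys_\<phi> by auto
      show ?thesis
        using hom_mult[OF wedge0_hom u(1) v(1)] hom_mult[OF wedge0_hom \<phi>uv]
          diagonal_action_coset[OF uv] diagonal_action_coset[OF u(1)] diagonal_action_coset[OF v(1)]
        by (simp add: u(2) v(2) frag_extend_add)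
    qed
  qed
  then show ?thesis
    by unfold_locales
qed

lemma wedge0_closed: "\<lbrakk>a \<in> carrier N; b \<in> carrier N\<rbrakk> \<Longrightarrow> wedge0 a b \<in> carrier E2"
  unfolding wedge0_def by (rule hom_in_carrier[OF wedge0_hom]) (simp add: keys_frag_of)

lemma diagonal_action_wedge0: "\<lbrakk>a \<in> carrier N; b \<in> carrier N\<rbrakk> \<Longrightarrow> \<tau> (wedge0 a b) = wedge0 (T a) (T b)"
  unfolding wedge0_def by (subst diagonal_action_coset) (auto simp: keys_frag_of)

lemma comm_group_wedge_coinvariants: "comm_group wedge_coinvariants"
  unfolding wedge_coinvariants_def
  by (rule group_endomorphism.comm_group_coinvariants[OF group_endomorphism_exterior_square])

abbreviation "Im\<tau> \<equiv> one_minus E2 \<tau> ` carrier E2"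

lemma subgroup_Im\<tau>: "subgroup Im\<tau> E2"
  by (rule group_endomorphism.subgroup_one_minus_image[OF group_endomorphism_exterior_square])

lemma coinvariants_hom: "(\<lambda>x. Im\<tau> #>\<^bsub>E2\<^esub> x) \<in> hom E2 wedge_coinvariants"
  unfolding wedge_coinvariants_def coinvariants_def
  by (rule normal.r_coset_hom_Mod)
    (use comm_group.normal_iff_subgroup[OF comm_group_exterior_square] subgroup_Im\<tau> in blast)

lemma wedge_hom: "(\<lambda>v. Im\<tau> #>\<^bsub>E2\<^esub> (Rel #>\<^bsub>FN\<^esub> v)) \<in> hom FN wedge_coinvariants"
  using hom_compose[OF wedge0_hom coinvariants_hom] by (simp add: comp_def)

lemma wedge_eq_zeroI:
  assumes "v \<in> Rel"
  shows "Im\<tau> #>\<^bsub>E2\<^esub> (Rel #>\<^bsub>FN\<^esub> v) = \<one>\<^bsub>wedge_coinvariants\<^esub>"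
proof -
  have "Rel #>\<^bsub>FN\<^esub> v = \<one>\<^bsub>E2\<^esub>"
    using group.coset_join2[OF group_free_Abelian_group _ subgroup_exterior_relations assms]
      subgroup.subset[OF subgroup_exterior_relations] assms by (auto simp: exterior_square_def)
  then show ?thesis
    using hom_one[OF coinvariants_hom] comm_group_wedge_coinvariants comm_group_exterior_square
    by (simp add: comm_group.axioms)
qed

lemma wedge_closed: "\<lbrakk>a \<in> carrier N; b \<in> carrier N\<rbrakk> \<Longrightarrow> wedge a b \<in> carrier wedge_coinvariants"
  unfolding wedge_def wedge0_def by (rule hom_in_carrier[OF wedge_hom]) (simp add: keys_frag_of)

text \<open>
  Both additivity laws are instances of this, as both defining relations have this form.
\<close>
lemma wedge_additive_aux:
  assumes "frag_of p - frag_of q - frag_of r \<in> Rel"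
    and "{p, q, r} \<subseteq> carrier N \<times> carrier N"
  shows "wedge (fst p) (snd p) = wedge (fst q) (snd q) \<otimes>\<^bsub>wedge_coinvariants\<^esub> wedge (fst r) (snd r)"
proof -
  interpret L: comm_group wedge_coinvariants by (rule comm_group_wedge_coinvariants)
  let ?q = "\<lambda>v. Im\<tau> #>\<^bsub>E2\<^esub> (Rel #>\<^bsub>FN\<^esub> v)"
  have k: "keys (frag_of p - frag_of q - frag_of r) \<subseteq> carrier N \<times> carrier N"
    using subgroup.subset[OF subgroup_exterior_relations] assms(1)
    by (metis carrier_free_Abelian_group_iff subsetD)
  have k': "keys (frag_of q + frag_of r) \<subseteq> carrier N \<times> carrier N"
    by (rule order_trans[OF keys_add]) (use assms in \<open>simp add: keys_frag_of\<close>)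
  have "?q (frag_of p) = ?q ((frag_of p - frag_of q - frag_of r) + (frag_of q + frag_of r))"
    by simp
  also have "\<dots> = \<one>\<^bsub>wedge_coinvariants\<^esub> \<otimes>\<^bsub>wedge_coinvariants\<^esub> ?q (frag_of q + frag_of r)"
    using hom_mult[OF wedge_hom, of "frag_of p - frag_of q - frag_of r" "frag_of q + frag_of r"] k k' wedge_eq_zeroI[OF assms(1)]
    by simp
  also have "?q (frag_of q + frag_of r) = ?q (frag_of q) \<otimes>\<^bsub>wedge_coinvariants\<^esub> ?q (frag_of r)"
    using hom_mult[OF wedge_hom, of "frag_of q" "frag_of r"] assms(2) by (simp add: keys_frag_of)
  finally have "?q (frag_of p) = \<one>\<^bsub>wedge_coinvariants\<^esub> \<otimes>\<^bsub>wedge_coinvariants\<^esub>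
      (?q (frag_of q) \<otimes>\<^bsub>wedge_coinvariants\<^esub> ?q (frag_of r))" .
  moreover have "?q (frag_of q) \<in> carrier wedge_coinvariants" "?q (frag_of r) \<in> carrier wedge_coinvariants"
    using assms(2) by (auto intro!: hom_in_carrier[OF wedge_hom] simp: keys_frag_of)
  ultimately show ?thesis
    by (simp add: wedge_def wedge0_def del: L.r_one)
qed

lemma wedge_left: "\<lbrakk>a \<in> carrier N; a' \<in> carrier N; b \<in> carrier N\<rbrakk> \<Longrightarrow>
    wedge (a \<otimes> a') b = wedge a b \<otimes>\<^bsub>wedge_coinvariants\<^esub> wedge a' b"
  using wedge_additive_aux[OF exterior_relations(1), of a a' b] by simp

lemma wedge_right: "\<lbrakk>a \<in> carrier N; b \<in> carrier N; b' \<in> carrier N\<rbrakk> \<Longrightarrow>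
    wedge a (b \<otimes> b') = wedge a b \<otimes>\<^bsub>wedge_coinvariants\<^esub> wedge a b'"
  using wedge_additive_aux[OF exterior_relations(2), of a b b'] by simp

lemma wedge_self: "a \<in> carrier N \<Longrightarrow> wedge a a = \<one>\<^bsub>wedge_coinvariants\<^esub>"
  unfolding wedge_def wedge0_def by (rule wedge_eq_zeroI) (rule exterior_relations(3))

lemma wedge_T:
  assumes "a \<in> carrier N" "b \<in> carrier N"
  shows "wedge (T a) (T b) = wedge a b"
proof -
  interpret E: comm_group "E2" by (rule comm_group_exterior_square)
  have "wedge0 a b \<otimes>\<^bsub>E2\<^esub> inv\<^bsub>E2\<^esub> wedge0 (T a) (T b) \<in> Im\<tau>"
    using assms wedge0_closed
    by (intro image_eqI[of _ _ "wedge0 a b"]) (simp_all add: one_minus_def diagonal_action_wedge0)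
  then show ?thesis
    unfolding wedge_def using rcoset_eq_iff[OF E.is_group subgroup_Im\<tau>, of "wedge0 a b" "wedge0 (T a) (T b)"] assms wedge0_closed
    by simp
qed

lemma wedge_generate:
  "carrier wedge_coinvariants = generate wedge_coinvariants {wedge a b | a b. a \<in> carrier N \<and> b \<in> carrier N}"
    (is "_ = generate _ ?W")
proof -
  interpret L: comm_group wedge_coinvariants by (rule comm_group_wedge_coinvariants)
  have W: "?W \<subseteq> carrier wedge_coinvariants"
    using wedge_closed by auto
  let ?q = "\<lambda>v. Im\<tau> #>\<^bsub>E2\<^esub> (Rel #>\<^bsub>FN\<^esub> v)"
  have "?q v \<in> generate wedge_coinvariants ?W" if "keys v \<subseteq> carrier N \<times> carrier N" for v
  proof -
    have "keys v \<subseteq> carrier N \<times> carrier N \<and> ?q v \<in> generate wedge_coinvariants ?W"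
      using that
    proof (induction v rule: frag_induction)
      case zero
      then show ?case
        using hom_one[OF wedge_hom] generate.one[of wedge_coinvariants ?W] by simp
    next
      case (one x)
      then show ?case
        by (auto simp: wedge_def wedge0_def keys_frag_of intro!: generate.incl)
    next
      case (diff a b)
      then have "keys (a - b) \<subseteq> carrier N \<times> carrier N"
        using keys_diff[of a b] by blast
      moreover have "?q (a - b) \<in> generate wedge_coinvariants ?W"
        using diff hom_free_Abelian_group_diff[OF L.is_group wedge_hom, of a b]
          subgroup.m_closed[OF L.generate_is_subgroup[OF W]] L.generate_m_inv_closed[OF W] by simp
      ultimately show ?case ..
    qed
    then show ?thesis ..
  qed
  moreover have "carrier wedge_coinvariants = ?q ` carrier FN"
    by (simp add: wedge_coinvariants_def coinvariants_def carrier_FactGroup carrier_exterior_square image_image)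
  ultimately show ?thesis
    using L.generate_incl[OF W] by (simp add: subset_antisym image_subset_iff)
qed

text \<open>
  An alternating biadditive map factors through \<open>\<Lambda>\<^sup>2 N\<close>, and a \<open>T\<close>-invariant one kills the image of
  \<open>1 - \<tau>\<close>.
\<close>
lemma wedge_universal:
  fixes G :: "('g, 'n) monoid_scheme"
  assumes "comm_group G" and f: "\<And>a b. \<lbrakk>a \<in> carrier N; b \<in> carrier N\<rbrakk> \<Longrightarrow> f a b \<in> carrier G"
    and left: "\<And>a a' b. \<lbrakk>a \<in> carrier N; a' \<in> carrier N; b \<in> carrier N\<rbrakk> \<Longrightarrow>
      f (a \<otimes> a') b = f a b \<otimes>\<^bsub>G\<^esub> f a' b"
    and right: "\<And>a b b'. \<lbrakk>a \<in> carrier N; b \<in> carrier N; b' \<in> carrier N\<rbrakk> \<Longrightarrow>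
      f a (b \<otimes> b') = f a b \<otimes>\<^bsub>G\<^esub> f a b'"
    and alt: "\<And>a. a \<in> carrier N \<Longrightarrow> f a a = \<one>\<^bsub>G\<^esub>"
    and inv: "\<And>a b. \<lbrakk>a \<in> carrier N; b \<in> carrier N\<rbrakk> \<Longrightarrow> f (T a) (T b) = f a b"
  obtains g where "g \<in> hom wedge_coinvariants G"
    "\<And>a b. \<lbrakk>a \<in> carrier N; b \<in> carrier N\<rbrakk> \<Longrightarrow> g (wedge a b) = f a b"
proof -
  interpret G: comm_group G by fact
  interpret E: group_endomorphism "E2" \<tau>
    by (rule group_endomorphism_exterior_square)
  obtain h where h: "h \<in> hom E2 G"
    "\<And>a b. \<lbrakk>a \<in> carrier N; b \<in> carrier N\<rbrakk> \<Longrightarrow> h (wedge0 a b) = f a b"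
    by (rule exterior_square_universal[OF assms(1) f left right alt]) blast+
  interpret h: group_hom "E2" G h
    using h by (intro group_hom.intro group_hom_axioms.intro) (auto simp: G.is_group E.N.is_group)
  have h\<tau>: "h (\<tau> x) = h x" if x: "x \<in> carrier E2" for x
  proof -
    obtain v where v: "v \<in> carrier FN" "x = Rel #>\<^bsub>FN\<^esub> v"
      using x by (auto simp: carrier_exterior_square simp del: carrier_free_Abelian_group_iff)
    let ?c = "\<lambda>v. Rel #>\<^bsub>FN\<^esub> v"
    have "(h \<circ> \<tau> \<circ> ?c) v = (h \<circ> ?c) v"
    proof (rule hom_free_Abelian_group_eq[OF G.is_group])
      show "h \<circ> \<tau> \<circ> ?c \<in> hom FN G"
        using hom_compose[OF wedge0_hom hom_compose[OF E.T_hom h(1)]] by (simp add: comp_assoc)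
      show "h \<circ> ?c \<in> hom FN G"
        by (rule hom_compose[OF wedge0_hom h(1)])
      show "(h \<circ> \<tau> \<circ> ?c) (frag_of p) = (h \<circ> ?c) (frag_of p)" if p: "p \<in> keys v" for p
      proof -
        obtain a b where ab: "p = (a, b)" "a \<in> carrier N" "b \<in> carrier N"
          using p v(1) by auto
        then show ?thesis
          using diagonal_action_wedge0[of a b] by (simp add: h(2) inv flip: wedge0_def)
      qed
    qed (use v(1) in auto)
    then show ?thesis
      by (simp add: v(2))
  qed
  have k: "Im\<tau> \<subseteq> kernel E2 G h"
    by (auto simp: kernel_def one_minus_def h\<tau>)
  have n: "Im\<tau> \<lhd> E2"
    using subgroup_Im\<tau> E.N.normal_iff_subgroup by blast
  obtain g where "g \<in> hom (E2 Mod Im\<tau>) G"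
    "\<And>x. x \<in> carrier E2 \<Longrightarrow> g (Im\<tau> #>\<^bsub>E2\<^esub> x) = h x"
    by (rule h.FactGroup_universal_kernel[OF n k]) blast
  then show thesis
    using that[of g] h(2) wedge0_closed by (simp add: wedge_coinvariants_def coinvariants_def wedge_def)
qed

end

section \<open>The submodule (1 - T)M and its cosets\<close>

text \<open>
  In comments \<open>M\<close> is written additively.
\<close>
locale alexander = M: comm_group M for M :: "('a, 'm) monoid_scheme" (structure) +
  fixes T :: "'a \<Rightarrow> 'a"
  assumes T_iso: "T \<in> iso M M"
begin

lemma T_hom: "T \<in> hom M M"
  using T_iso by (simp add: iso_def)

sublocale ME: group_endomorphism M T
  using T_hom by unfold_locales

abbreviation D :: "'a \<Rightarrow> 'a" where "D \<equiv> one_minus M T"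
definition N :: "'a set" where "N = D ` carrier M"
abbreviation NM :: "('a, 'm) monoid_scheme" where "NM \<equiv> one_minus_image M T"

lemma NM_simps [simp]:
  "carrier NM = N" "x \<otimes>\<^bsub>NM\<^esub> y = x \<otimes> y" "\<one>\<^bsub>NM\<^esub> = \<one>"
  by (simp_all add: one_minus_image_def N_def)

lemma subgroup_N: "subgroup N M"
  unfolding N_def by (rule ME.subgroup_one_minus_image)

lemma N_closed [simp]: "x \<in> N \<Longrightarrow> x \<in> carrier M"
  using subgroup.subset[OF subgroup_N] by blast

lemma N_mult [simp]: "\<lbrakk>x \<in> N; y \<in> N\<rbrakk> \<Longrightarrow> x \<otimes> y \<in> N"
  and N_inv [simp]: "x \<in> N \<Longrightarrow> inv x \<in> N"
  and N_one [simp]: "\<one> \<in> N"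
  using subgroup_N by (auto simp: subgroup.m_closed subgroup.m_inv_closed subgroup.one_closed)

lemma inv_NM [simp]: "x \<in> N \<Longrightarrow> inv\<^bsub>NM\<^esub> x = inv x"
  unfolding one_minus_image_def N_def[symmetric] by (rule M.m_inv_consistent[OF subgroup_N])

lemma comm_group_NM: "comm_group NM"
  unfolding one_minus_image_def N_def[symmetric] by (rule M.subgroup_comm_group[OF subgroup_N])

lemma D_mult [simp]: "\<lbrakk>x \<in> carrier M; y \<in> carrier M\<rbrakk> \<Longrightarrow> D (x \<otimes> y) = D x \<otimes> D y"
  and D_inv [simp]: "x \<in> carrier M \<Longrightarrow> D (inv x) = inv (D x)"
  and D_one [simp]: "D \<one> = \<one>"
  and T_mult [simp]: "\<lbrakk>x \<in> carrier M; y \<in> carrier M\<rbrakk> \<Longrightarrow> T (x \<otimes> y) = T x \<otimes> T y"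
  and T_inv [simp]: "x \<in> carrier M \<Longrightarrow> T (inv x) = inv (T x)"
  and T_one [simp]: "T \<one> = \<one>"
  and T_closed [simp]: "x \<in> carrier M \<Longrightarrow> T x \<in> carrier M"
  by simp_all

lemma D_closed [simp]: "x \<in> carrier M \<Longrightarrow> D x \<in> carrier M"
  by simp

lemma D_in_N [simp]: "x \<in> carrier M \<Longrightarrow> D x \<in> N"
  by (simp add: N_def)

lemma T_D: "x \<in> carrier M \<Longrightarrow> T (D x) = D (T x)"
  by (simp add: one_minus_def)

lemma T_N [simp]: "x \<in> N \<Longrightarrow> T x \<in> N"
  by (auto simp: T_D N_def)

lemma D_T: "x \<in> carrier M \<Longrightarrow> x = D x \<otimes> T x"
  by (simp add: one_minus_def M.m_assoc)

sublocale NE: group_endomorphism NM T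
proof -
  interpret NM: comm_group NM by (rule comm_group_NM)
  show "group_endomorphism NM T"
    by unfold_locales (auto simp: hom_def T_D)
qed

abbreviation L where "L \<equiv> NE.wedge_coinvariants"
abbreviation wd (infixl \<open>\<^bold>\<and>\<close> 70) where "a \<^bold>\<and> b \<equiv> NE.wedge a b"

abbreviation L_product (infixl \<open>\<bullet>\<close> 70)
  where "\<alpha> \<bullet> \<beta> \<equiv> \<alpha> \<otimes>\<^bsub>L\<^esub> \<beta>"

sublocale L: comm_group L
  by (rule NE.comm_group_wedge_coinvariants)

lemma wd_closed [simp]: "\<lbrakk>a \<in> N; b \<in> N\<rbrakk> \<Longrightarrow> a \<^bold>\<and> b \<in> carrier L"
  using NE.wedge_closed by simp

lemma wd_left: "\<lbrakk>a \<in> N; a' \<in> N; b \<in> N\<rbrakk> \<Longrightarrow> (a \<otimes> a') \<^bold>\<and> b = (a \<^bold>\<and> b) \<bullet> (a' \<^bold>\<and> b)"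
  using NE.wedge_left by simp

lemma wd_right: "\<lbrakk>a \<in> N; b \<in> N; b' \<in> N\<rbrakk> \<Longrightarrow> a \<^bold>\<and> (b \<otimes> b') = (a \<^bold>\<and> b) \<bullet> (a \<^bold>\<and> b')"
  using NE.wedge_right by simp

lemma wd_self [simp]: "a \<in> N \<Longrightarrow> a \<^bold>\<and> a = \<one>\<^bsub>L\<^esub>"
  using NE.wedge_self by simp

lemma wd_T: "\<lbrakk>a \<in> N; b \<in> N\<rbrakk> \<Longrightarrow> T a \<^bold>\<and> T b = a \<^bold>\<and> b"
  using NE.wedge_T by simp

lemma wd_one [simp]: "a \<in> N \<Longrightarrow> a \<^bold>\<and> \<one> = \<one>\<^bsub>L\<^esub>" "a \<in> N \<Longrightarrow> \<one> \<^bold>\<and> a = \<one>\<^bsub>L\<^esub>"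
  using wd_right[of a \<one> \<one>] wd_left[of \<one> \<one> a] L.l_cancel_one'[of "a \<^bold>\<and> \<one>" "a \<^bold>\<and> \<one>"]
    L.l_cancel_one'[of "\<one> \<^bold>\<and> a" "\<one> \<^bold>\<and> a"] by auto

lemma wd_antisym:
  assumes "a \<in> N" "b \<in> N"
  shows "(a \<^bold>\<and> b) \<bullet> (b \<^bold>\<and> a) = \<one>\<^bsub>L\<^esub>"
  using wd_self[of "a \<otimes> b"] wd_left[of a b "a \<otimes> b"] wd_right[of a a b] wd_right[of b a b] assms
  by simp

text \<open>
  This is where coinvariants matter: as \<open>T m \<and> T x = m \<and> x\<close>, the left side is
  \<open>T m \<and> x - m \<and> x = x \<and> m - x \<and> T m\<close>.
\<close>
lemma wd_T_D:
  assumes [simp]: "m \<in> N" "x \<in> N"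
  shows "T m \<^bold>\<and> D x = x \<^bold>\<and> D m"
proof -
  have Tm: "T m \<in> N" and Tx: "T x \<in> N" and Dm: "D m \<in> N" and Dx: "D x \<in> N"
    by (simp_all add: T_N[OF assms(1)] T_N[OF assms(2)])
  note [simp] = Tm Tx Dm Dx
  have 1: "T m \<^bold>\<and> x = (T m \<^bold>\<and> D x) \<bullet> (m \<^bold>\<and> x)"
    using wd_right[of "T m" "D x" "T x"] D_T[of x] wd_T[of m x] by simp
  have 2: "x \<^bold>\<and> m = (x \<^bold>\<and> D m) \<bullet> (x \<^bold>\<and> T m)"
    using wd_right[of x "D m" "T m"] D_T[of m] by simp
  have "T m \<^bold>\<and> D x = (T m \<^bold>\<and> D x) \<bullet> ((m \<^bold>\<and> x) \<bullet> (x \<^bold>\<and> m))"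
    using wd_antisym[of m x] by simp
  also have "\<dots> = (T m \<^bold>\<and> x) \<bullet> ((x \<^bold>\<and> D m) \<bullet> (x \<^bold>\<and> T m))"
    unfolding 1 2[symmetric] by (simp add: L.m_assoc)
  also have "\<dots> = (x \<^bold>\<and> D m) \<bullet> ((T m \<^bold>\<and> x) \<bullet> (x \<^bold>\<and> T m))"
    by (simp add: L.m_ac)
  also have "\<dots> = x \<^bold>\<and> D m"
    using wd_antisym[of "T m" x] by simp
  finally show ?thesis .
qed

text \<open>
  The antisymmetrization of the form \<open>k \<and> D n\<close> is thus \<open>D k \<and> D n\<close>.  This form is the part of the
  factor set of \<open>\<Gamma>\<close> that lives on \<open>N\<close>.
\<close>
lemma wd_D_right:
  assumes [simp]: "k \<in> N" "n \<in> N"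
  shows "k \<^bold>\<and> D n = (n \<^bold>\<and> D k) \<bullet> (D k \<^bold>\<and> D n)"
proof -
  have "k \<^bold>\<and> D n = (D k \<^bold>\<and> D n) \<bullet> (T k \<^bold>\<and> D n)"
    using wd_left[of "D k" "T k" "D n"] D_T[of k] by (simp add: T_N[OF assms(1)])
  then show ?thesis
    by (simp add: wd_T_D L.m_comm)
qed

abbreviation A where "A \<equiv> coinvariants M T"

definition cl :: "'a \<Rightarrow> 'a set" where "cl x = N #> x"

lemma carrier_A: "carrier A = cl ` carrier M"
  by (simp add: coinvariants_def carrier_FactGroup cl_def[abs_def] N_def)

lemma cl_closed [simp]: "x \<in> carrier M \<Longrightarrow> cl x \<in> carrier A"
  by (simp add: carrier_A)

lemma one_A: "\<one>\<^bsub>A\<^esub> = N"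
  by (simp add: coinvariants_def N_def)

lemma cl_eq_iff: "\<lbrakk>x \<in> carrier M; y \<in> carrier M\<rbrakk> \<Longrightarrow> cl x = cl y \<longleftrightarrow> x \<otimes> inv y \<in> N"
  unfolding cl_def by (rule rcoset_eq_iff[OF M.is_group subgroup_N])

lemma cl_N: "x \<in> N \<Longrightarrow> cl x = N"
  unfolding cl_def by (rule M.coset_join2[OF N_closed subgroup_N])

lemma cl_hom: "cl \<in> hom M A"
  unfolding cl_def[abs_def] coinvariants_def N_def[symmetric]
  by (rule normal.r_coset_hom_Mod) (use M.normal_iff_subgroup subgroup_N in blast)

lemma comm_group_A: "comm_group A"
  by (rule ME.comm_group_coinvariants)

text \<open>
  A section of \<open>M \<rightarrow> A\<close>, normalized to send 0 to 0.  Every \<open>y\<close> in \<open>M\<close> is then \<open>rem y + sec (cl y)\<close>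
  with \<open>rem y\<close> in \<open>N\<close>.
\<close>
definition sec :: "'a set \<Rightarrow> 'a"
  where "sec c = (if c = N then \<one> else SOME x. x \<in> carrier M \<and> cl x = c)"

lemma sec:
  assumes "c \<in> carrier A"
  shows sec_closed [simp]: "sec c \<in> carrier M" and cl_sec [simp]: "cl (sec c) = c"
proof -
  have ex: "\<exists>x. x \<in> carrier M \<and> cl x = c"
    using assms by (auto simp: carrier_A)
  show "sec c \<in> carrier M" "cl (sec c) = c"
    using someI_ex[OF ex] cl_N[of \<one>] by (auto simp: sec_def)
qed

lemma sec_N [simp]: "sec N = \<one>"
  by (simp add: sec_def)

definition rem :: "'a \<Rightarrow> 'a" where "rem y = y \<otimes> inv (sec (cl y))"

lemma rem_in_N [simp]: "y \<in> carrier M \<Longrightarrow> rem y \<in> N"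
  using cl_eq_iff[of y "sec (cl y)"] by (simp add: rem_def)

lemma rem_sec: "y \<in> carrier M \<Longrightarrow> y = rem y \<otimes> sec (cl y)"
  by (simp add: rem_def M.m_assoc)

abbreviation S where "S \<equiv> carrier A - {N}"

text \<open>
  The basis element of \<open>c\<close> in the free group on \<open>A - 0\<close>, with the convention that the zero class
  gives 0.  Edges whose label lies in \<open>N\<close> include the degenerate ones, hence must not be counted.
\<close>
definition gen :: "'a set \<Rightarrow> ('a set \<Rightarrow>\<^sub>0 int)" where "gen c = (if c = N then 0 else frag_of c)"

lemma keys_gen: "c \<in> carrier A \<Longrightarrow> keys (gen c) \<subseteq> S"
  by (auto simp: gen_def keys_frag_of)

lemma gen_N [simp]: "gen N = 0"
  by (simp add: gen_def)

definition \<delta>0 where "\<delta>0 c = (if c \<in> carrier A then D (sec c) else \<one>)"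
text \<open>
  The homomorphism with \<open>c \<mapsto> D (sec c)\<close>.  It measures how far the label class \<open>c\<close> moves a vertex.
\<close>
definition \<delta> :: "('a set \<Rightarrow>\<^sub>0 int) \<Rightarrow> 'a" where "\<delta> = free_lift NM \<delta>0"

lemma \<delta>0_closed: "\<delta>0 c \<in> carrier NM"
  by (simp add: \<delta>0_def)

lemma \<delta>_in_N [simp]: "\<delta> \<phi> \<in> N"
  and \<delta>_add: "\<delta> (\<phi> + \<nu>) = \<delta> \<phi> \<otimes> \<delta> \<nu>"
  and \<delta>_zero [simp]: "\<delta> 0 = \<one>"
  and \<delta>_gen [simp]: "c \<in> carrier A \<Longrightarrow> \<delta> (gen c) = D (sec c)"
  and \<delta>_frag_of: "\<delta> (frag_of c) = \<delta>0 c"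
  using comm_group.free_lift[OF comm_group_NM, of \<delta>0, OF \<delta>0_closed]
  by (auto simp: \<delta>_def gen_def \<delta>0_def)

definition bil0 where "bil0 c d = (if some_order d c then \<delta>0 c \<^bold>\<and> \<delta>0 d else \<one>\<^bsub>L\<^esub>)"
text \<open>
  The wedge of \<open>\<delta> \<phi>\<close> and \<open>\<delta> \<nu>\<close> cut down to the pairs of basis elements in descending order: a
  biadditive form whose antisymmetrization is the whole wedge.  A biadditive form on \<open>N\<close> with this
  property need not exist, but on a free group it does.
\<close>
definition bil where "bil \<phi> \<nu> = free_lift L (\<lambda>c. free_lift L (bil0 c) \<nu>) \<phi>"

lemma bil0_closed: "bil0 c d \<in> carrier L"
  using \<delta>0_closed by (simp add: bil0_def)

lemma bil_closed [simp]: "bil \<phi> \<nu> \<in> carrier L"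
  and bil_left: "bil (\<phi> + \<phi>') \<nu> = bil \<phi> \<nu> \<bullet> bil \<phi>' \<nu>"
  and bil_zero_left [simp]: "bil 0 \<nu> = \<one>\<^bsub>L\<^esub>"
  and bil_right: "bil \<phi> (\<nu> + \<nu>') = bil \<phi> \<nu> \<bullet> bil \<phi> \<nu>'"
  and bil_zero_right [simp]: "bil \<phi> 0 = \<one>\<^bsub>L\<^esub>"
  and bil_frag_of: "bil (frag_of c) (frag_of d) = bil0 c d"
proof -
  have c: "\<And>c. free_lift L (bil0 c) \<nu> \<in> carrier L" for \<nu>
    by (rule L.free_lift_closed[OF bil0_closed])
  note F = L.free_lift[of "bil0 _", OF bil0_closed]
  note G = L.free_lift[of "\<lambda>c. free_lift L (bil0 c) _", OF c]
  show closed: "bil \<phi> \<nu> \<in> carrier L" for \<nu>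
    by (simp add: bil_def G)
  show "bil (\<phi> + \<phi>') \<nu> = bil \<phi> \<nu> \<bullet> bil \<phi>' \<nu>" "bil 0 \<nu> = \<one>\<^bsub>L\<^esub>"
    by (simp_all add: bil_def G)
  show right: "bil \<phi> (\<nu> + \<nu>') = bil \<phi> \<nu> \<bullet> bil \<phi> \<nu>'" for \<nu> \<nu>'
    unfolding bil_def F by (simp add: L.free_lift_pointwise_mult c)
  from right[of 0 0] show "bil \<phi> 0 = \<one>\<^bsub>L\<^esub>"
    using closed L.l_cancel_one'[of "bil \<phi> 0" "bil \<phi> 0"] by auto
  show "bil (frag_of c) (frag_of d) = bil0 c d"
    by (simp add: bil_def F G L.free_lift_of bil0_closed)
qed

lemma additive_into_L_eq:
  assumes "\<And>u. f u \<in> carrier L" "\<And>u v. f (u + v) = f u \<bullet> f v"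
    and "\<And>u. g u \<in> carrier L" "\<And>u v. g (u + v) = g u \<bullet> g v"
    and "\<And>c. f (frag_of c) = g (frag_of c)"
  shows "f u = g u"
  by (rule hom_free_Abelian_group_eq[OF L.is_group, of _ UNIV]) (use assms in \<open>auto intro: homI\<close>)

lemma bil_antisym: "bil \<phi> \<nu> = bil \<nu> \<phi> \<bullet> (\<delta> \<phi> \<^bold>\<and> \<delta> \<nu>)"
proof -
  have gens: "bil (frag_of c) (frag_of d) = bil (frag_of d) (frag_of c) \<bullet> (\<delta> (frag_of c) \<^bold>\<and> \<delta> (frag_of d))" for c d
  proof -
    have "\<delta>0 c \<in> N" "\<delta>0 d \<in> N"
      using \<delta>0_closed by simp_all
    then show ?thesis
      using wd_antisym[of "\<delta>0 d" "\<delta>0 c"] some_order(1)[of c d] some_order(2)[of c d] some_order(2)[of d c]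
      unfolding bil_frag_of bil0_def \<delta>_frag_of by (cases "c = d"; cases "some_order d c") simp_all
  qed
  have 1: "bil (frag_of c) \<nu> = bil \<nu> (frag_of c) \<bullet> (\<delta> (frag_of c) \<^bold>\<and> \<delta> \<nu>)" for c \<nu>
    by (rule additive_into_L_eq[where f = "\<lambda>\<nu>. bil (frag_of c) \<nu>" and g = "\<lambda>\<nu>. bil \<nu> (frag_of c) \<bullet> (\<delta> (frag_of c) \<^bold>\<and> \<delta> \<nu>)", OF _ _ _ _ gens])
      (simp_all add: bil_right bil_left \<delta>_add wd_right L.m_ac)
  show ?thesis
    by (rule additive_into_L_eq[where f = "\<lambda>\<phi>. bil \<phi> \<nu>" and g = "\<lambda>\<phi>. bil \<nu> \<phi> \<bullet> (\<delta> \<phi> \<^bold>\<and> \<delta> \<nu>)", OF _ _ _ _ 1])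
      (simp_all add: bil_right bil_left \<delta>_add wd_left L.m_ac)
qed

section \<open>The holonomy group\<close>

text \<open>
  \<open>P\<close> is \<open>N \<oplus> F\<close>, to be thought of as \<open>M\<close> with \<open>A = M / N\<close> replaced by the free group \<open>F\<close> on
  \<open>A - 0\<close>.
\<close>
abbreviation P where "P \<equiv> NM \<times>\<times> free_Abelian_group S"

text \<open>
  Chosen so that \<open>\<omega> p q - \<omega> q p\<close> is the wedge of the images of \<open>p\<close> and \<open>q\<close> in \<open>N\<close> under
  \<open>(k, \<phi>) \<mapsto> D k + \<delta> \<phi>\<close>: see \<open>wd_D_right\<close> for the \<open>N\<close>-parts and \<open>bil_antisym\<close> for the \<open>F\<close>-parts.
\<close>
definition \<omega> :: "'a \<times> ('a set \<Rightarrow>\<^sub>0 int) \<Rightarrow> 'a \<times> ('a set \<Rightarrow>\<^sub>0 int) \<Rightarrow> _"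
  where "\<omega> p q = ((fst p \<otimes> \<delta> (snd p)) \<^bold>\<and> D (fst q)) \<bullet> bil (snd p) (snd q)"

definition \<Gamma> where "\<Gamma> = cocycle_extension P L \<omega>"

abbreviation \<Gamma>_product (infixl \<open>\<cdot>\<close> 70)
  where "g \<cdot> g' \<equiv> g \<otimes>\<^bsub>\<Gamma>\<^esub> g'"

lemma \<Gamma>_simps:
  "carrier \<Gamma> = carrier P \<times> carrier L"
  "x \<cdot> y = (fst x \<otimes>\<^bsub>P\<^esub> fst y, snd x \<bullet> snd y \<bullet> \<omega> (fst x) (fst y))"
  "\<one>\<^bsub>\<Gamma>\<^esub> = (\<one>\<^bsub>P\<^esub>, \<one>\<^bsub>L\<^esub>)"
  by (simp_all add: \<Gamma>_def)

definition pr :: "('a \<times> ('a set \<Rightarrow>\<^sub>0 int)) \<times> ('a \<times> 'a \<Rightarrow>\<^sub>0 int) set set \<Rightarrow> 'a"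
  where "pr g = D (fst (fst g)) \<otimes> \<delta> (snd (fst g))"

lemma carrier_P: "carrier P = N \<times> {\<phi>. keys \<phi> \<subseteq> S}"
  by (auto simp: DirProd_def)

lemma P_simps [simp]: "p \<otimes>\<^bsub>P\<^esub> q = (fst p \<otimes> fst q, snd p + snd q)" "\<one>\<^bsub>P\<^esub> = (\<one>, 0)"
  by (simp_all add: DirProd_def case_prod_beta)

lemma comm_group_P: "comm_group P"
  using comm_group_NM abelian_free_Abelian_group[of S]
  by (intro group.group_comm_groupI DirProd_group)
    (auto simp: comm_group.axioms DirProd_def M.m_comm add.commute)

lemma \<omega>_closed: "\<lbrakk>p \<in> carrier P; q \<in> carrier P\<rbrakk> \<Longrightarrow> \<omega> p q \<in> carrier L"
  unfolding \<omega>_def carrier_P by (intro L.m_closed wd_closed N_mult \<delta>_in_N D_in_N bil_closed) auto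

sublocale \<Gamma>: normalized_cocycle P L \<omega>
proof (rule normalized_cocycle_of_biadditive)
  show "group P" "comm_group L"
    using comm_group_P by (simp_all add: comm_group.axioms L.comm_group_axioms)
  show "\<omega> p q \<in> carrier L" if "p \<in> carrier P" "q \<in> carrier P" for p q
    using that by (rule \<omega>_closed)
  show "\<omega> (p \<otimes>\<^bsub>P\<^esub> p') q = \<omega> p q \<bullet> \<omega> p' q" if "p \<in> carrier P" "p' \<in> carrier P" "q \<in> carrier P" for p p' q
  proof -
    have [simp]: "fst p \<in> N" "fst p' \<in> N" "fst q \<in> N"
      using that by (auto simp: carrier_P)
    have "fst p \<otimes> fst p' \<otimes> (\<delta> (snd p) \<otimes> \<delta> (snd p')) = (fst p \<otimes> \<delta> (snd p)) \<otimes> (fst p' \<otimes> \<delta> (snd p'))"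
      by (simp add: M.m_ac)
    then show ?thesis
      by (simp add: \<omega>_def \<delta>_add bil_left wd_left L.m_ac)
  qed
  show "\<omega> p (q \<otimes>\<^bsub>P\<^esub> q') = \<omega> p q \<bullet> \<omega> p q'" if "p \<in> carrier P" "q \<in> carrier P" "q' \<in> carrier P" for p q q'
  proof -
    have [simp]: "fst p \<in> N" "fst q \<in> N" "fst q' \<in> N"
      using that by (auto simp: carrier_P)
    show ?thesis
      by (simp add: \<omega>_def bil_right wd_right L.m_ac)
  qed
qed

sublocale \<Gamma>: group \<Gamma>
  unfolding \<Gamma>_def by (rule \<Gamma>.group_cocycle_extension)

lemma carrier_\<Gamma>: "carrier \<Gamma> = (N \<times> {\<phi>. keys \<phi> \<subseteq> S}) \<times> carrier L"
  by (simp only: \<Gamma>_simps carrier_P)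

lemma \<Gamma>_memI: "\<lbrakk>k \<in> N; keys \<phi> \<subseteq> S; \<alpha> \<in> carrier L\<rbrakk> \<Longrightarrow> ((k, \<phi>), \<alpha>) \<in> carrier \<Gamma>"
  by (auto simp: carrier_\<Gamma>)

lemma \<Gamma>_mult: "((k, \<phi>), \<alpha>) \<cdot> ((n, \<nu>), \<beta>) =
    ((k \<otimes> n, \<phi> + \<nu>), \<alpha> \<bullet> \<beta> \<bullet> (((k \<otimes> \<delta> \<phi>) \<^bold>\<and> D n) \<bullet> bil \<phi> \<nu>))"
  by (simp add: \<Gamma>_simps \<omega>_def)

lemma \<Gamma>_one: "\<one>\<^bsub>\<Gamma>\<^esub> = ((\<one>, 0), \<one>\<^bsub>L\<^esub>)"
  by (simp add: \<Gamma>_simps)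

lemma pr_in_N: "g \<in> carrier \<Gamma> \<Longrightarrow> pr g \<in> N"
  by (auto simp: pr_def carrier_\<Gamma>)

lemma pr_mult: "\<lbrakk>g \<in> carrier \<Gamma>; g' \<in> carrier \<Gamma>\<rbrakk> \<Longrightarrow> pr (g \<cdot> g') = pr g \<otimes> pr g'"
  unfolding carrier_\<Gamma> by (auto simp: pr_def \<Gamma>_mult \<delta>_add M.m_ac)

lemma pr_hom: "pr \<in> hom \<Gamma> NM"
  using pr_in_N pr_mult by (auto simp: hom_def)

lemma \<Gamma>_commutator:
  assumes g: "g \<in> carrier \<Gamma>" and g': "g' \<in> carrier \<Gamma>"
  shows "g \<cdot> g' = (g' \<cdot> g) \<cdot> ((\<one>, 0), pr g \<^bold>\<and> pr g')"
proof -
  obtain k \<phi> \<alpha> n \<nu> \<beta> where eq: "g = ((k, \<phi>), \<alpha>)" "g' = ((n, \<nu>), \<beta>)"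
    by (metis prod.collapse)
  have k: "k \<in> N" "n \<in> N" and [simp]: "\<alpha> \<in> carrier L" "\<beta> \<in> carrier L"
    using g g' by (auto simp: eq carrier_\<Gamma>)
  have D: "D k \<in> N" "D n \<in> N"
    using k by simp_all
  note [simp] = k D
  have "(k \<^bold>\<and> D n) \<bullet> (\<delta> \<phi> \<^bold>\<and> D n) \<bullet> bil \<phi> \<nu> =
      (n \<^bold>\<and> D k) \<bullet> (D k \<^bold>\<and> D n) \<bullet> (\<delta> \<phi> \<^bold>\<and> D n) \<bullet> (bil \<nu> \<phi> \<bullet> (\<delta> \<phi> \<^bold>\<and> \<delta> \<nu>))
        \<bullet> ((\<delta> \<nu> \<^bold>\<and> D k) \<bullet> (D k \<^bold>\<and> \<delta> \<nu>))"
    using wd_D_right[of k n] bil_antisym[of \<phi> \<nu>] wd_antisym[of "\<delta> \<nu>" "D k"] by simp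
  then have "((k \<otimes> \<delta> \<phi>) \<^bold>\<and> D n) \<bullet> bil \<phi> \<nu> = ((n \<otimes> \<delta> \<nu>) \<^bold>\<and> D k) \<bullet> bil \<nu> \<phi> \<bullet> ((D k \<otimes> \<delta> \<phi>) \<^bold>\<and> (D n \<otimes> \<delta> \<nu>))"
    by (simp add: wd_left wd_right L.m_ac)
  then show ?thesis
    unfolding eq \<Gamma>_mult by (simp add: pr_def M.m_comm L.m_ac add.commute)
qed

text \<open>
  The element for the label \<open>y = n + s\<close>, with \<open>n = rem y\<close> and \<open>s = sec (cl y)\<close>, is the product of
  those for \<open>n\<close> and \<open>s\<close> up to the central correction \<open>D s \<and> n\<close>, which \<open>h_relation\<close> forces.
\<close>
definition h :: "'a \<Rightarrow> ('a \<times> ('a set \<Rightarrow>\<^sub>0 int)) \<times> ('a \<times> 'a \<Rightarrow>\<^sub>0 int) set set"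
  where "h y = ((rem y, gen (cl y)), D (sec (cl y)) \<^bold>\<and> rem y)"

lemma h_closed [simp]: "y \<in> carrier M \<Longrightarrow> h y \<in> carrier \<Gamma>"
  unfolding h_def by (intro \<Gamma>_memI wd_closed) (auto simp: keys_gen)

lemma pr_h: "y \<in> carrier M \<Longrightarrow> pr (h y) = D y"
  using rem_sec[of y] D_mult[of "rem y" "sec (cl y)"] by (simp add: pr_def h_def)

lemma h_N: "n \<in> N \<Longrightarrow> h n = ((n, 0), \<one>\<^bsub>L\<^esub>)"
  by (simp add: h_def cl_N rem_def)

lemma h_one: "h \<one> = \<one>\<^bsub>\<Gamma>\<^esub>"
  using h_N[of \<one>] by (simp add: \<Gamma>_one)

lemma h_sec: "c \<in> carrier A \<Longrightarrow> h (sec c) = ((\<one>, gen c), \<one>\<^bsub>L\<^esub>)"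
  by (simp add: h_def rem_def)

text \<open>
  For a group with this relation the product \<open>(h x)\<^sup>-\<^sup>1 \<cdot> h y\<close> behaves like the edge \<open>(x, y)\<close> of an
  Alexander quandle; see \<open>weight_cocycle\<close>.  In the coordinates \<open>a = n + s\<close> and \<open>z = m + t\<close> the first
  two components agree because \<open>T z = (T m - D t) + t\<close>; the component in \<open>L\<close> reduces to \<open>wd_T_D\<close>
  for \<open>m\<close> and the element \<open>n + D m + D t\<close>, and to \<open>bil_antisym\<close>.
\<close>
theorem h_relation:
  assumes a: "a \<in> carrier M" and z: "z \<in> carrier M"
  shows "h a \<cdot> h z = h (T z) \<cdot> h (a \<otimes> D z)"
proof -
  define s n t m where "s = sec (cl a)" and "n = rem a" and "t = sec (cl z)" and "m = rem z"
  have [simp]: "s \<in> carrier M" "t \<in> carrier M" and nm: "n \<in> N" "m \<in> N"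
    using a z by (simp_all add: s_def t_def n_def m_def)
  have [simp]: "n \<in> carrier M" "m \<in> carrier M" "T m \<in> N" "D m \<in> N"
    using nm by simp_all
  note [simp] = nm
  have an: "a = n \<otimes> s" and zm: "z = m \<otimes> t"
    using rem_sec a z by (simp_all add: s_def t_def n_def m_def)
  have clT: "cl (T z) = cl z"
    by (rule cl_eq_iff[THEN iffD2]) (use z N_inv[OF D_in_N[of z]] in \<open>simp_all add: one_minus_def M.inv_mult M.m_comm\<close>)
  have cla: "cl (a \<otimes> D z) = cl a"
    by (rule cl_eq_iff[THEN iffD2]) (use a z D_in_N[of z] in \<open>simp_all add: M.m_comm[of a] M.m_assoc\<close>)
  have remT: "rem (T z) = T m \<otimes> inv (D t)"
    unfolding rem_def clT t_def[symmetric] by (simp add: zm one_minus_def M.inv_mult M.m_ac)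
  have rema: "rem (a \<otimes> D z) = n \<otimes> (D m \<otimes> D t)"
    unfolding rem_def cla s_def[symmetric] using a z zm n_def[unfolded rem_def, folded s_def] by (simp add: M.m_ac)
  have ha: "h a = ((n, gen (cl a)), D s \<^bold>\<and> n)" and hz: "h z = ((m, gen (cl z)), D t \<^bold>\<and> m)"
    by (simp_all add: h_def s_def n_def t_def m_def)
  have hT: "h (T z) = ((T m \<otimes> inv (D t), gen (cl z)), D t \<^bold>\<and> (T m \<otimes> inv (D t)))"
    and haz: "h (a \<otimes> D z) = ((n \<otimes> (D m \<otimes> D t), gen (cl a)), D s \<^bold>\<and> (n \<otimes> (D m \<otimes> D t)))"
    unfolding h_def remT rema clT cla by (simp_all add: s_def t_def)
  have \<delta>: "\<delta> (gen (cl a)) = D s" "\<delta> (gen (cl z)) = D t"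
    using a z by (simp_all add: s_def t_def)
  have "T m \<otimes> inv (D t) \<otimes> (n \<otimes> (D m \<otimes> D t)) = n \<otimes> (T m \<otimes> D m) \<otimes> (inv (D t) \<otimes> D t)"
    by (simp only: M.m_ac M.m_closed M.inv_closed D_closed T_closed \<open>n \<in> carrier M\<close> \<open>m \<in> carrier M\<close> \<open>t \<in> carrier M\<close>)
  also have "\<dots> = n \<otimes> m"
    using D_T[of m] by (simp add: M.m_comm)
  finally have fst: "T m \<otimes> inv (D t) \<otimes> (n \<otimes> (D m \<otimes> D t)) = n \<otimes> m" .
  have pos: "T m \<otimes> inv (D t) \<otimes> D t = T m"
    by (simp add: M.m_assoc)
  have w1: "D t \<^bold>\<and> m = (D t \<^bold>\<and> D m) \<bullet> (D t \<^bold>\<and> T m)"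
    using wd_right[of "D t" "D m" "T m"] D_T[of m] by simp
  have "D t \<^bold>\<and> T m = (D t \<^bold>\<and> (T m \<otimes> inv (D t))) \<bullet> (D t \<^bold>\<and> D t)"
    using wd_right[of "D t" "T m \<otimes> inv (D t)" "D t"] pos by simp
  then have w2: "D t \<^bold>\<and> (T m \<otimes> inv (D t)) = D t \<^bold>\<and> T m"
    by simp
  have w3: "T m \<^bold>\<and> D (n \<otimes> (D m \<otimes> D t)) = (n \<^bold>\<and> D m) \<bullet> (D t \<^bold>\<and> D m)"
    using wd_T_D[of m "n \<otimes> (D m \<otimes> D t)"] by (simp add: wd_left del: D_mult)
  have b: "bil (gen (cl a)) (gen (cl z)) = bil (gen (cl z)) (gen (cl a)) \<bullet> (D s \<^bold>\<and> D t)"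
    using bil_antisym[of "gen (cl a)" "gen (cl z)"] by (simp add: \<delta>)
  have "(D s \<^bold>\<and> n) \<bullet> (D t \<^bold>\<and> m) \<bullet> (((n \<otimes> D s) \<^bold>\<and> D m) \<bullet> bil (gen (cl a)) (gen (cl z))) =
      (D t \<^bold>\<and> (T m \<otimes> inv (D t))) \<bullet> (D s \<^bold>\<and> (n \<otimes> (D m \<otimes> D t)))
        \<bullet> ((T m \<^bold>\<and> D (n \<otimes> (D m \<otimes> D t))) \<bullet> bil (gen (cl z)) (gen (cl a)))"
    unfolding w1 w2 w3 b by (simp add: wd_left wd_right L.m_ac)
  then show ?thesis
    unfolding ha hz hT haz \<Gamma>_mult \<delta> pos fst by (simp add: add.commute)
qed

text \<open>
  Commutators of the \<open>h y\<close> give all of \<open>L\<close> because \<open>D\<close> maps \<open>M\<close> onto \<open>N\<close>; modulo \<open>L\<close> the elements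
  \<open>h n\<close> and \<open>h (sec c)\<close> give \<open>N\<close> and the basis of \<open>F\<close>.
\<close>
theorem \<Gamma>_generated: "generate \<Gamma> (h ` carrier M) = carrier \<Gamma>"
proof
  have hM: "h ` carrier M \<subseteq> carrier \<Gamma>"
    by (auto)
  let ?H = "generate \<Gamma> (h ` carrier M)"
  show "?H \<subseteq> carrier \<Gamma>"
    by (rule \<Gamma>.generate_incl[OF hM])
  have H: "subgroup ?H \<Gamma>"
    by (rule \<Gamma>.generate_is_subgroup[OF hM])
  have hH: "h y \<in> ?H" if "y \<in> carrier M" for y
    using that by (intro generate.incl) blast
  have mult: "g \<cdot> g' \<in> ?H" if "g \<in> ?H" "g' \<in> ?H" for g g'
    using subgroup.m_closed[OF H] that by blast
  have inv: "inv\<^bsub>\<Gamma>\<^esub> g \<in> ?H" if "g \<in> ?H" for g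
    using subgroup.m_inv_closed[OF H] that by blast
  have zL: "((\<one>, 0), \<alpha>) \<cdot> ((\<one>, 0), \<beta>) = ((\<one>, 0), \<alpha> \<bullet> \<beta>)" if "\<alpha> \<in> carrier L" "\<beta> \<in> carrier L" for \<alpha> \<beta>
    using that by (simp add: \<Gamma>_simps \<omega>_def)
  have zc: "((\<one>, 0), \<alpha>) \<in> carrier \<Gamma>" if "\<alpha> \<in> carrier L" for \<alpha>
    using that by (intro \<Gamma>_memI) auto
  have wH: "((\<one>, 0), u \<^bold>\<and> v) \<in> ?H" if uv: "u \<in> N" "v \<in> N" for u v
  proof -
    obtain y z where yz: "y \<in> carrier M" "z \<in> carrier M" "u = D y" "v = D z"
      using uv by (auto simp: N_def)
    have c: "h y \<in> carrier \<Gamma>" "h z \<in> carrier \<Gamma>" "((\<one>, 0), u \<^bold>\<and> v) \<in> carrier \<Gamma>"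
      using yz uv h_closed zc wd_closed by (blast+)
    have "h y \<cdot> h z = (h z \<cdot> h y) \<cdot> ((\<one>, 0), u \<^bold>\<and> v)"
      using \<Gamma>_commutator[OF c(1,2)] yz by (simp only: pr_h)
    then have "((\<one>, 0), u \<^bold>\<and> v) = inv\<^bsub>\<Gamma>\<^esub> (h z \<cdot> h y) \<cdot> (h y \<cdot> h z)"
      using c \<Gamma>.inv_solve_left[of "((\<one>, 0), u \<^bold>\<and> v)" "h z \<cdot> h y" "h y \<cdot> h z"] \<Gamma>.m_closed by metis
    then show ?thesis
      using mult inv hH yz by metis
  qed
  have LH: "((\<one>, 0), \<alpha>) \<in> ?H" if "\<alpha> \<in> carrier L" for \<alpha>
  proof -
    have "(\<lambda>\<alpha>. ((\<one>, 0), \<alpha>)) \<in> hom L \<Gamma>"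
      using zc zL by (intro homI) (auto)
    then interpret i: group_hom L \<Gamma> "\<lambda>\<alpha>. ((\<one>, 0), \<alpha>)"
      by (intro group_hom.intro group_hom_axioms.intro \<Gamma>.is_group L.is_group)
    let ?W = "{a \<^bold>\<and> b | a b. a \<in> carrier NM \<and> b \<in> carrier NM}"
    have "?W \<subseteq> carrier L"
      by auto
    note img = i.generate_img[OF this]
    have "(\<lambda>\<alpha>. ((\<one>, 0), \<alpha>)) ` ?W \<subseteq> ?H"
      using wH unfolding NM_simps by blast
    then have "(\<lambda>\<alpha>. ((\<one>, 0), \<alpha>)) ` generate L ?W \<subseteq> ?H"
      unfolding img[symmetric] by (rule \<Gamma>.generate_subgroup_incl[OF _ H])
    moreover have "\<alpha> \<in> generate L ?W"
      using that NE.wedge_generate by simp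
    ultimately show ?thesis
      by (rule subsetD[OF _ imageI])
  qed
  have FH: "\<exists>\<alpha>\<in>carrier L. ((\<one>, \<phi>), \<alpha>) \<in> ?H" if "keys \<phi> \<subseteq> S" for \<phi>
  proof -
    have "keys \<phi> \<subseteq> S \<and> (\<exists>\<alpha>\<in>carrier L. ((\<one>, \<phi>), \<alpha>) \<in> ?H)"
      using that
    proof (induction \<phi> rule: frag_induction)
      case zero
      show ?case
        by (intro conjI bexI[OF _ L.one_closed] LH L.one_closed) simp
    next
      case (one c)
      then have "h (sec c) = ((\<one>, frag_of c), \<one>\<^bsub>L\<^esub>)"
        by (simp add: h_sec gen_def)
      then show ?case
        using hH[of "sec c"] one by (auto simp: keys_frag_of intro!: bexI[of _ "\<one>\<^bsub>L\<^esub>"])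
    next
      case (diff u v)
      then obtain \<alpha> \<beta> where ab: "((\<one>, u), \<alpha>) \<in> ?H" "((\<one>, v), \<beta>) \<in> ?H" "\<alpha> \<in> carrier L" "\<beta> \<in> carrier L"
        by blast
      have keys: "keys (u - v) \<subseteq> S"
        using diff keys_diff[of u v] by blast
      define w where "w = inv\<^bsub>\<Gamma>\<^esub> ((\<one>, v), \<beta>)"
      have w: "w \<in> carrier \<Gamma>" "w \<cdot> ((\<one>, v), \<beta>) = \<one>\<^bsub>\<Gamma>\<^esub>"
        unfolding w_def using \<Gamma>_memI[of \<one> v \<beta>] diff ab \<Gamma>.inv_closed \<Gamma>.l_inv by (blast intro: N_one)+
      have "fst w = (\<one>, - v)"
      proof -
        obtain k \<phi> \<gamma> where kp: "w = ((k, \<phi>), \<gamma>)" "k \<in> N"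
          using w(1) unfolding carrier_\<Gamma> by blast
        then have "k \<otimes> \<one> = \<one>" "\<phi> + v = 0"
          using w(2) unfolding kp(1) \<Gamma>_mult \<Gamma>_one by blast+
        then show ?thesis
          using kp by (simp add: eq_neg_iff_add_eq_0)
      qed
      then obtain \<gamma> where \<gamma>: "((\<one>, u), \<alpha>) \<cdot> w = ((\<one>, u - v), \<gamma>)"
        by (simp add: \<Gamma>_simps)
      have "((\<one>, u), \<alpha>) \<cdot> w \<in> ?H"
        unfolding w_def by (intro mult inv ab)
      then have uv: "((\<one>, u - v), \<gamma>) \<in> ?H"
        by (simp only: \<gamma>)
      then have "((\<one>, u - v), \<gamma>) \<in> carrier \<Gamma>"
        by (rule subsetD[OF \<open>?H \<subseteq> carrier \<Gamma>\<close>])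
      then have "\<gamma> \<in> carrier L"
        unfolding carrier_\<Gamma> by (rule mem_Sigma_iff[THEN iffD1, THEN conjunct2])
      then show ?case
        using keys uv by blast
    qed
    then show ?thesis ..
  qed
  show "carrier \<Gamma> \<subseteq> ?H"
  proof
    fix g assume "g \<in> carrier \<Gamma>"
    then obtain k \<phi> \<alpha> where g: "g = ((k, \<phi>), \<alpha>)" "k \<in> N" "keys \<phi> \<subseteq> S" "\<alpha> \<in> carrier L"
      by (auto simp: carrier_\<Gamma>)
    obtain \<beta> where \<beta>: "\<beta> \<in> carrier L" "((\<one>, \<phi>), \<beta>) \<in> ?H"
      using FH[OF g(3)] by blast
    have kH: "((k, 0), \<one>\<^bsub>L\<^esub>) \<in> ?H"
      using hH[of k] g(2) h_N[of k] by simp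
    have "((k, 0), \<one>\<^bsub>L\<^esub>) \<cdot> ((\<one>, \<phi>), \<beta>) = ((k, \<phi>), \<beta>)"
      using g \<beta> by (simp add: \<Gamma>_simps \<omega>_def)
    then have "((k, \<phi>), \<beta>) \<in> ?H"
      using mult[OF kH \<beta>(2)] by simp
    moreover have "((k, \<phi>), \<beta>) \<cdot> ((\<one>, 0), inv\<^bsub>L\<^esub> \<beta> \<bullet> \<alpha>) = g"
      using g \<beta> by (simp add: \<Gamma>_simps \<omega>_def flip: L.m_assoc)
    moreover have "((\<one>, 0), inv\<^bsub>L\<^esub> \<beta> \<bullet> \<alpha>) \<in> ?H"
      using g \<beta> by (intro LH) simp
    ultimately show "g \<in> ?H"
      using mult by metis
  qed
qed

section \<open>Holonomy of edges\<close>

definition op where "op = alexander_op M T"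

lemma op_eq: "op x y = T x \<otimes> D y"
  by (simp add: op_def alexander_op_def)

lemma op_closed [simp]: "\<lbrakk>x \<in> carrier M; y \<in> carrier M\<rbrakk> \<Longrightarrow> op x y \<in> carrier M"
  by (simp add: op_eq)

lemma op_N [simp]: "\<lbrakk>x \<in> N; y \<in> carrier M\<rbrakk> \<Longrightarrow> op x y \<in> N"
  unfolding op_eq by (intro N_mult T_N D_in_N)

sublocale quandle "carrier M" op
  unfolding op_def by (rule quandle_alexander[OF M.comm_group_axioms T_iso])

lemma op_self: "x \<in> carrier M \<Longrightarrow> op x x = x"
  by (rule idem)

definition root where "root x = (if x = \<one> then \<one> else SOME y. y \<in> carrier M \<and> D y = x)"

lemma root:
  assumes "x \<in> N"
  shows root_closed [simp]: "root x \<in> carrier M" and D_root [simp]: "D (root x) = x"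
proof -
  have "\<exists>y. y \<in> carrier M \<and> D y = x"
    using assms by (auto simp: N_def)
  from someI_ex[OF this] show "root x \<in> carrier M" "D (root x) = x"
    by (auto simp: root_def)
qed

lemma root_one [simp]: "root \<one> = \<one>"
  by (simp add: root_def)

text \<open>
  An element over each vertex, with \<open>vert 0 = 1\<close>.
\<close>
definition vert where "vert x = h (root x)"

lemma vert_closed [simp]: "x \<in> N \<Longrightarrow> vert x \<in> carrier \<Gamma>"
  by (simp add: vert_def)

lemma pr_vert [simp]: "x \<in> N \<Longrightarrow> pr (vert x) = x"
  by (simp add: vert_def pr_h)

lemma vert_one [simp]: "vert \<one> = \<one>\<^bsub>\<Gamma>\<^esub>"
  by (simp add: vert_def h_one)

definition Z0 where "Z0 = kernel \<Gamma> NM pr"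
abbreviation ZG where "ZG \<equiv> \<Gamma>\<lparr>carrier := Z0\<rparr>"

sublocale pr: group_hom \<Gamma> NM pr
  using pr_hom comm_group_NM by (intro group_hom.intro group_hom_axioms.intro \<Gamma>.is_group) (auto simp: comm_group.axioms)

lemma mem_Z0: "g \<in> Z0 \<longleftrightarrow> g \<in> carrier \<Gamma> \<and> pr g = \<one>"
  by (simp add: Z0_def kernel_def)

lemma Z0_closed: "g \<in> Z0 \<Longrightarrow> g \<in> carrier \<Gamma>"
  by (simp add: mem_Z0)

lemma subgroup_Z0: "subgroup Z0 \<Gamma>"
  unfolding Z0_def by (rule pr.subgroup_kernel)

text \<open>
  The commutator with \<open>g\<close> is \<open>0 \<and> pr g\<close>.
\<close>
lemma Z0_central: 
  assumes "z \<in> Z0" "g \<in> carrier \<Gamma>"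
  shows "z \<cdot> g = g \<cdot> z"
proof -
  have "((\<one>, 0), \<one>\<^bsub>L\<^esub>) = \<one>\<^bsub>\<Gamma>\<^esub>"
    by (simp add: \<Gamma>_one)
  then show ?thesis
    using \<Gamma>_commutator[of z g] assms pr_in_N[of g] by (simp add: mem_Z0)
qed

lemma comm_group_ZG: "comm_group ZG"
proof (rule group.group_comm_groupI)
  show "group ZG"
    by (rule \<Gamma>.subgroup_imp_group[OF subgroup_Z0])
qed (simp add: Z0_central Z0_closed)

lemma inv_ZG: "g \<in> Z0 \<Longrightarrow> inv\<^bsub>ZG\<^esub> g = inv\<^bsub>\<Gamma>\<^esub> g"
  by (rule \<Gamma>.m_inv_consistent[OF subgroup_Z0])

lemma Z0_mult: "\<lbrakk>g \<in> Z0; g' \<in> Z0\<rbrakk> \<Longrightarrow> g \<cdot> g' \<in> Z0"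
  and Z0_inv: "g \<in> Z0 \<Longrightarrow> inv\<^bsub>\<Gamma>\<^esub> g \<in> Z0"
  and Z0_one: "\<one>\<^bsub>\<Gamma>\<^esub> \<in> Z0"
  using subgroup_Z0 by (auto simp: subgroup.m_closed subgroup.m_inv_closed subgroup.one_closed)

text \<open>
  A product that is central can be permuted cyclically.
\<close>
lemma Z0_rotate:
  assumes "g \<in> carrier \<Gamma>" "g' \<in> carrier \<Gamma>" "g \<cdot> g' \<in> Z0"
  shows "g' \<cdot> g = g \<cdot> g'"
proof -
  have "g' \<cdot> g = inv\<^bsub>\<Gamma>\<^esub> g \<cdot> ((g \<cdot> g') \<cdot> g)"
    using assms(1,2) by (simp add: \<Gamma>.m_assoc \<Gamma>.cancel_inv_left)
  also have "\<dots> = inv\<^bsub>\<Gamma>\<^esub> g \<cdot> (g \<cdot> (g \<cdot> g'))"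
    using Z0_central[OF assms(3,1)] by simp
  also have "\<dots> = g \<cdot> g'"
    using assms(1,2) by (simp add: \<Gamma>.cancel_inv_left)
  finally show ?thesis .
qed

definition weight where
  "weight x y = vert x \<cdot> inv\<^bsub>\<Gamma>\<^esub> (h x) \<cdot> (h y \<cdot> inv\<^bsub>\<Gamma>\<^esub> (vert (op x y)))"

lemma weight_in_Z0:
  assumes "x \<in> N" "y \<in> carrier M"
  shows "weight x y \<in> Z0"
proof -
  have xM: "x \<in> carrier M" using assms by simp
  have [simp]: "op x y \<in> N" "D x \<in> N" "D y \<in> N" using assms xM by auto
  have "x \<otimes> inv (D x) \<otimes> (D y \<otimes> inv (T x \<otimes> D y)) = (x \<otimes> inv (D x) \<otimes> inv (T x)) \<otimes> (D y \<otimes> inv (D y))"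
    using assms xM by (simp only: M.inv_mult M.m_ac M.inv_closed M.m_closed D_closed T_closed)
  also have "\<dots> = \<one>"
  proof -
    have "x \<otimes> inv (D x) \<otimes> inv (T x) = x \<otimes> inv (D x \<otimes> T x)"
      using xM by (simp add: M.m_assoc M.inv_mult)
    then show ?thesis
      using xM assms D_T[OF xM] by simp
  qed
  finally have "x \<otimes> inv (D x) \<otimes> (D y \<otimes> inv (op x y)) = \<one>"
    by (simp add: op_eq)
  then show ?thesis
    using assms xM unfolding weight_def mem_Z0 by (simp add: pr_h)
qed

lemma weight_self: "x \<in> N \<Longrightarrow> weight x x = \<one>\<^bsub>\<Gamma>\<^esub>"
  by (simp add: weight_def op_self \<Gamma>.m_assoc \<Gamma>.cancel_inv_left)

lemma h_op: 
  assumes "x \<in> carrier M" "y \<in> carrier M"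
  shows "h (T y) \<cdot> h (op x y) = h (T x) \<cdot> h y"
  using h_relation[of "T x" y] assms by (simp add: op_eq)

text \<open>
  The form in which \<open>h_relation\<close> enters the next lemma: the right side separates \<open>x\<close> from \<open>y\<close>.
\<close>
lemma h_op_inv: 
  assumes "x \<in> carrier M" "y \<in> carrier M"
  shows "h y \<cdot> inv\<^bsub>\<Gamma>\<^esub> h (op x y) = inv\<^bsub>\<Gamma>\<^esub> h (T x) \<cdot> h (T y)"
proof -
  have [simp]: "h y \<in> carrier \<Gamma>" "h (op x y) \<in> carrier \<Gamma>" "h (T x) \<in> carrier \<Gamma>" "h (T y) \<in> carrier \<Gamma>"
    using assms by simp_all
  have "inv\<^bsub>\<Gamma>\<^esub> h (T x) \<cdot> (h (T x) \<cdot> h y) \<cdot> inv\<^bsub>\<Gamma>\<^esub> h (op x y) = 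
     inv\<^bsub>\<Gamma>\<^esub> h (T x) \<cdot> (h (T y) \<cdot> h (op x y)) \<cdot> inv\<^bsub>\<Gamma>\<^esub> h (op x y)"
    by (simp only: h_op[OF assms])
  then show ?thesis
    by (simp add: \<Gamma>.m_assoc \<Gamma>.cancel_inv_left)
qed

text \<open>
  Inside the product \<open>vert (x * y)\<close> cancels and \<open>h_op_inv\<close> applies.  What is left depends on \<open>y\<close> and
  \<open>z\<close> only through \<open>h (T y) \<cdot> h z\<close> and the endpoint.
\<close>
lemma weight_path:
  assumes "x \<in> N" "y \<in> carrier M" "z \<in> carrier M"
  shows "weight x y \<cdot> weight (op x y) z =
    vert x \<cdot> inv\<^bsub>\<Gamma>\<^esub> (h x) \<cdot> inv\<^bsub>\<Gamma>\<^esub> h (T x) \<cdot> (h (T y) \<cdot> h z) \<cdot> inv\<^bsub>\<Gamma>\<^esub> vert (op (op x y) z)"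
proof -
  have [simp]: "vert x \<in> carrier \<Gamma>" "h x \<in> carrier \<Gamma>" "h y \<in> carrier \<Gamma>" "h z \<in> carrier \<Gamma>" "vert (op x y) \<in> carrier \<Gamma>"
    "h (op x y) \<in> carrier \<Gamma>" "vert (op (op x y) z) \<in> carrier \<Gamma>" "h (T x) \<in> carrier \<Gamma>" "h (T y) \<in> carrier \<Gamma>"
    using assms by simp_all
  have "weight x y \<cdot> weight (op x y) z =
    vert x \<cdot> inv\<^bsub>\<Gamma>\<^esub> (h x) \<cdot> (h y \<cdot> inv\<^bsub>\<Gamma>\<^esub> h (op x y)) \<cdot> h z \<cdot> inv\<^bsub>\<Gamma>\<^esub> vert (op (op x y) z)"
    unfolding weight_def by (simp add: \<Gamma>.m_assoc \<Gamma>.cancel_inv_left)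
  then show ?thesis
    using h_op_inv[of x y] assms by (simp add: \<Gamma>.m_assoc)
qed

theorem weight_cocycle:
  assumes "x \<in> N" "y \<in> carrier M" "z \<in> carrier M"
  shows "weight x y \<cdot> weight (op x y) z = weight x z \<cdot> weight (op x z) (op y z)"
  using weight_path[of x y z] weight_path[of x z "op y z"] h_op[of y z] self_distrib[of x y z] assms by simp

text \<open>
  Edges outside the component of 0 have no weight.
\<close>
definition edge_weight where
  "edge_weight xs = (if \<exists>x y. xs = [x, y] \<and> x \<in> N \<and> y \<in> carrier M then weight (xs ! 0) (xs ! 1) else \<one>\<^bsub>\<Gamma>\<^esub>)"

definition \<psi> where "\<psi> = free_lift ZG edge_weight"

lemma edge_weight_closed: "edge_weight xs \<in> carrier ZG"
  using weight_in_Z0 Z0_one by (auto simp: edge_weight_def)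

lemma \<psi>_in_Z0: "\<psi> u \<in> Z0"
  and \<psi>_add: "\<psi> (u + w) = \<psi> u \<cdot> \<psi> w"
  and \<psi>_diff: "\<psi> (u - w) = \<psi> u \<cdot> inv\<^bsub>\<Gamma>\<^esub> \<psi> w"
  and \<psi>_zero [simp]: "\<psi> 0 = \<one>\<^bsub>\<Gamma>\<^esub>"
  and \<psi>_frag_of: "\<psi> (frag_of xs) = edge_weight xs"
proof -
  note F = comm_group.free_lift[OF comm_group_ZG, of edge_weight, OF edge_weight_closed]
  show c: "\<psi> w \<in> Z0" for w
    using F(2) by (simp add: \<psi>_def)
  show "\<psi> (u + w) = \<psi> u \<cdot> \<psi> w" "\<psi> 0 = \<one>\<^bsub>\<Gamma>\<^esub>" "\<psi> (frag_of xs) = edge_weight xs"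
    using F by (simp_all add: \<psi>_def)
  show "\<psi> (u - w) = \<psi> u \<cdot> inv\<^bsub>\<Gamma>\<^esub> \<psi> w"
    using F(6)[of u w] c[of w] by (simp add: \<psi>_def inv_ZG)
qed

lemma \<psi>_edge: "\<lbrakk>x \<in> N; y \<in> carrier M\<rbrakk> \<Longrightarrow> \<psi> (frag_of [x, y]) = weight x y"
  by (simp add: \<psi>_frag_of edge_weight_def)

lemma \<psi>_outside: "x \<notin> N \<Longrightarrow> \<psi> (frag_of [x, y]) = \<one>\<^bsub>\<Gamma>\<^esub>"
  by (auto simp: \<psi>_frag_of edge_weight_def)

lemma op_N_iff: "\<lbrakk>x \<in> carrier M; y \<in> carrier M\<rbrakk> \<Longrightarrow> op x y \<in> N \<longleftrightarrow> x \<in> N"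
proof
  assume [simp]: "x \<in> carrier M" "y \<in> carrier M" and "op x y \<in> N"
  then have "op x y \<otimes> inv (D y) \<otimes> D x \<in> N"
    by (intro N_mult N_inv D_in_N)
  moreover have "op x y \<otimes> inv (D y) \<otimes> D x = T x \<otimes> D x \<otimes> (D y \<otimes> inv (D y))"
    unfolding op_eq by (simp only: M.m_ac M.m_closed M.inv_closed D_closed T_closed \<open>x \<in> carrier M\<close> \<open>y \<in> carrier M\<close>)
  moreover have "\<dots> = x"
    using D_T[of x] by (simp add: M.m_comm)
  ultimately show "x \<in> N"
    by simp
qed (rule op_N)

abbreviation Bd where "Bd \<equiv> boundaries (carrier M) op"

lemma \<psi>_degenerate: "d \<in> degenerate (carrier M) 2 \<Longrightarrow> \<psi> d = \<one>\<^bsub>\<Gamma>\<^esub>"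
proof (induction rule: degenerate_induct)
  case (gen xs i)
  then obtain x where "xs = [x, x]" "x \<in> carrier M"
    by (auto simp: tuples_2)
  then show ?case
    by (cases "x \<in> N") (simp_all add: \<psi>_edge \<psi>_outside weight_self)
qed (auto simp: \<psi>_diff)

lemma \<psi>_boundary: "keys t \<subseteq> tuples (carrier M) 3 \<Longrightarrow> \<psi> (rack_boundary op t) = \<one>\<^bsub>\<Gamma>\<^esub>"
proof (induction t rule: frag_induction)
  case (one xs)
  then obtain x y z where xs: "xs = [x, y, z]" and [simp]: "x \<in> carrier M" "y \<in> carrier M" "z \<in> carrier M"
    by (auto simp: tuples_3)
  show ?case
  proof (cases "x \<in> N")
    case True
    have W: "weight x y \<in> Z0" "weight (op x y) z \<in> Z0" "weight x z \<in> Z0" "weight (op x z) (op y z) \<in> Z0"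
      using True by (simp_all add: weight_in_Z0)
    interpret ZG: comm_group ZG by (rule comm_group_ZG)
    have "weight x z \<otimes>\<^bsub>ZG\<^esub> inv\<^bsub>ZG\<^esub> weight (op x y) z \<otimes>\<^bsub>ZG\<^esub> inv\<^bsub>ZG\<^esub> (weight x y \<otimes>\<^bsub>ZG\<^esub> inv\<^bsub>ZG\<^esub> weight (op x z) (op y z))
        = (weight x z \<otimes>\<^bsub>ZG\<^esub> weight (op x z) (op y z)) \<otimes>\<^bsub>ZG\<^esub> inv\<^bsub>ZG\<^esub> (weight x y \<otimes>\<^bsub>ZG\<^esub> weight (op x y) z)"
      by (rule ZG.diff_diff_eq) (use W in simp_all)
    also have "\<dots> = \<one>\<^bsub>ZG\<^esub>"
      using W weight_cocycle[of x y z] True ZG.r_inv[of "weight x y \<cdot> weight (op x y) z"] by (simp add: Z0_mult)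
    finally show ?thesis
      using W True unfolding xs rack_boundary_3 by (simp add: \<psi>_diff \<psi>_edge inv_ZG Z0_mult Z0_inv)
  next
    case False
    then show ?thesis
      unfolding xs rack_boundary_3 by (simp add: \<psi>_diff \<psi>_outside op_N_iff)
  qed
qed (auto simp: rack_boundary_diff \<psi>_diff)

lemma \<psi>_boundaries: "u \<in> Bd \<Longrightarrow> \<psi> u = \<one>\<^bsub>\<Gamma>\<^esub>"
  by (auto simp: boundaries_def \<psi>_add \<psi>_degenerate \<psi>_boundary)

section \<open>Every central element is the holonomy of a cycle\<close>

text \<open>
  The edges of the component of 0.
\<close>
definition K0 where "K0 = {[x, y] | x y. x \<in> N \<and> y \<in> carrier M}"

lemma T_N_surj:
  assumes "x \<in> N"
  obtains x0 where "x0 \<in> N" "T x0 = x"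
proof -
  obtain y where y: "y \<in> carrier M" "x = D y"
    using assms by (auto simp: N_def)
  have "T ` carrier M = carrier M"
    using T_iso by (simp add: iso_def bij_betw_def)
  then obtain y0 where "y0 \<in> carrier M" "T y0 = y"
    using y(1) by (metis imageE)
  then have "D y0 \<in> N" "T (D y0) = x"
    using y by (simp_all add: T_D)
  then show thesis
    using that by blast
qed

text \<open>
  The edge \<open>(x\<^sub>0, y)\<close> ends in \<open>T x\<^sub>0 + D y\<close>, so going back along \<open>(x\<^sub>0, 0)\<close> and then along \<open>(x\<^sub>0, y)\<close>
  with \<open>T x\<^sub>0 = x\<close> amounts to a step from \<open>x\<close> to \<open>x + D y\<close>.  Its holonomy compares \<open>vert x \<cdot> h y\<close> with
  \<open>vert (x + D y)\<close>.
\<close>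
lemma step_chain:
  assumes "x \<in> N" "y \<in> carrier M"
  obtains u where "keys u \<subseteq> K0" "rack_boundary op u = frag_of [x] - frag_of [x \<otimes> D y]"
    "\<psi> u = vert x \<cdot> (h y \<cdot> inv\<^bsub>\<Gamma>\<^esub> vert (x \<otimes> D y))"
proof -
  obtain x0 where x0: "x0 \<in> N" "T x0 = x"
    using assms T_N_surj by blast
  define u where "u = frag_of [x0, y] - frag_of [x0, \<one>]"
  have op: "op x0 y = x \<otimes> D y" "op x0 \<one> = x"
    using x0 assms by (simp_all add: op_eq)
  have xy: "x \<otimes> D y \<in> N"
    using assms by (intro N_mult D_in_N)
  have "keys u \<subseteq> K0"
    unfolding u_def using x0 assms by (intro order_trans[OF keys_diff]) (auto simp: keys_frag_of K0_def)
  moreover have "rack_boundary op u = frag_of [x] - frag_of [x \<otimes> D y]"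
    by (simp add: u_def rack_boundary_diff rack_boundary_2 op)
  moreover have "\<psi> u = vert x \<cdot> (h y \<cdot> inv\<^bsub>\<Gamma>\<^esub> vert (x \<otimes> D y))"
  proof -
    \<comment> \<open>With these, the two edges have the weights \<open>c \<cdot> w'\<close> and \<open>c \<cdot> w\<^sup>-\<^sup>1\<close>; their quotient is central and hence not changed by conjugation with \<open>c\<close>.\<close>
    define c w w' where "c = vert x0 \<cdot> inv\<^bsub>\<Gamma>\<^esub> h x0" and "w = vert x" and "w' = h y \<cdot> inv\<^bsub>\<Gamma>\<^esub> vert (x \<otimes> D y)"
    have [simp]: "c \<in> carrier \<Gamma>" "w \<in> carrier \<Gamma>" "w' \<in> carrier \<Gamma>"
      unfolding c_def w_def w'_def using x0 assms xy by simp_all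
    have "weight x0 y = c \<cdot> w'" "weight x0 \<one> = c \<cdot> inv\<^bsub>\<Gamma>\<^esub> w"
      using x0 assms by (simp_all add: weight_def op c_def w_def w'_def h_one)
    then have \<psi>u: "\<psi> u = (c \<cdot> w') \<cdot> inv\<^bsub>\<Gamma>\<^esub> (c \<cdot> inv\<^bsub>\<Gamma>\<^esub> w)"
      unfolding u_def using x0 assms by (simp add: \<psi>_diff \<psi>_edge)
    then have e: "\<psi> u = c \<cdot> (w' \<cdot> w \<cdot> inv\<^bsub>\<Gamma>\<^esub> c)"
      by (simp add: \<Gamma>.inv_mult_group \<Gamma>.m_assoc)
    have "(w' \<cdot> w \<cdot> inv\<^bsub>\<Gamma>\<^esub> c) \<cdot> c = \<psi> u"
      using Z0_rotate[of c "w' \<cdot> w \<cdot> inv\<^bsub>\<Gamma>\<^esub> c"] \<psi>_in_Z0[of u] e by simp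
    then have "w' \<cdot> w = \<psi> u"
      by (simp add: \<Gamma>.m_assoc)
    then have "\<psi> u = w \<cdot> w'"
      using Z0_rotate[of w' w] \<psi>_in_Z0[of u] by simp
    then show ?thesis
      by (simp add: w_def w'_def)
  qed
  ultimately show thesis
    using that by blast
qed

text \<open>
  Words in the \<open>h y\<close> are followed step by step.  Stating this for an arbitrary starting element \<open>a\<close>
  lets the induction run over the generation of \<open>g\<close>, where products of two arbitrary elements occur.
\<close>
lemma path_chain:
  assumes "g \<in> generate \<Gamma> (h ` carrier M)"
    and "a \<in> carrier \<Gamma>" "keys u \<subseteq> K0" "rack_boundary op u = frag_of [\<one>] - frag_of [pr a]"
    "\<psi> u = a \<cdot> inv\<^bsub>\<Gamma>\<^esub> vert (pr a)"
  shows "\<exists>w. keys w \<subseteq> K0 \<and> rack_boundary op w = frag_of [\<one>] - frag_of [pr (a \<cdot> g)] \<and>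
    \<psi> w = a \<cdot> g \<cdot> inv\<^bsub>\<Gamma>\<^esub> vert (pr (a \<cdot> g))"
  using assms
proof (induction arbitrary: a u rule: generate.induct)
  case one
  then show ?case
    by (intro exI[of _ u]) simp
next
  case (incl g)
  then obtain y where y: "y \<in> carrier M" "g = h y"
    by blast
  have x: "pr a \<in> N"
    using pr_in_N incl by blast
  have x': "pr a \<otimes> D y \<in> N"
    using x y by (intro N_mult D_in_N)
  obtain s where s: "keys s \<subseteq> K0" "rack_boundary op s = frag_of [pr a] - frag_of [pr a \<otimes> D y]"
    "\<psi> s = vert (pr a) \<cdot> (h y \<cdot> inv\<^bsub>\<Gamma>\<^esub> vert (pr a \<otimes> D y))"
    using step_chain[OF x y(1)] by blast
  show ?case
  proof (intro exI[of _ "u + s"] conjI)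
    show "keys (u + s) \<subseteq> K0"
      using keys_add[of u s] incl s by blast
    show "rack_boundary op (u + s) = frag_of [\<one>] - frag_of [pr (a \<cdot> g)]"
      using incl s y by (simp add: rack_boundary_add pr_h)
    show "\<psi> (u + s) = a \<cdot> g \<cdot> inv\<^bsub>\<Gamma>\<^esub> vert (pr (a \<cdot> g))"
      using incl s y x x' by (simp add: \<psi>_add pr_h \<Gamma>.m_assoc \<Gamma>.cancel_inv_left)
  qed
next
  case (inv g)
  then obtain y where y: "y \<in> carrier M" "g = h y"
    by blast
  define x where "x = pr a \<otimes> inv (D y)"
  have pa: "pr a \<in> N"
    using pr_in_N inv by blast
  have x: "x \<in> N"
    unfolding x_def using pa y by (intro N_mult N_inv D_in_N)
  have xD: "x \<otimes> D y = pr a"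
    unfolding x_def using pa y by (simp add: M.m_assoc)
  obtain s where s: "keys s \<subseteq> K0" "rack_boundary op s = frag_of [x] - frag_of [pr a]"
    "\<psi> s = vert x \<cdot> (h y \<cdot> inv\<^bsub>\<Gamma>\<^esub> vert (pr a))"
    using step_chain[OF x y(1)] unfolding xD by blast
  have pg: "pr (a \<cdot> inv\<^bsub>\<Gamma>\<^esub> g) = x"
    using inv y by (simp add: pr_h x_def)
  show ?case
  proof (intro exI[of _ "u - s"] conjI)
    show "keys (u - s) \<subseteq> K0"
      using keys_diff[of u s] inv s by blast
    show "rack_boundary op (u - s) = frag_of [\<one>] - frag_of [pr (a \<cdot> inv\<^bsub>\<Gamma>\<^esub> g)]"
      unfolding pg using inv s y by (simp add: rack_boundary_diff)
    show "\<psi> (u - s) = a \<cdot> inv\<^bsub>\<Gamma>\<^esub> g \<cdot> inv\<^bsub>\<Gamma>\<^esub> vert (pr (a \<cdot> inv\<^bsub>\<Gamma>\<^esub> g))"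
      unfolding pg using inv s y x pa by (simp add: \<psi>_diff \<Gamma>.inv_mult_group \<Gamma>.m_assoc \<Gamma>.cancel_inv_left)
  qed
next
  case (eng g g')
  have hM: "h ` carrier M \<subseteq> carrier \<Gamma>"
    by auto
  have c: "g \<in> carrier \<Gamma>" "g' \<in> carrier \<Gamma>"
    using eng.hyps \<Gamma>.generate_in_carrier[OF hM] by blast+
  obtain w where w: "keys w \<subseteq> K0" "rack_boundary op w = frag_of [\<one>] - frag_of [pr (a \<cdot> g)]"
    "\<psi> w = a \<cdot> g \<cdot> inv\<^bsub>\<Gamma>\<^esub> vert (pr (a \<cdot> g))"
    using eng.IH(1)[OF eng.prems] by blast
  have "a \<cdot> g \<in> carrier \<Gamma>"
    using eng.prems c by simp
  from eng.IH(2)[OF this w] show ?case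
    using eng.prems(1) c by (simp add: \<Gamma>.m_assoc)
qed

theorem \<psi>_surjective:
  assumes "g \<in> Z0"
  obtains u where "keys u \<subseteq> K0" "rack_boundary op u = 0" "\<psi> u = g"
proof -
  have g: "g \<in> generate \<Gamma> (h ` carrier M)"
    using assms \<Gamma>_generated by (simp add: mem_Z0)
  obtain w where "keys w \<subseteq> K0" "rack_boundary op w = frag_of [\<one>] - frag_of [pr (\<one>\<^bsub>\<Gamma>\<^esub> \<cdot> g)]"
    "\<psi> w = \<one>\<^bsub>\<Gamma>\<^esub> \<cdot> g \<cdot> inv\<^bsub>\<Gamma>\<^esub> vert (pr (\<one>\<^bsub>\<Gamma>\<^esub> \<cdot> g))"
    using path_chain[OF g \<Gamma>.one_closed, of 0] by auto
  then show thesis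
    using that[of w] assms by (simp add: mem_Z0)
qed

section \<open>A cocycle of loops\<close>

abbreviation e where "e x y \<equiv> frag_of [x, y]"

lemma subgroup_Bd: "subgroup Bd (free_Abelian_group UNIV)"
  unfolding subgroup_free_Abelian_group_iff
proof (intro conjI ballI)
  show "0 \<in> Bd"
    using degenerate_closed(4)[OF frag_of_degenerate[OF M.one_closed] frag_of_degenerate[OF M.one_closed]]
    unfolding boundaries_def by force
  show "u - w \<in> Bd" if uw: "u \<in> Bd" "w \<in> Bd" for u w
  proof -
    obtain d t d' t' where *: "u = d + rack_boundary op t" "w = d' + rack_boundary op t'"
      "d \<in> degenerate (carrier M) 2" "d' \<in> degenerate (carrier M) 2"
      "keys t \<subseteq> tuples (carrier M) 3" "keys t' \<subseteq> tuples (carrier M) 3"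
      using uw by (auto simp: boundaries_def)
    then have "u - w = (d - d') + rack_boundary op (t - t')"
      by (simp add: rack_boundary_diff)
    moreover have "keys (t - t') \<subseteq> tuples (carrier M) 3"
      using * keys_diff[of t t'] by blast
    ultimately show ?thesis
      unfolding boundaries_def using * degenerate_closed by blast
  qed
qed auto

lemma Bd_diff: "u \<in> Bd \<Longrightarrow> w \<in> Bd \<Longrightarrow> u - w \<in> Bd" and Bd_zero [simp]: "0 \<in> Bd"
  using subgroup_Bd by (auto simp: subgroup_free_Abelian_group_iff)

lemma Bd_minus: "u \<in> Bd \<Longrightarrow> - u \<in> Bd"
  using Bd_diff[of 0 u] by simp

lemma Bd_add: "u \<in> Bd \<Longrightarrow> w \<in> Bd \<Longrightarrow> u + w \<in> Bd"
  using Bd_diff[of u "- w"] Bd_minus by simp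

lemma Bd_self: "x \<in> carrier M \<Longrightarrow> e x x \<in> Bd"
  unfolding boundaries_def using frag_of_degenerate[of x] by (force intro: exI[of _ 0])

lemma Bd_cell:
  assumes "x \<in> carrier M" "y \<in> carrier M" "z \<in> carrier M"
  shows "e x z - e (op x y) z - (e x y - e (op x z) (op y z)) \<in> Bd"
proof -
  have "0 \<in> degenerate (carrier M) 2"
    using degenerate_closed(4)[OF frag_of_degenerate[OF M.one_closed] frag_of_degenerate[OF M.one_closed]] .
  moreover have "keys (frag_of [x, y, z]) \<subseteq> tuples (carrier M) 3"
    using assms by (auto simp: keys_frag_of tuples_3)
  ultimately show ?thesis
    unfolding boundaries_def rack_boundary_3[symmetric] by force
qed

definition ti where "ti = inv_into (carrier M) T"

lemma ti_closed [simp]: "x \<in> carrier M \<Longrightarrow> ti x \<in> carrier M"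
  and T_ti [simp]: "x \<in> carrier M \<Longrightarrow> T (ti x) = x"
  and ti_T [simp]: "x \<in> carrier M \<Longrightarrow> ti (T x) = x"
proof -
  have b: "bij_betw T (carrier M) (carrier M)"
    using T_iso by (simp add: iso_def)
  show "x \<in> carrier M \<Longrightarrow> ti x \<in> carrier M"
    using b inv_into_into[of x T "carrier M"] by (simp add: ti_def bij_betw_def)
  show "x \<in> carrier M \<Longrightarrow> T (ti x) = x"
    using b f_inv_into_f[of x T "carrier M"] by (simp add: ti_def bij_betw_def)
  show "x \<in> carrier M \<Longrightarrow> ti (T x) = x"
    using b by (simp add: ti_def bij_betw_def)
qed

lemma ti_fix: "\<lbrakk>r \<in> carrier M; D r = \<one>\<rbrakk> \<Longrightarrow> ti r = r"
  using D_T[of r] ti_T[of r] by simp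

text \<open>
  The loop at 0 that runs along \<open>(0, T\<^sup>-\<^sup>1 a)\<close> and \<open>(D (T\<^sup>-\<^sup>1 a), b)\<close> and returns along \<open>(0, a + b)\<close>.
\<close>
definition \<mu> where "\<mu> a b = e \<one> (ti a) + e (D (ti a)) b - e \<one> (a \<otimes> b)"

lemma \<mu>_T: "a \<in> carrier M \<Longrightarrow> \<mu> (T a) b = e \<one> a + e (D a) b - e \<one> (T a \<otimes> b)"
  by (simp add: \<mu>_def)

lemma op_one: "y \<in> carrier M \<Longrightarrow> op \<one> y = D y"
  by (simp add: op_eq)

text \<open>
  The square at the vertex 0.
\<close>
lemma \<mu>_exchange:
  assumes [simp]: "y \<in> carrier M" "z \<in> carrier M"
  shows "\<mu> (T z) (op y z) - \<mu> (T y) z \<in> Bd"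
proof -
  have s: "T z \<otimes> op y z = T y \<otimes> z"
    by (simp add: op_eq one_minus_def M.group_normalize)
  have "\<mu> (T z) (op y z) - \<mu> (T y) z = e \<one> z - e (op \<one> y) z - (e \<one> y - e (op \<one> z) (op y z))"
    by (simp add: \<mu>_T s op_one)
  then show ?thesis
    using Bd_cell[of \<one> y z] by simp
qed

lemma \<mu>_one_left: "b \<in> carrier M \<Longrightarrow> \<mu> \<one> b \<in> Bd"
  using \<mu>_T[of \<one> b] Bd_self[of \<one>] by simp

lemma \<mu>_one_right:
  assumes "a \<in> carrier M"
  shows "\<mu> a \<one> \<in> Bd"
  using Bd_diff[OF \<mu>_one_left[of a] \<mu>_exchange[of "ti a" \<one>]] assms by (simp add: op_eq)

text \<open>
  The square at the vertex \<open>D (T\<^sup>-\<^sup>1 a)\<close>: the edges from 0 to its corners cancel.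
\<close>
lemma \<mu>_square:
  assumes [simp]: "a \<in> carrier M" "y \<in> carrier M" "z \<in> carrier M"
  shows "\<mu> a z + \<mu> (T (a \<otimes> z)) (op y z) - \<mu> (T (a \<otimes> y)) z - \<mu> a y \<in> Bd"
proof -
  have xy: "op (D (ti a)) y = D (a \<otimes> y)" "op (D (ti a)) z = D (a \<otimes> z)"
    by (simp_all add: op_eq T_D)
  have s: "T (a \<otimes> z) \<otimes> op y z = T (a \<otimes> y) \<otimes> z"
    by (simp add: op_eq one_minus_def M.group_normalize)
  have "\<mu> a z + \<mu> (T (a \<otimes> z)) (op y z) - \<mu> (T (a \<otimes> y)) z - \<mu> a y =
      e (D (ti a)) z - e (op (D (ti a)) y) z - (e (D (ti a)) y - e (op (D (ti a)) z) (op y z))"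
    unfolding xy using \<mu>_T[of "a \<otimes> z" "op y z"] \<mu>_T[of "a \<otimes> y" z] by (simp add: s[simplified] \<mu>_def)
  then show ?thesis
    using Bd_cell[of "D (ti a)" y z] by simp
qed

text \<open>
  The previous relation, with its second term rewritten by \<open>\<mu>_exchange\<close> and in terms of
  \<open>q = T (a + y) - a\<close>.
\<close>
lemma \<mu>_square':
  assumes [simp]: "a \<in> carrier M" "q \<in> carrier M" "z \<in> carrier M"
  shows "\<mu> a z + \<mu> q (a \<otimes> z) - \<mu> (q \<otimes> a) z - \<mu> a (ti (q \<otimes> a) \<otimes> inv a) \<in> Bd"
proof -
  define y where "y = ti (q \<otimes> a) \<otimes> inv a"
  have [simp]: "y \<in> carrier M"
    by (simp add: y_def)
  have Ty: "T y = q \<otimes> a \<otimes> inv (T a)"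
    by (simp add: y_def)
  have Tay: "T (a \<otimes> y) = q \<otimes> a"
    by (simp add: Ty M.group_normalize)
  have "op (ti q) (a \<otimes> z) = op y z"
    by (simp add: op_eq Ty one_minus_def M.group_normalize)
  then have "\<mu> (T (a \<otimes> z)) (op y z) - \<mu> q (a \<otimes> z) \<in> Bd"
    using \<mu>_exchange[of "ti q" "a \<otimes> z"] by simp
  from Bd_diff[OF \<mu>_square[of a y z] this] show ?thesis
    unfolding Tay y_def[symmetric] by (simp add: algebra_simps)
qed

text \<open>
  The previous relation for \<open>z = 0\<close>.  It replaces the last term there and yields the cocycle
  identity.
\<close>
lemma \<mu>_rotate:
  assumes [simp]: "a \<in> carrier M" "q \<in> carrier M"
  shows "\<mu> q a - \<mu> a (ti (q \<otimes> a) \<otimes> inv a) \<in> Bd"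
  using Bd_add[OF Bd_diff[OF \<mu>_square'[of a q \<one>] \<mu>_one_right[of a]] \<mu>_one_right[of "q \<otimes> a"]]
  by (simp add: algebra_simps)

lemma \<mu>_cocycle:
  assumes [simp]: "x \<in> carrier M" "y \<in> carrier M" "z \<in> carrier M"
  shows "\<mu> x y + \<mu> (x \<otimes> y) z - (\<mu> y z + \<mu> x (y \<otimes> z)) \<in> Bd"
  using Bd_diff[OF \<mu>_rotate[of y x] \<mu>_square'[of y x z]] by (simp add: algebra_simps)

lemma \<mu>_T_invariant:
  assumes [simp]: "a \<in> carrier M" "y \<in> carrier M"
  shows "\<mu> (T a) (T y) - \<mu> a y \<in> Bd"
proof -
  define q where "q = T (a \<otimes> y) \<otimes> inv a"
  have [simp]: "q \<in> carrier M"
    by (simp add: q_def)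
  have qa: "q \<otimes> a = T (a \<otimes> y)"
    by (simp add: q_def M.m_assoc)
  have "ti (q \<otimes> a) \<otimes> inv a = y"
    unfolding qa by (simp add: M.group_normalize del: T_mult)
  then have 1: "\<mu> q a - \<mu> a y \<in> Bd"
    using \<mu>_rotate[of a q] by simp
  have "op (ti q) a = T y"
    by (simp add: op_eq q_def one_minus_def M.group_normalize)
  then have "\<mu> (T a) (T y) - \<mu> q a \<in> Bd"
    using \<mu>_exchange[of "ti q" a] by simp
  from Bd_add[OF this 1] show ?thesis
    by (simp add: algebra_simps)
qed

definition lam where "lam a b = \<mu> a b - \<mu> b a"

text \<open>
  The antisymmetrization of a 2-cocycle on an abelian group is biadditive: combine the cocycle
  identities for \<open>(a, b, c)\<close>, \<open>(c, a, b)\<close> and \<open>(a, c, b)\<close>.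
\<close>
lemma lam_left:
  assumes [simp]: "a \<in> carrier M" "b \<in> carrier M" "c \<in> carrier M"
  shows "lam (a \<otimes> b) c - (lam a c + lam b c) \<in> Bd"
proof -
  have "lam (a \<otimes> b) c - (lam a c + lam b c) =
      (\<mu> a b + \<mu> (a \<otimes> b) c - (\<mu> b c + \<mu> a (b \<otimes> c))) 
      + (\<mu> c a + \<mu> (c \<otimes> a) b - (\<mu> a b + \<mu> c (a \<otimes> b)))
      - (\<mu> a c + \<mu> (a \<otimes> c) b - (\<mu> c b + \<mu> a (c \<otimes> b)))"
    by (simp add: lam_def M.m_comm[of c a] M.m_comm[of c b] algebra_simps)
  also have "\<dots> \<in> Bd"
    by (intro Bd_diff Bd_add \<mu>_cocycle) simp_all
  finally show ?thesis .
qed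

lemma lam_swap: "lam b a = - lam a b"
  by (simp add: lam_def)

lemma lam_self [simp]: "lam a a = 0"
  by (simp add: lam_def)

text \<open>
  If \<open>D r = 0\<close> then \<open>\<mu>_exchange\<close> itself exchanges \<open>r\<close> and \<open>b\<close>.
\<close>
lemma lam_fixed:
  assumes [simp]: "r \<in> carrier M" "b \<in> carrier M" and r: "D r = \<one>"
  shows "lam r b \<in> Bd"
proof -
  have Tr: "T r = r"
    using D_T[of r] r by simp
  have "op (ti b) r = b"
    using r by (simp add: op_eq)
  then show ?thesis
    using \<mu>_exchange[of "ti b" r] by (simp add: Tr lam_def)
qed

lemma lam_cong_left:
  assumes [simp]: "a \<in> carrier M" "a' \<in> carrier M" "b \<in> carrier M" and D: "D a = D a'"
  shows "lam a b - lam a' b \<in> Bd"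
proof -
  have eq: "a = a' \<otimes> (inv a' \<otimes> a)"
    by (simp add: M.group_normalize)
  have "D (inv a' \<otimes> a) = \<one>"
    using D by simp
  then have "lam (inv a' \<otimes> a) b \<in> Bd"
    by (intro lam_fixed) simp_all
  from Bd_add[OF lam_left[of a' "inv a' \<otimes> a" b] this] show ?thesis
    by (simp add: eq[symmetric])
qed

lemma lam_cong:
  assumes "a \<in> carrier M" "a' \<in> carrier M" "b \<in> carrier M" "b' \<in> carrier M" "D a = D a'" "D b = D b'"
  shows "lam a b - lam a' b' \<in> Bd"
  using Bd_diff[OF lam_cong_left[of a a' b] lam_cong_left[of b b' a']] assms
  by (simp add: lam_swap[of b a'] lam_swap[of b' a'])

lemma lam_T:
  assumes "a \<in> carrier M" "b \<in> carrier M"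
  shows "lam (T a) (T b) - lam a b \<in> Bd"
  using Bd_diff[OF \<mu>_T_invariant[of a b] \<mu>_T_invariant[of b a]] assms by (simp add: lam_def algebra_simps)

text \<open>
  The cocycle identity for \<open>(T z, D z, a)\<close>, where \<open>T z + D z = z\<close>.  So \<open>\<mu>\<close> vanishes modulo
  commutators when its first argument lies in \<open>N\<close>.
\<close>
lemma \<mu>_N:
  assumes [simp]: "z \<in> carrier M" "a \<in> carrier M"
  shows "\<mu> (D z) a - lam z a \<in> Bd"
proof -
  have 1: "\<mu> (T z) (D z) - \<mu> \<one> z \<in> Bd"
    using \<mu>_exchange[of \<one> z] by (simp add: op_one)
  have op: "op (ti a) z = D z \<otimes> a"
    by (simp add: op_eq M.m_comm)
  have 2: "\<mu> (T z) (D z \<otimes> a) - \<mu> a z \<in> Bd"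
    using \<mu>_exchange[of "ti a" z] by (simp add: op)
  have z: "T z \<otimes> D z = z"
    using D_T[of z] by (simp add: M.m_comm)
  have "\<mu> (D z) a - lam z a = (\<mu> (T z) (D z) - \<mu> \<one> z) + \<mu> \<one> z - (\<mu> (T z) (D z \<otimes> a) - \<mu> a z)
     - (\<mu> (T z) (D z) + \<mu> (T z \<otimes> D z) a - (\<mu> (D z) a + \<mu> (T z) (D z \<otimes> a)))"
    by (simp add: lam_def z)
  also have "\<dots> \<in> Bd"
    by (intro Bd_diff Bd_add 1 2 \<mu>_cocycle \<mu>_one_left) simp_all
  finally show ?thesis .
qed

section \<open>Commutators of loops\<close>

abbreviation FU :: "('a list \<Rightarrow>\<^sub>0 int) monoid" where "FU \<equiv> free_Abelian_group UNIV"

definition Q where "Q = FU Mod Bd"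
definition cls where "cls u = Bd #>\<^bsub>FU\<^esub> u"

lemmas cls = frag_quotient[OF subgroup_Bd, folded Q_def cls_def]
lemmas comm_group_Q = cls(1) and cls_closed [simp] = cls(2) and cls_add = cls(3)
  and cls_diff = cls(4) and cls_zero = cls(5) and cls_eq_iff = cls(6)

text \<open>
  As \<open>lam a b\<close> depends only on \<open>D a\<close> and \<open>D b\<close>, it defines a map on \<open>N \<times> N\<close>, to which the universal
  property of \<open>L\<close> applies.
\<close>
lemma lambda_bar:
  obtains l where "l \<in> hom L Q" "\<And>a b. \<lbrakk>a \<in> carrier M; b \<in> carrier M\<rbrakk> \<Longrightarrow> l (D a \<^bold>\<and> D b) = cls (lam a b)"
proof -
  have root_mult: "D (root (a \<otimes> a')) = D (root a \<otimes> root a')" if "a \<in> N" "a' \<in> N" for a a'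
    using that N_mult[OF that] by simp
  have left: "cls (lam (root (a \<otimes> a')) (root b)) = cls (lam (root a) (root b)) \<otimes>\<^bsub>Q\<^esub> cls (lam (root a') (root b))"
    if "a \<in> N" "a' \<in> N" "b \<in> N" for a a' b
    unfolding cls_add[symmetric] cls_eq_iff
    using Bd_add[OF lam_cong_left[of "root (a \<otimes> a')" "root a \<otimes> root a'" "root b"] lam_left[of "root a" "root a'" "root b"]]
      root_mult[of a a'] that N_mult[OF that(1,2)] by (simp add: algebra_simps)
  have right: "cls (lam (root b) (root (a \<otimes> a'))) = cls (lam (root b) (root a)) \<otimes>\<^bsub>Q\<^esub> cls (lam (root b) (root a'))"
    if "a \<in> N" "a' \<in> N" "b \<in> N" for a a' b
  proof -
    have "lam (root (a \<otimes> a')) (root b) - (lam (root a) (root b) + lam (root a') (root b)) \<in> Bd"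
      using left[OF that] unfolding cls_add[symmetric] cls_eq_iff .
    from Bd_minus[OF this] show ?thesis
      unfolding cls_add[symmetric] cls_eq_iff lam_swap[of "root b"] by (simp add: algebra_simps)
  qed
  have T: "cls (lam (root (T a)) (root (T b))) = cls (lam (root a) (root b))" if "a \<in> N" "b \<in> N" for a b
    unfolding cls_eq_iff
    using Bd_add[OF lam_cong[of "root (T a)" "T (root a)" "root (T b)" "T (root b)"] lam_T[of "root a" "root b"]] that
    by (simp flip: T_D)
  obtain l where l: "l \<in> hom L Q"
    "\<And>a b. \<lbrakk>a \<in> carrier NM; b \<in> carrier NM\<rbrakk> \<Longrightarrow> l (a \<^bold>\<and> b) = cls (lam (root a) (root b))"
    by (rule NE.wedge_universal[OF comm_group_Q, of "\<lambda>a b. cls (lam (root a) (root b))"])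
      (simp_all add: left right T cls_zero)
  show thesis
  proof (rule that[OF l(1)])
    fix a b assume ab: "a \<in> carrier M" "b \<in> carrier M"
    have "lam (root (D a)) (root (D b)) - lam a b \<in> Bd"
      using ab by (intro lam_cong) simp_all
    then show "l (D a \<^bold>\<and> D b) = cls (lam a b)"
      using l(2)[of "D a" "D b"] ab by (simp add: cls_eq_iff)
  qed
qed

text \<open>
  The elements over the vertices cancel, and \<open>h (T y) \<cdot> h (D y) = h y\<close> removes the remaining factor.
\<close>
lemma \<psi>_\<mu>:
  assumes [simp]: "a \<in> carrier M" "b \<in> carrier M"
  shows "\<psi> (\<mu> a b) = h a \<cdot> h b \<cdot> inv\<^bsub>\<Gamma>\<^esub> h (a \<otimes> b)"
proof -
  define y where "y = ti a"
  have [simp]: "y \<in> carrier M" and a: "a = T y"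
    by (simp_all add: y_def)
  define x where "x = D y"
  have [simp]: "x \<in> N" "D (a \<otimes> b) \<in> N"
    unfolding x_def by (intro D_in_N; simp)+
  have opx: "op x b = D (a \<otimes> b)"
    by (simp add: x_def op_eq a T_D)
  have hx: "h a \<cdot> h x = h y"
    using h_op[of \<one> y] by (simp add: op_one a x_def h_one)
  have "inv\<^bsub>\<Gamma>\<^esub> (h x) = inv\<^bsub>\<Gamma>\<^esub> (h y) \<cdot> h a"
    unfolding hx[symmetric] by (simp add: \<Gamma>.inv_mult_group \<Gamma>.m_assoc)
  then have w2: "weight x b = vert x \<cdot> (inv\<^bsub>\<Gamma>\<^esub> (h y) \<cdot> h a) \<cdot> (h b \<cdot> inv\<^bsub>\<Gamma>\<^esub> (vert (D (a \<otimes> b))))"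
    unfolding weight_def opx by simp
  have w1: "weight \<one> z = h z \<cdot> inv\<^bsub>\<Gamma>\<^esub> (vert (D z))" if "z \<in> carrier M" for z
    using that unfolding weight_def by (simp add: op_one h_one)
  have "\<psi> (\<mu> a b) = weight \<one> y \<cdot> weight x b \<cdot> inv\<^bsub>\<Gamma>\<^esub> weight \<one> (a \<otimes> b)"
    by (simp add: \<mu>_def \<psi>_diff \<psi>_add \<psi>_edge x_def flip: y_def)
  also have "\<dots> = h a \<cdot> h b \<cdot> inv\<^bsub>\<Gamma>\<^esub> h (a \<otimes> b)"
    unfolding w2 w1[OF \<open>y \<in> carrier M\<close>] w1[OF M.m_closed[OF assms]] x_def[symmetric]
    by (simp add: \<Gamma>.inv_mult_group \<Gamma>.m_assoc \<Gamma>.cancel_inv_left del: D_mult)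
  finally show ?thesis .
qed

lemma zero_fiber_closed: "\<alpha> \<in> carrier L \<Longrightarrow> ((\<one>, 0), \<alpha>) \<in> carrier \<Gamma>"
  by (intro \<Gamma>_memI) auto

lemma zero_fiber_mult: "\<lbrakk>\<alpha> \<in> carrier L; \<beta> \<in> carrier L\<rbrakk> \<Longrightarrow>
    ((\<one>, 0), \<alpha>) \<cdot> ((\<one>, 0), \<beta>) = ((\<one>, 0), \<alpha> \<bullet> \<beta>)"
  by (simp add: \<Gamma>_mult)

lemma zero_fiber_inv:
  assumes "\<alpha> \<in> carrier L"
  shows "inv\<^bsub>\<Gamma>\<^esub> ((\<one>, 0), \<alpha>) = ((\<one>, 0), inv\<^bsub>L\<^esub> \<alpha>)"
  using assms zero_fiber_mult[of "inv\<^bsub>L\<^esub> \<alpha>" \<alpha>] zero_fiber_closed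
  by (intro \<Gamma>.inv_equality) (auto simp: \<Gamma>_one)

lemma \<psi>_lam:
  assumes [simp]: "a \<in> carrier M" "b \<in> carrier M"
  shows "\<psi> (lam a b) = ((\<one>, 0), D a \<^bold>\<and> D b)"
proof -
  define c where "c = ((\<one>, 0) :: 'a \<times> ('a set \<Rightarrow>\<^sub>0 int), D a \<^bold>\<and> D b)"
  have [simp]: "c \<in> carrier \<Gamma>"
    unfolding c_def by (intro zero_fiber_closed wd_closed) simp_all
  have comm: "h a \<cdot> h b = (h b \<cdot> h a) \<cdot> c"
    using \<Gamma>_commutator[of "h a" "h b"] by (simp add: c_def pr_h)
  have "\<psi> (lam a b) = h a \<cdot> h b \<cdot> inv\<^bsub>\<Gamma>\<^esub> h (a \<otimes> b) \<cdot> inv\<^bsub>\<Gamma>\<^esub> (h b \<cdot> h a \<cdot> inv\<^bsub>\<Gamma>\<^esub> h (b \<otimes> a))"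
    by (simp add: lam_def \<psi>_diff \<psi>_\<mu>)
  also have "\<dots> = (h b \<cdot> h a) \<cdot> c \<cdot> inv\<^bsub>\<Gamma>\<^esub> (h b \<cdot> h a)"
    unfolding comm M.m_comm[OF assms] by (simp add: \<Gamma>.inv_mult_group \<Gamma>.m_assoc \<Gamma>.cancel_inv_left)
  also have "\<dots> = c"
  proof -
    have "c \<in> Z0"
      unfolding mem_Z0 by (simp add: pr_def c_def) (simp flip: c_def)
    then have "(h b \<cdot> h a) \<cdot> c = c \<cdot> (h b \<cdot> h a)"
      using Z0_central[of c "h b \<cdot> h a"] by simp
    then show ?thesis
      by (simp add: \<Gamma>.m_assoc[of c "h b \<cdot> h a"])
  qed
  finally show ?thesis
    by (simp add: c_def)
qed

section \<open>A cycle with trivial holonomy is a boundary\<close>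

definition lbar where
  "lbar = (SOME l. l \<in> hom L Q \<and> (\<forall>a\<in>carrier M. \<forall>b\<in>carrier M. l (D a \<^bold>\<and> D b) = cls (lam a b)))"

lemma lbar:
  shows lbar_hom: "lbar \<in> hom L Q"
    and lbar_wedge: "\<lbrakk>a \<in> carrier M; b \<in> carrier M\<rbrakk> \<Longrightarrow> lbar (D a \<^bold>\<and> D b) = cls (lam a b)"
proof -
  have "\<exists>l. l \<in> hom L Q \<and> (\<forall>a\<in>carrier M. \<forall>b\<in>carrier M. l (D a \<^bold>\<and> D b) = cls (lam a b))"
    by (rule lambda_bar) blast
  from someI_ex[OF this] show "lbar \<in> hom L Q"
    "\<lbrakk>a \<in> carrier M; b \<in> carrier M\<rbrakk> \<Longrightarrow> lbar (D a \<^bold>\<and> D b) = cls (lam a b)"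
    unfolding lbar_def[symmetric] by blast+
qed

sublocale lbar: group_hom L Q lbar
  using lbar_hom comm_group_Q by (intro group_hom.intro group_hom_axioms.intro L.is_group) (auto simp: comm_group.axioms)

text \<open>
  The chains that are a combination of commutators modulo boundaries, described through their
  holonomy: it lies in \<open>L\<close> and determines the class of the chain.  This makes \<open>Bl_kernel\<close> immediate.
\<close>
definition Bl where
  "Bl = {w. \<exists>\<alpha>\<in>carrier L. \<psi> w = ((\<one>, 0), \<alpha>) \<and> cls w = lbar \<alpha>}"

lemma subgroup_Bl: "subgroup Bl FU"
  unfolding subgroup_free_Abelian_group_iff
proof (intro conjI ballI)
  show "0 \<in> Bl"
    unfolding Bl_def using lbar.hom_one by (auto simp: \<Gamma>_one cls_zero)
  show "u - w \<in> Bl" if uw: "u \<in> Bl" "w \<in> Bl" for u w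
  proof -
    obtain \<alpha> \<beta> where ab: "\<alpha> \<in> carrier L" "\<psi> u = ((\<one>, 0), \<alpha>)" "cls u = lbar \<alpha>"
      "\<beta> \<in> carrier L" "\<psi> w = ((\<one>, 0), \<beta>)" "cls w = lbar \<beta>"
      using uw by (auto simp: Bl_def)
    then have "\<psi> (u - w) = ((\<one>, 0), \<alpha> \<bullet> inv\<^bsub>L\<^esub> \<beta>)" "cls (u - w) = lbar (\<alpha> \<bullet> inv\<^bsub>L\<^esub> \<beta>)"
      by (simp_all add: \<psi>_diff zero_fiber_inv zero_fiber_mult cls_diff)
    then show ?thesis
      unfolding Bl_def using ab by blast
  qed
qed auto

lemma Bl_add: "u \<in> Bl \<Longrightarrow> w \<in> Bl \<Longrightarrow> u + w \<in> Bl"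
  using subgroup.m_closed[OF subgroup_Bl] by simp

lemma Bd_subset_Bl: "u \<in> Bd \<Longrightarrow> u \<in> Bl"
proof -
  assume u: "u \<in> Bd"
  then have "cls u = cls 0"
    by (simp add: cls_eq_iff)
  then show ?thesis
    unfolding Bl_def using u lbar.hom_one by (auto simp: \<psi>_boundaries \<Gamma>_one cls_zero)
qed

lemma lam_in_Bl: "\<lbrakk>a \<in> carrier M; b \<in> carrier M\<rbrakk> \<Longrightarrow> lam a b \<in> Bl"
  unfolding Bl_def by (rule CollectI, rule bexI[of _ "D a \<^bold>\<and> D b"]) (simp_all add: \<psi>_lam lbar_wedge)

lemma Bl_kernel:
  assumes "u \<in> Bl" "\<psi> u = \<one>\<^bsub>\<Gamma>\<^esub>"
  shows "u \<in> Bd"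
proof -
  have "cls u = lbar \<one>\<^bsub>L\<^esub>"
    using assms by (auto simp: Bl_def \<Gamma>_one)
  then show ?thesis
    using lbar.hom_one cls_eq_iff[of u 0] by (simp add: cls_zero)
qed

definition U where "U = FU Mod Bl"
definition cls_lam where "cls_lam u = Bl #>\<^bsub>FU\<^esub> u"

lemmas cls_lam = frag_quotient[OF subgroup_Bl, folded U_def cls_lam_def]
lemmas comm_group_U = cls_lam(1) and cls_lam_closed [simp] = cls_lam(2) and cls_lam_add = cls_lam(3)
  and cls_lam_diff = cls_lam(4) and cls_lam_zero = cls_lam(5) and cls_lam_eq_iff = cls_lam(6)

lemma cls_lam_one: "u \<in> Bl \<Longrightarrow> cls_lam u = \<one>\<^bsub>U\<^esub>"
  using cls_lam_eq_iff[of u 0] by (simp add: cls_lam_zero)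

sublocale U: comm_group U
  by (rule comm_group_U)

text \<open>
  Modulo \<open>Bl\<close> the cocycle \<open>\<mu>\<close> is symmetric, so that it defines an abelian extension of \<open>M\<close>.
\<close>
definition X where "X = cocycle_extension M U (\<lambda>a b. cls_lam (\<mu> a b))"

lemma X_simps:
  "carrier X = carrier M \<times> carrier U"
  "x \<otimes>\<^bsub>X\<^esub> y = (fst x \<otimes> fst y, snd x \<otimes>\<^bsub>U\<^esub> snd y \<otimes>\<^bsub>U\<^esub> cls_lam (\<mu> (fst x) (fst y)))"
  "\<one>\<^bsub>X\<^esub> = (\<one>, \<one>\<^bsub>U\<^esub>)"
  by (simp_all add: X_def)

lemma comm_group_X: "comm_group X"
  unfolding X_def
proof (rule normalized_cocycle.comm_group_cocycle_extension)
  show "normalized_cocycle M U (\<lambda>a b. cls_lam (\<mu> a b))"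
  proof
    show "cls_lam (\<mu> \<one> x) = \<one>\<^bsub>U\<^esub>" if "x \<in> carrier M" for x
      using that by (simp add: cls_lam_one Bd_subset_Bl \<mu>_one_left)
    show "cls_lam (\<mu> x y) \<otimes>\<^bsub>U\<^esub> cls_lam (\<mu> (x \<otimes> y) z) = cls_lam (\<mu> y z) \<otimes>\<^bsub>U\<^esub> cls_lam (\<mu> x (y \<otimes> z))"
      if "x \<in> carrier M" "y \<in> carrier M" "z \<in> carrier M" for x y z
      unfolding cls_lam_add[symmetric] cls_lam_eq_iff using that by (intro Bd_subset_Bl \<mu>_cocycle)
  qed simp
  show "cls_lam (\<mu> x y) = cls_lam (\<mu> y x)" if "x \<in> carrier M" "y \<in> carrier M" for x y
    unfolding cls_lam_eq_iff lam_def[symmetric] using that by (rule lam_in_Bl)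
qed (rule M.comm_group_axioms)

sublocale X: comm_group X
  by (rule comm_group_X)

lemma X_memI: "a \<in> carrier M \<Longrightarrow> u \<in> carrier U \<Longrightarrow> (a, u) \<in> carrier X"
  by (simp add: X_simps)

lemma cls_lam_\<mu>_N: "\<lbrakk>k \<in> N; a \<in> carrier M\<rbrakk> \<Longrightarrow> cls_lam (\<mu> k a) = \<one>\<^bsub>U\<^esub>"
proof -
  assume "k \<in> N" and a: "a \<in> carrier M"
  then obtain z where z: "z \<in> carrier M" "k = D z"
    by (auto simp: N_def)
  have "\<mu> k a - lam z a + lam z a \<in> Bl"
    unfolding z(2) by (intro Bl_add Bd_subset_Bl[OF \<mu>_N] lam_in_Bl z a)
  then show ?thesis
    by (simp add: cls_lam_one)
qed

definition sx where "sx c = (if c \<in> carrier A then sec c else \<one>, \<one>\<^bsub>U\<^esub>)"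
definition jx where "jx = free_lift X sx"
text \<open>
  The homomorphism from \<open>\<Gamma>\<close> with \<open>h y \<mapsto> (y, 0)\<close>.  On \<open>F\<close> it exists because \<open>F\<close> is free and \<open>X\<close> is
  abelian, on \<open>N\<close> because \<open>\<mu>\<close> vanishes there modulo \<open>Bl\<close>.
\<close>
definition J where "J g = (fst (fst g), \<one>\<^bsub>U\<^esub>) \<otimes>\<^bsub>X\<^esub> jx (snd (fst g))"

lemma sx_closed: "sx c \<in> carrier X"
  by (simp add: sx_def X_simps)

lemma jx_closed [simp]: "jx \<phi> \<in> carrier X"
  and jx_add: "jx (\<phi> + \<nu>) = jx \<phi> \<otimes>\<^bsub>X\<^esub> jx \<nu>"
  and jx_zero: "jx 0 = \<one>\<^bsub>X\<^esub>"
  and jx_frag_of: "jx (frag_of c) = sx c"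
  using X.free_lift[of sx, OF sx_closed] by (simp_all add: jx_def)

lemma jx_gen: "c \<in> carrier A \<Longrightarrow> jx (gen c) = (sec c, \<one>\<^bsub>U\<^esub>)"
  by (simp add: gen_def jx_zero jx_frag_of sx_def X_simps)

lemma J_hom: "J \<in> hom \<Gamma> X"
proof (rule homI)
  show "J g \<in> carrier X" if "g \<in> carrier \<Gamma>" for g
    using that unfolding J_def carrier_\<Gamma> by (intro X.m_closed X_memI) auto
  show "J (g \<cdot> g') = J g \<otimes>\<^bsub>X\<^esub> J g'" if gg: "g \<in> carrier \<Gamma>" "g' \<in> carrier \<Gamma>" for g g'
  proof -
    obtain k \<phi> \<alpha> n \<nu> \<beta> where eq: "g = ((k, \<phi>), \<alpha>)" "g' = ((n, \<nu>), \<beta>)"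
      by (metis prod.collapse)
    have kn: "k \<in> N" "n \<in> N"
      using gg by (auto simp: eq carrier_\<Gamma>)
    then have [simp]: "(k, \<one>\<^bsub>U\<^esub>) \<in> carrier X" "(n, \<one>\<^bsub>U\<^esub>) \<in> carrier X"
      by (simp_all add: X_memI)
    have "(k \<otimes> n, \<one>\<^bsub>U\<^esub>) = (k, \<one>\<^bsub>U\<^esub>) \<otimes>\<^bsub>X\<^esub> (n, \<one>\<^bsub>U\<^esub>)"
      using kn by (simp add: X_simps cls_lam_\<mu>_N)
    then show ?thesis
      by (simp add: eq \<Gamma>_mult J_def jx_add X.m_ac)
  qed
qed

sublocale J: group_hom \<Gamma> X J
  by (intro group_hom.intro group_hom_axioms.intro \<Gamma>.is_group X.is_group J_hom)

lemma J_h: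
  assumes "y \<in> carrier M"
  shows "J (h y) = (y, \<one>\<^bsub>U\<^esub>)"
  using assms rem_sec[of y] by (simp add: J_def h_def jx_gen X_simps cls_lam_\<mu>_N)

text \<open>
  Apply \<open>J\<close> to the definition of the weight.  In \<open>X\<close> the pair of \<open>root x\<close> is the product of those of
  \<open>x = D (root x)\<close> and \<open>T (root x)\<close>, and the first cancels.
\<close>
lemma J_weight:
  assumes x: "x \<in> N" and y [simp]: "y \<in> carrier M"
  shows "J (weight x y) \<otimes>\<^bsub>X\<^esub> (root (op x y), \<one>\<^bsub>U\<^esub>) = (T (root x), \<one>\<^bsub>U\<^esub>) \<otimes>\<^bsub>X\<^esub> (y, \<one>\<^bsub>U\<^esub>)"
proof -
  note [simp] = x
  have xy [simp]: "op x y \<in> N"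
    by simp
  have [simp]: "(a, \<one>\<^bsub>U\<^esub>) \<in> carrier X" if "a \<in> carrier M" for a
    using that by (simp add: X_memI)
  have r: "(root x, \<one>\<^bsub>U\<^esub>) = (x, \<one>\<^bsub>U\<^esub>) \<otimes>\<^bsub>X\<^esub> (T (root x), \<one>\<^bsub>U\<^esub>)"
    using D_T[of "root x"] by (simp add: X_simps cls_lam_\<mu>_N)
  have W: "weight x y \<cdot> vert (op x y) = vert x \<cdot> inv\<^bsub>\<Gamma>\<^esub> (h x) \<cdot> h y"
    by (simp add: weight_def \<Gamma>.m_assoc)
  have "J (weight x y) \<otimes>\<^bsub>X\<^esub> J (vert (op x y)) = J (vert x) \<otimes>\<^bsub>X\<^esub> inv\<^bsub>X\<^esub> J (h x) \<otimes>\<^bsub>X\<^esub> J (h y)"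
    using arg_cong[OF W, of J] weight_in_Z0[of x y] Z0_closed by simp
  then have "J (weight x y) \<otimes>\<^bsub>X\<^esub> (root (op x y), \<one>\<^bsub>U\<^esub>) = (root x, \<one>\<^bsub>U\<^esub>) \<otimes>\<^bsub>X\<^esub> inv\<^bsub>X\<^esub> (x, \<one>\<^bsub>U\<^esub>) \<otimes>\<^bsub>X\<^esub> (y, \<one>\<^bsub>U\<^esub>)"
    by (simp add: J_h vert_def)
  also have "\<dots> = (T (root x), \<one>\<^bsub>U\<^esub>) \<otimes>\<^bsub>X\<^esub> (y, \<one>\<^bsub>U\<^esub>)"
    unfolding r by (simp add: X.m_comm[of "(x, \<one>\<^bsub>U\<^esub>)"] X.m_assoc)
  finally show ?thesis .
qed

definition XR where "XR = {x \<in> carrier X. D (fst x) = \<one>}"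
text \<open>
  For \<open>r\<close> with \<open>D r = 0\<close> the edge \<open>(0, r)\<close> is a loop, and \<open>\<mu> r s\<close> is the coboundary of \<open>r \<mapsto> (0, r)\<close>
  there.  So this is a homomorphism on the part of \<open>X\<close> over the kernel of \<open>D\<close>.
\<close>
definition \<zeta> where "\<zeta> x = snd x \<otimes>\<^bsub>U\<^esub> cls_lam (e \<one> (fst x))"

lemma \<mu>_fixed: "\<lbrakk>r \<in> carrier M; D r = \<one>\<rbrakk> \<Longrightarrow> \<mu> r b = e \<one> r + e \<one> b - e \<one> (r \<otimes> b)"
  by (simp add: \<mu>_def ti_fix)

lemma subgroup_XR: "subgroup XR X"
proof -
  have "group_hom X M (\<lambda>x. D (fst x))"
    by (intro group_hom.intro group_hom_axioms.intro X.is_group M.is_group homI) (auto simp: X_simps)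
  then show ?thesis
    using group_hom.subgroup_kernel[of X M "\<lambda>x. D (fst x)"] by (simp add: XR_def kernel_def)
qed

lemma \<zeta>_hom: "\<zeta> \<in> hom (X\<lparr>carrier := XR\<rparr>) U"
proof (rule homI)
  show "\<zeta> x \<in> carrier U" if "x \<in> carrier (X\<lparr>carrier := XR\<rparr>)" for x
    using that by (auto simp: XR_def X_simps \<zeta>_def)
  show "\<zeta> (x \<otimes>\<^bsub>X\<lparr>carrier := XR\<rparr>\<^esub> y) = \<zeta> x \<otimes>\<^bsub>U\<^esub> \<zeta> y"
    if xy: "x \<in> carrier (X\<lparr>carrier := XR\<rparr>)" "y \<in> carrier (X\<lparr>carrier := XR\<rparr>)" for x y
  proof -
    obtain r u s t where eq: "x = (r, u)" "y = (s, t)"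
      by (metis prod.collapse)
    have [simp]: "r \<in> carrier M" "D r = \<one>" "u \<in> carrier U" "s \<in> carrier M" "t \<in> carrier U"
      using xy by (auto simp: eq XR_def X_simps)
    have *: "cls_lam (\<mu> r s) \<otimes>\<^bsub>U\<^esub> cls_lam (e \<one> (r \<otimes> s)) = cls_lam (e \<one> r) \<otimes>\<^bsub>U\<^esub> cls_lam (e \<one> s)"
      unfolding cls_lam_add[symmetric] by (simp add: \<mu>_fixed)
    have "\<zeta> (x \<otimes>\<^bsub>X\<^esub> y) = u \<otimes>\<^bsub>U\<^esub> t \<otimes>\<^bsub>U\<^esub> (cls_lam (\<mu> r s) \<otimes>\<^bsub>U\<^esub> cls_lam (e \<one> (r \<otimes> s)))"
      by (simp add: \<zeta>_def eq X_simps U.m_assoc)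
    also have "\<dots> = \<zeta> x \<otimes>\<^bsub>U\<^esub> \<zeta> y"
      unfolding * by (simp add: \<zeta>_def eq U.m_ac)
    finally show ?thesis
      by simp
  qed
qed

text \<open>
  The edges from 0 to all vertices of the component; with them an edge is closed up to a loop.
\<close>
definition tree where "tree = frag_extend (\<lambda>xs. e \<one> (root (hd xs)))"

text \<open>
  Along \<open>\<zeta>\<close> and \<open>J\<close> the weight of an edge becomes the class of the edge, closed up to a loop by
  \<open>tree\<close>.
\<close>
lemma \<zeta>_J_weight:
  assumes x: "x \<in> N" and y [simp]: "y \<in> carrier M"
  shows "J (weight x y) \<in> XR"
    and "\<zeta> (J (weight x y)) = cls_lam (e \<one> (root x) + e x y - e \<one> (root (op x y)))"
proof -
  note [simp] = x
  have xy [simp]: "op x y \<in> N"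
    by simp
  have Jc: "J (weight x y) \<in> carrier X"
    using weight_in_Z0[OF x y] Z0_closed J.hom_closed by blast
  obtain r u where ru: "J (weight x y) = (r, u)" and [simp]: "r \<in> carrier M" "u \<in> carrier U"
    using Jc by (cases "J (weight x y)") (auto simp: X_simps)
  define s where "s = root (op x y)"
  have [simp]: "s \<in> carrier M"
    by (simp add: s_def)
  have rs: "r \<otimes> s = T (root x) \<otimes> y" and us: "u \<otimes>\<^bsub>U\<^esub> cls_lam (\<mu> r s) = cls_lam (\<mu> (T (root x)) y)"
    using J_weight[OF x y] by (simp_all add: ru X_simps s_def)
  have "D r \<otimes> op x y = op x y"
    using arg_cong[OF rs, of D] by (simp add: s_def op_eq flip: T_D)
  then have Dr: "D r = \<one>"
    by (simp add: M.r_cancel_one)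
  then show "J (weight x y) \<in> XR"
    using Jc by (simp add: XR_def ru)
  have "\<zeta> (J (weight x y)) = u \<otimes>\<^bsub>U\<^esub> cls_lam (\<mu> r s) \<otimes>\<^bsub>U\<^esub> inv\<^bsub>U\<^esub> cls_lam (\<mu> r s) \<otimes>\<^bsub>U\<^esub> cls_lam (e \<one> r)"
    by (simp add: \<zeta>_def ru U.m_assoc)
  also have "\<dots> = cls_lam (\<mu> (T (root x)) y - \<mu> r s + e \<one> r)"
    unfolding us by (simp add: cls_lam_add cls_lam_diff)
  also have "\<mu> (T (root x)) y - \<mu> r s + e \<one> r = e \<one> (root x) + e x y - e \<one> s"
    by (simp add: \<mu>_T \<mu>_fixed Dr rs)
  finally show "\<zeta> (J (weight x y)) = cls_lam (e \<one> (root x) + e x y - e \<one> (root (op x y)))"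
    by (simp add: s_def)
qed

lemma \<zeta>_J_\<psi>:
  assumes "keys w \<subseteq> K0"
  shows "J (\<psi> w) \<in> XR \<and> \<zeta> (J (\<psi> w)) = cls_lam (w + tree (rack_boundary op w))"
  using assms
proof (induction w rule: frag_induction)
  case zero
  have "\<zeta> \<one>\<^bsub>X\<^esub> = \<one>\<^bsub>U\<^esub>"
    using cls_lam_one[OF Bd_subset_Bl[OF Bd_self[OF M.one_closed]]] by (simp add: \<zeta>_def X_simps)
  then show ?case
    using subgroup.one_closed[OF subgroup_XR] by (simp add: tree_def cls_lam_zero)
next
  case (one xs)
  then obtain x y where xs: "xs = [x, y]" and x: "x \<in> N" and y: "y \<in> carrier M"
    by (auto simp: K0_def)
  show ?case
    using \<zeta>_J_weight[OF x y] unfolding xs \<psi>_edge[OF x y]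
    by (simp add: rack_boundary_2 tree_def frag_extend_diff algebra_simps)
next
  case (diff a b)
  interpret Z: group_hom "X\<lparr>carrier := XR\<rparr>" U \<zeta>
    by (intro group_hom.intro group_hom_axioms.intro X.subgroup_imp_group subgroup_XR U.is_group \<zeta>_hom)
  have J: "J (\<psi> (a - b)) = J (\<psi> a) \<otimes>\<^bsub>X\<^esub> inv\<^bsub>X\<^esub> J (\<psi> b)"
    using Z0_closed[OF \<psi>_in_Z0] by (simp add: \<psi>_diff)
  have mem: "inv\<^bsub>X\<^esub> J (\<psi> b) \<in> XR"
    using diff subgroup.m_inv_closed[OF subgroup_XR] by blast
  have "\<zeta> (inv\<^bsub>X\<^esub> J (\<psi> b)) = inv\<^bsub>U\<^esub> \<zeta> (J (\<psi> b))"
    using Z.hom_inv[of "J (\<psi> b)"] diff X.m_inv_consistent[OF subgroup_XR, of "J (\<psi> b)"] by simp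
  then have "\<zeta> (J (\<psi> (a - b))) = \<zeta> (J (\<psi> a)) \<otimes>\<^bsub>U\<^esub> inv\<^bsub>U\<^esub> \<zeta> (J (\<psi> b))"
    unfolding J using Z.hom_mult[of "J (\<psi> a)" "inv\<^bsub>X\<^esub> J (\<psi> b)"] diff mem by simp
  also have "\<dots> = cls_lam ((a + tree (rack_boundary op a)) - (b + tree (rack_boundary op b)))"
    using diff by (simp add: cls_lam_diff)
  also have "(a + tree (rack_boundary op a)) - (b + tree (rack_boundary op b)) = a - b + tree (rack_boundary op (a - b))"
    by (simp add: tree_def rack_boundary_diff frag_extend_diff)
  finally show ?case
    unfolding J using diff mem subgroup.m_closed[OF subgroup_XR] by simp
qed

text \<open>
  For a cycle the correction by \<open>tree\<close> disappears, so trivial holonomy puts it into \<open>Bl\<close>, and there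
  the holonomy determines the class.
\<close>
theorem \<psi>_injective:
  assumes "keys w \<subseteq> K0" "rack_boundary op w = 0" "\<psi> w = \<one>\<^bsub>\<Gamma>\<^esub>"
  shows "w \<in> Bd"
proof -
  have "cls_lam w = \<zeta> (J (\<psi> w))"
    using \<zeta>_J_\<psi>[OF assms(1)] assms(2) by (simp add: tree_def)
  also have "\<dots> = \<zeta> (J (\<psi> 0))"
    using assms(3) by simp
  also have "\<dots> = cls_lam 0"
    using \<zeta>_J_\<psi>[of 0] by (simp add: tree_def)
  finally have "w \<in> Bl"
    by (simp add: cls_lam_eq_iff)
  then show ?thesis
    using Bl_kernel assms(3) by blast
qed

section \<open>The group of holonomies\<close>

text \<open>
  The image of \<open>Z0\<close> in \<open>F\<close>: as \<open>pr ((k, \<phi>), \<alpha>) = D k + \<delta> \<phi>\<close>, the component \<open>\<phi>\<close> of an element of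
  \<open>Z0\<close> has \<open>\<delta> \<phi>\<close> in \<open>D N\<close>.
\<close>
definition F' where "F' = {\<phi>. keys \<phi> \<subseteq> S \<and> \<delta> \<phi> \<in> D ` N}"

lemma \<delta>_minus: "\<delta> (- \<phi>) = inv (\<delta> \<phi>)"
  and \<delta>_diff: "\<delta> (\<phi> - \<nu>) = \<delta> \<phi> \<otimes> inv (\<delta> \<nu>)"
  using comm_group.free_lift(5,6)[OF comm_group_NM, of \<delta>0, OF \<delta>0_closed] by (simp_all flip: \<delta>_def)

lemma subgroup_F': "subgroup F' (free_Abelian_group S)"
  unfolding subgroup_free_Abelian_group_iff
proof (intro conjI ballI)
  show "0 \<in> F'"
    using image_eqI[of \<one> D \<one> N] by (simp add: F'_def)
  show "u - w \<in> F'" if uw: "u \<in> F'" "w \<in> F'" for u w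
  proof -
    obtain x y where "x \<in> N" "y \<in> N" "\<delta> u = D x" "\<delta> w = D y"
      using uw by (auto simp: F'_def)
    then have "\<delta> (u - w) = D (x \<otimes> inv y)" "x \<otimes> inv y \<in> N"
      by (simp_all add: \<delta>_diff)
    then show ?thesis
      using uw keys_diff[of u w] by (auto simp: F'_def)
  qed
qed (auto simp: F'_def)

lemma \<delta>_cmul: "\<delta> (frag_cmul (int n) \<phi>) = \<delta> \<phi> [^] n"
  by (induction n) (simp_all add: frag_cmul_distrib \<delta>_add M.m_comm)

lemma D_pow: "x \<in> carrier M \<Longrightarrow> D (x [^] (n::nat)) = D x [^] n"
  by (induction n) simp_all

lemma cl_one_iff: "x \<in> carrier M \<Longrightarrow> cl x = N \<longleftrightarrow> x \<in> N"
  using cl_eq_iff[of x \<one>] cl_N[of \<one>] by simp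

text \<open>
  If a combination of classes is zero in \<open>A\<close>, then \<open>\<delta>\<close> maps it into \<open>D N\<close>.  This applies to
  \<open>2 c - (c + c)\<close>, whose support contains \<open>c\<close> since \<open>c \<noteq> c + c\<close>, and to \<open>c\<close> times the order of \<open>A\<close>
  if that is finite.
\<close>
lemma F'_same_rank: "free_Abelian_group S \<cong> (free_Abelian_group S)\<lparr>carrier := F'\<rparr>"
proof (rule subgroup_of_free_Abelian_group_same_rank[OF subgroup_F'])
  interpret A: comm_group A
    by (rule comm_group_A)
  interpret cl: group_hom M A cl
    using cl_hom by unfold_locales
  show "\<exists>n. n \<noteq> 0 \<and> frag_cmul n (frag_of c) \<in> F'" if "finite S" "c \<in> S" for c
  proof (intro exI conjI)
    let ?n = "order A"
    have fin: "finite (carrier A)"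
      using that(1) by simp
    then show "int ?n \<noteq> 0"
      using A.order_gt_0_iff_finite by simp
    have c: "c \<in> carrier A" and cN: "c \<noteq> N"
      using that(2) by auto
    have "cl (sec c [^] ?n) = c [^]\<^bsub>A\<^esub> ?n"
      using c by (simp add: cl.hom_nat_pow)
    also have "\<dots> = N"
      using A.pow_order_eq_1[OF c] by (simp add: one_A)
    finally have "sec c [^] ?n \<in> N"
      using c cl_one_iff by simp
    moreover have "\<delta> (frag_cmul (int ?n) (frag_of c)) = D (sec c [^] ?n)"
      using c by (simp add: \<delta>_cmul \<delta>_frag_of \<delta>0_def D_pow)
    ultimately show "frag_cmul (int ?n) (frag_of c) \<in> F'"
      using that(2) keys_cmul[of "int ?n" "frag_of c"] by (auto simp: F'_def)
  qed
  show "\<exists>v\<in>F'. c \<in> keys v" if "c \<in> S" for c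
  proof
    have c: "c \<in> carrier A" "c \<noteq> N"
      using that by auto
    \<comment> \<open>In additive notation \<open>2 c - (c + c)\<close>, where the sum in brackets is formed in \<open>A\<close>.\<close>
    let ?d = "c \<otimes>\<^bsub>A\<^esub> c" and ?v = "frag_of c + frag_of c - gen (c \<otimes>\<^bsub>A\<^esub> c)"
    have d: "?d \<in> carrier A" "?d \<noteq> c"
      using c A.l_cancel_one'[of c c] by (auto simp: one_A)
    have "cl (sec c \<otimes> sec c) = cl (sec ?d)"
      using c d by simp
    then have "sec c \<otimes> sec c \<otimes> inv (sec ?d) \<in> N"
      using c d cl_eq_iff[of "sec c \<otimes> sec c" "sec ?d"] by simp
    moreover have "\<delta> ?v = D (sec c \<otimes> sec c \<otimes> inv (sec ?d))"
      using c d by (simp add: \<delta>_diff \<delta>_add \<delta>_frag_of \<delta>0_def)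
    moreover have "keys ?v \<subseteq> S"
      using that keys_gen[OF d(1)] keys_diff[of "frag_of c + frag_of c" "gen ?d"] keys_add[of "frag_of c" "frag_of c"]
      by (auto simp: keys_frag_of)
    ultimately show "?v \<in> F'"
      by (auto simp: F'_def)
    show "c \<in> keys ?v"
      using d(2) by (simp add: in_keys_iff lookup_minus lookup_add gen_def)
  qed
qed

text \<open>
  On the kernel of \<open>Z0 \<rightarrow> F'\<close> the factor set vanishes: it consists of the triples \<open>(k, 0, \<alpha>)\<close> with
  \<open>D k = 0\<close>.
\<close>
lemma Z0_iso:
  "ZG \<cong> L \<times>\<times> invariants NM T \<times>\<times> sum_group S (\<lambda>_. integer_group)"
proof -
  let ?F = "(free_Abelian_group S)\<lparr>carrier := F'\<rparr>" and ?p = "\<lambda>g. snd (fst g)"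
  let ?K = "ZG\<lparr>carrier := kernel ZG ?F ?p\<rparr>"
  interpret ZG: comm_group ZG
    by (rule comm_group_ZG)
  have gF: "group ?F"
    by (rule group.subgroup_imp_group[OF group_free_Abelian_group subgroup_F'])
  have Z0: "g \<in> Z0 \<longleftrightarrow> (\<exists>k \<phi> \<alpha>. g = ((k, \<phi>), \<alpha>) \<and> k \<in> N \<and> keys \<phi> \<subseteq> S \<and> \<alpha> \<in> carrier L \<and> D k \<otimes> \<delta> \<phi> = \<one>)" for g
    by (auto simp: mem_Z0 carrier_\<Gamma> pr_def)
  have \<delta>_inv: "\<delta> \<phi> \<in> D ` N" if "k \<in> N" "D k \<otimes> \<delta> \<phi> = \<one>" for k \<phi>
  proof -
    have "\<delta> \<phi> \<otimes> D k = \<one>"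
      using that M.m_comm[of "D k" "\<delta> \<phi>"] by simp
    then have "inv (D k) = \<delta> \<phi>"
      using that by (intro M.inv_equality) simp_all
    then have "\<delta> \<phi> = D (inv k)"
      using that by simp
    then show ?thesis
      by (rule image_eqI) (use that in simp)
  qed
  have p: "?p \<in> hom ZG ?F"
  proof (rule homI)
    show "?p g \<in> carrier ?F" if "g \<in> carrier ZG" for g
      using that \<delta>_inv by (auto simp: Z0 F'_def)
  qed (simp add: \<Gamma>_simps)
  have surj: "?p ` carrier ZG = carrier ?F"
  proof
    show "carrier ?F \<subseteq> ?p ` carrier ZG"
    proof
      fix \<phi> assume "\<phi> \<in> carrier ?F"
      then obtain n where n: "n \<in> N" "\<delta> \<phi> = D n" "keys \<phi> \<subseteq> S"
        by (auto simp: F'_def)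
      then have "((inv n, \<phi>), \<one>\<^bsub>L\<^esub>) \<in> Z0"
        by (auto simp: Z0)
      then show "\<phi> \<in> ?p ` carrier ZG"
        by force
    qed
  qed (use p in \<open>auto simp: hom_def\<close>)
  have inv: "carrier (invariants NM T) = {k \<in> N. D k = \<one>}"
    by (auto simp: invariants_def kernel_def one_minus_def)
  have inv_mult: "k \<otimes>\<^bsub>invariants NM T\<^esub> n = k \<otimes> n" for k n
    by (simp add: invariants_def)
  have "group (invariants NM T)"
    unfolding invariants_def by (rule group.subgroup_imp_group[OF NE.N.is_group NE.one_minus.subgroup_kernel])
  have gK: "group ?K"
    by (rule ZG.subgroup_imp_group, rule group_hom.subgroup_kernel)
      (intro group_hom.intro group_hom_axioms.intro ZG.is_group gF p)
  have K: "carrier ?K = {((k, 0), \<alpha>) | k \<alpha>. k \<in> N \<and> D k = \<one> \<and> \<alpha> \<in> carrier L}"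
    by (auto simp: kernel_def Z0)
  have "(\<lambda>g. (snd g, fst (fst g))) \<in> iso ?K (L \<times>\<times> invariants NM T)"
  proof (rule isoI)
    show "(\<lambda>g. (snd g, fst (fst g))) \<in> hom ?K (L \<times>\<times> invariants NM T)"
    proof (rule homI)
      show "(snd (g \<otimes>\<^bsub>?K\<^esub> g'), fst (fst (g \<otimes>\<^bsub>?K\<^esub> g'))) =
          (snd g, fst (fst g)) \<otimes>\<^bsub>L \<times>\<times> invariants NM T\<^esub> (snd g', fst (fst g'))"
        if "g \<in> carrier ?K" "g' \<in> carrier ?K" for g g'
        using that unfolding K by (auto simp: \<Gamma>_mult DirProd_def inv_mult)
      show "(snd g, fst (fst g)) \<in> carrier (L \<times>\<times> invariants NM T)" if "g \<in> carrier ?K" for g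
        using that unfolding K by (auto simp: inv DirProd_def)
    qed
    show "bij_betw (\<lambda>g. (snd g, fst (fst g))) (carrier ?K) (carrier (L \<times>\<times> invariants NM T))"
      unfolding K by (rule bij_betw_byWitness[where f' = "\<lambda>(\<alpha>, k). ((k, 0), \<alpha>)"]) (auto simp: inv DirProd_def)
  qed
  then have 1: "?K \<cong> L \<times>\<times> invariants NM T"
    by (auto simp: is_iso_def)
  have "free_Abelian_group S \<cong> ?F"
    by (rule F'_same_rank)
  then have "?F \<cong> free_Abelian_group S"
    by (rule group.iso_sym[OF group_free_Abelian_group])
  also have "\<dots> \<cong> sum_group S (\<lambda>_. integer_group)"
    by (rule group.iso_sym[OF _ isomorphic_sum_integer_group]) simp
  finally have 2: "?F \<cong> sum_group S (\<lambda>_. integer_group)" .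
  have "ZG \<cong> ?K \<times>\<times> ?F"
    using split_iso_free[OF comm_group_ZG p surj gF F'_same_rank] by simp
  also have "\<dots> \<cong> (L \<times>\<times> invariants NM T) \<times>\<times> sum_group S (\<lambda>_. integer_group)"
    by (rule group.DirProd_iso_trans[OF gK 1 2])
  also have "\<dots> \<cong> L \<times>\<times> invariants NM T \<times>\<times> sum_group S (\<lambda>_. integer_group)"
    by (rule DirProd_assoc_iso)
  finally show ?thesis .
qed

section \<open>Reduction to one component\<close>

text \<open>
  Restriction to the tuples that start in \<open>C\<close>, followed by the translation by \<open>t\<close>.
\<close>
definition move :: "'a set \<Rightarrow> 'a \<Rightarrow> ('a list \<Rightarrow>\<^sub>0 int) \<Rightarrow> ('a list \<Rightarrow>\<^sub>0 int)" where
  "move C t = frag_extend (\<lambda>xs. if hd xs \<in> C then frag_of (map (\<lambda>x. x \<otimes> t) xs) else 0)"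

lemma move_add: "move C t (u + w) = move C t u + move C t w"
  and move_diff: "move C t (u - w) = move C t u - move C t w"
  and move_zero [simp]: "move C t 0 = 0"
  and move_frag_of: "move C t (frag_of xs) = (if hd xs \<in> C then frag_of (map (\<lambda>x. x \<otimes> t) xs) else 0)"
  by (simp_all add: move_def frag_extend_add frag_extend_diff)

lemma move_sum: "finite I \<Longrightarrow> move C t (\<Sum>i\<in>I. f i) = (\<Sum>i\<in>I. move C t (f i))"
  by (induction I rule: finite_induct) (simp_all add: move_add)

lemma op_translate:
  assumes [simp]: "x \<in> carrier M" "y \<in> carrier M" "t \<in> carrier M"
  shows "op (x \<otimes> t) (y \<otimes> t) = op x y \<otimes> t"
  by (simp add: op_eq one_minus_def M.group_normalize)

definition op_stable where "op_stable C \<longleftrightarrow> (\<forall>x\<in>carrier M. \<forall>y\<in>carrier M. op x y \<in> C \<longleftrightarrow> x \<in> C)"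

lemma boundary_move:
  assumes t: "t \<in> carrier M" and C: "op_stable C" and v: "keys v \<subseteq> tuples (carrier M) 2"
  shows "rack_boundary op (move C t v) = move C t (rack_boundary op v)"
  using v
proof (induction v rule: frag_induction)
  case (one xs)
  then obtain x y where "xs = [x, y]" "x \<in> carrier M" "y \<in> carrier M"
    by (auto simp: tuples_2)
  then show ?case
    using C t by (simp add: move_frag_of move_diff rack_boundary_2 op_stable_def op_translate)
qed (simp_all add: move_diff rack_boundary_diff)

lemma move_Bd:
  assumes t [simp]: "t \<in> carrier M" and C: "op_stable C" and u: "u \<in> Bd"
  shows "move C t u \<in> Bd"
proof -
  obtain d s where ds: "u = d + rack_boundary op s" "d \<in> degenerate (carrier M) 2" "keys s \<subseteq> tuples (carrier M) 3"
    using u by (auto simp: boundaries_def)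
  have "move C t d \<in> Bd"
    using ds(2)
  proof (induction rule: degenerate_induct)
    case (gen xs i)
    then obtain x where "xs = [x, x]" "x \<in> carrier M"
      by (auto simp: tuples_2)
    then show ?case
      using Bd_self[of "x \<otimes> t"] by (simp add: move_frag_of)
  qed (simp_all add: move_diff Bd_diff)
  moreover have "move C t (rack_boundary op s) \<in> Bd"
    using ds(3)
  proof (induction s rule: frag_induction)
    case (one xs)
    then obtain x y z where xs: "xs = [x, y, z]" and [simp]: "x \<in> carrier M" "y \<in> carrier M" "z \<in> carrier M"
      by (auto simp: tuples_3)
    show ?case
      using Bd_cell[of "x \<otimes> t" "y \<otimes> t" "z \<otimes> t"] C
      unfolding xs rack_boundary_3 by (simp add: move_diff move_frag_of op_stable_def op_translate)
  qed (simp_all add: rack_boundary_diff move_diff Bd_diff)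
  ultimately show ?thesis
    by (simp add: ds(1) move_add Bd_add)
qed

lemma cl_op: "\<lbrakk>x \<in> carrier M; y \<in> carrier M\<rbrakk> \<Longrightarrow> cl (op x y) = cl x"
proof -
  assume [simp]: "x \<in> carrier M" "y \<in> carrier M"
  have "op x y \<otimes> inv x = D y \<otimes> inv (D x)"
    by (simp add: op_eq one_minus_def M.group_normalize)
  also have "\<dots> \<in> N"
    by simp
  finally show ?thesis
    by (simp add: cl_eq_iff)
qed

definition component where "component c = {x. cl x = c}"

lemma op_stable_component: "op_stable (component c)" and op_stable_UNIV: "op_stable UNIV"
  by (simp_all add: op_stable_def component_def cl_op)

definition to_base where "to_base c = move (component c) (inv (sec c))"
definition from_base where "from_base c = move UNIV (sec c)"

lemma keys_move:
  "keys (move C t v) \<subseteq> {map (\<lambda>x. x \<otimes> t) xs | xs. xs \<in> keys v \<and> hd xs \<in> C}"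
  unfolding move_def by (rule order_trans[OF keys_frag_extend]) (auto simp: keys_frag_of split: if_splits)

lemma keys_to_base:
  assumes "keys v \<subseteq> tuples (carrier M) 2" and c: "c \<in> carrier A"
  shows "keys (to_base c v) \<subseteq> K0"
proof
  fix zs assume "zs \<in> keys (to_base c v)"
  then obtain x y where zs: "zs = [x \<otimes> inv (sec c), y \<otimes> inv (sec c)]" "x \<in> carrier M" "y \<in> carrier M" "cl x = c"
    using keys_move[of "component c" "inv (sec c)" v] assms(1) by (fastforce simp: to_base_def tuples_2 component_def)
  then show "zs \<in> K0"
    using rem_in_N[of x] c by (auto simp: K0_def rem_def)
qed

lemma K0_tuples: "K0 \<subseteq> tuples (carrier M) 2"
  by (auto simp: K0_def tuples_2)

lemma keys_from_base:
  assumes "keys v \<subseteq> K0" and c: "c \<in> carrier A"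
  shows "keys (from_base c v) \<subseteq> tuples (carrier M) 2"
proof
  fix zs assume "zs \<in> keys (from_base c v)"
  then obtain x y where "zs = [x \<otimes> sec c, y \<otimes> sec c]" "x \<in> carrier M" "y \<in> carrier M"
    using keys_move[of UNIV "sec c" v] assms(1) by (fastforce simp: from_base_def K0_def)
  then show "zs \<in> tuples (carrier M) 2"
    using c by (simp add: tuples_2)
qed

lemma from_to_base:
  assumes "c \<in> carrier A" "keys v \<subseteq> tuples (carrier M) 2"
  shows "from_base c (to_base c v) = move (component c) \<one> v"
  using assms(2)
proof (induction v rule: frag_induction)
  case (one xs)
  then show ?case
    using assms(1) by (auto simp: tuples_2 from_base_def to_base_def move_frag_of M.m_assoc)
qed (simp_all add: from_base_def to_base_def move_diff)

lemma to_from_base: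
  assumes "c \<in> carrier A" "c' \<in> carrier A" "keys v \<subseteq> K0"
  shows "to_base c' (from_base c v) = (if c' = c then v else 0)"
  using assms(3)
proof (induction v rule: frag_induction)
  case (one xs)
  then obtain x y where xs: "xs = [x, y]" "x \<in> N" "y \<in> carrier M"
    by (auto simp: K0_def)
  have "cl (x \<otimes> sec c) = cl (sec c)"
    using xs assms by (intro cl_eq_iff[THEN iffD2]) (simp_all add: M.m_assoc)
  then show ?case
    using xs assms(1,2) by (auto simp: from_base_def to_base_def move_frag_of component_def M.m_assoc)
qed (simp_all add: from_base_def to_base_def move_diff)

lemma component_decomposition:
  assumes "finite I" "keys v \<subseteq> {xs \<in> tuples (carrier M) 2. cl (hd xs) \<in> I}"
  shows "v = (\<Sum>c\<in>I. move (component c) \<one> v)"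
  using assms(2)
proof (induction v rule: frag_induction)
  case (one xs)
  then have "map (\<lambda>x. x \<otimes> \<one>) xs = xs"
    by (auto simp: tuples_2)
  then show ?case
    using one assms(1) by (simp add: move_frag_of component_def)
next
  case (diff a b)
  have "a - b = (\<Sum>c\<in>I. move (component c) \<one> a) - (\<Sum>c\<in>I. move (component c) \<one> b)"
    by (rule arg_cong2[OF diff])
  also have "\<dots> = (\<Sum>c\<in>I. move (component c) \<one> (a - b))"
    by (simp add: move_diff sum_subtractf)
  finally show ?case .
qed simp

text \<open>
  The holonomy of each component, after translation to the component of 0.
\<close>
definition \<Psi> where "\<Psi> v = (\<lambda>c\<in>carrier A. \<psi> (to_base c v))"

abbreviation SG where "SG \<equiv> sum_group (carrier A) (\<lambda>_. ZG)"

lemma group_ZG: "group ZG"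
  using comm_group_ZG by (rule comm_group.axioms)

lemma to_base_support:
  "c \<notin> (\<lambda>xs. cl (hd xs)) ` keys v \<Longrightarrow> to_base c v = 0"
  unfolding to_base_def move_def by (rule frag_extend_eq_0) (auto simp: component_def)

lemma \<Psi>_closed: "\<Psi> v \<in> carrier SG"
proof -
  have "{c \<in> carrier A. \<Psi> v c \<noteq> \<one>\<^bsub>\<Gamma>\<^esub>} \<subseteq> (\<lambda>xs. cl (hd xs)) ` keys v"
  proof
    fix c assume "c \<in> {c \<in> carrier A. \<Psi> v c \<noteq> \<one>\<^bsub>\<Gamma>\<^esub>}"
    then have "to_base c v \<noteq> 0"
      by (auto simp: \<Psi>_def)
    then show "c \<in> (\<lambda>xs. cl (hd xs)) ` keys v"
      using to_base_support by blast
  qed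
  then have "finite {c \<in> carrier A. \<Psi> v c \<noteq> \<one>\<^bsub>\<Gamma>\<^esub>}"
    by (rule finite_subset) simp
  then show ?thesis
    by (simp add: carrier_sum_group group_ZG) (simp add: \<Psi>_def \<psi>_in_Z0)
qed

lemma Bd_sum: "finite I \<Longrightarrow> (\<And>i. i \<in> I \<Longrightarrow> f i \<in> Bd) \<Longrightarrow> (\<Sum>i\<in>I. f i) \<in> Bd"
  by (induction I rule: finite_induct) (simp_all add: Bd_add)

theorem homology_iso_SG: "quandle_homology (carrier M) op 2 \<cong> SG"
proof (rule quandle_homology_2_iso)
  show "group SG"
    by (simp add: group_ZG)
  show "\<Psi> \<in> hom ((rack_chain (carrier M) 2)\<lparr>carrier := cycles (carrier M) op\<rparr>) SG"
  proof (rule homI)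
    show "\<Psi> u \<in> carrier SG" for u
      by (rule \<Psi>_closed)
  qed (auto simp: rack_chain_def \<Psi>_def to_base_def move_add \<psi>_add)
  have bnd: "rack_boundary op (to_base c v) = 0" if "v \<in> cycles (carrier M) op" "c \<in> carrier A" for v c
    using that boundary_move[OF _ op_stable_component, of "inv (sec c)" v c] by (simp add: to_base_def cycles_def)
  show "\<Psi> v = \<one>\<^bsub>SG\<^esub> \<longleftrightarrow> v \<in> Bd" if v: "v \<in> cycles (carrier M) op" for v
  proof
    assume "\<Psi> v = \<one>\<^bsub>SG\<^esub>"
    then have "\<psi> (to_base c v) = \<one>\<^bsub>\<Gamma>\<^esub>" if "c \<in> carrier A" for c
      using that by (auto simp: \<Psi>_def fun_eq_iff split: if_splits)
    then have base: "to_base c v \<in> Bd" if "c \<in> carrier A" for c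
      using that v bnd keys_to_base[of v c] by (intro \<psi>_injective) (auto simp: cycles_def)
    \<comment> \<open>The finitely many components that \<open>v\<close> meets.\<close>
    define I where "I = (\<lambda>xs. cl (hd xs)) ` keys v"
    have keys: "keys v \<subseteq> tuples (carrier M) 2"
      using v by (simp add: cycles_def)
    have I: "finite I" "I \<subseteq> carrier A"
      using keys by (auto simp: I_def tuples_2)
    have part: "move (component c) \<one> v \<in> Bd" if "c \<in> I" for c
      using move_Bd[OF _ op_stable_UNIV base, of "sec c" c] that I keys
      by (simp add: subset_iff flip: from_to_base from_base_def)
    have dec: "v = (\<Sum>c\<in>I. move (component c) \<one> v)"
      by (rule component_decomposition[OF I(1)]) (use keys in \<open>auto simp: I_def\<close>)
    have "(\<Sum>c\<in>I. move (component c) \<one> v) \<in> Bd"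
      by (rule Bd_sum[OF I(1)]) (rule part)
    then show "v \<in> Bd"
      using dec by argo
  next
    assume "v \<in> Bd"
    then have "to_base c v \<in> Bd" if "c \<in> carrier A" for c
      unfolding to_base_def using that by (intro move_Bd op_stable_component) simp_all
    then show "\<Psi> v = \<one>\<^bsub>SG\<^esub>"
      by (auto simp: \<Psi>_def \<psi>_boundaries)
  qed
  show "\<Psi> ` cycles (carrier M) op = carrier SG"
  proof
    show "carrier SG \<subseteq> \<Psi> ` cycles (carrier M) op"
    proof
      fix f assume "f \<in> carrier SG"
      then have f: "f \<in> carrier A \<rightarrow>\<^sub>E Z0" and fin: "finite {c \<in> carrier A. f c \<noteq> \<one>\<^bsub>\<Gamma>\<^esub>}"
        by (simp_all add: carrier_sum_group group_ZG)
      define I where "I = {c \<in> carrier A. f c \<noteq> \<one>\<^bsub>\<Gamma>\<^esub>}"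
      have "\<exists>u. keys u \<subseteq> K0 \<and> rack_boundary op u = 0 \<and> \<psi> u = f c" if "c \<in> carrier A" for c
        using \<psi>_surjective[of "f c"] f that by (metis PiE_mem)
      then obtain u where u: "\<And>c. c \<in> carrier A \<Longrightarrow> keys (u c) \<subseteq> K0"
        "\<And>c. c \<in> carrier A \<Longrightarrow> rack_boundary op (u c) = 0" "\<And>c. c \<in> carrier A \<Longrightarrow> \<psi> (u c) = f c"
        by metis
      define v where "v = (\<Sum>c\<in>I. from_base c (u c))"
      have to_base: "to_base c v = (if c \<in> I then u c else 0)" if "c \<in> carrier A" for c
      proof -
        have "to_base c v = (\<Sum>c'\<in>I. to_base c (from_base c' (u c')))"
          unfolding v_def to_base_def using fin by (simp add: move_sum I_def)
        also have "\<dots> = (\<Sum>c'\<in>I. if c' = c then u c else 0)"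
          using that u(1) by (intro sum.cong) (auto simp: to_from_base I_def)
        finally show ?thesis
          using fin by (simp add: I_def)
      qed
      have "\<Psi> v = f"
      proof
        show "\<Psi> v c = f c" for c
        proof (cases "c \<in> carrier A")
          case True
          then show ?thesis
            using to_base[OF True] u(3)[OF True] by (simp add: \<Psi>_def I_def)
        next
          case False
          then show ?thesis
            using PiE_arb[OF f False] by (simp add: \<Psi>_def)
        qed
      qed
      moreover have "v \<in> cycles (carrier M) op"
      proof -
        have "keys (from_base c (u c)) \<subseteq> tuples (carrier M) 2" if "c \<in> I" for c
          using that keys_from_base[OF u(1)] by (simp add: I_def)
        then have "keys v \<subseteq> tuples (carrier M) 2"
          unfolding v_def by (intro order_trans[OF keys_sum] UN_least)
        moreover have "rack_boundary op v = (\<Sum>c\<in>I. rack_boundary op (from_base c (u c)))"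
          using fin unfolding v_def I_def[symmetric] rack_boundary_def
          by (subst frag_extend_sum) (simp_all add: comp_def)
        moreover have "rack_boundary op (from_base c (u c)) = 0" if "c \<in> I" for c
          unfolding from_base_def using that u(1,2) K0_tuples
          by (subst boundary_move[OF _ op_stable_UNIV]) (auto simp: I_def)
        ultimately show ?thesis
          by (simp add: cycles_def)
      qed
      ultimately show "f \<in> \<Psi> ` cycles (carrier M) op"
        by blast
    qed
  qed (use \<Psi>_closed in blast)
qed

end

section \<open>The second quandle homology group\<close>

theorem theorem1p1:
  fixes M :: "('a, 'm) monoid_scheme" and T :: "'a \<Rightarrow> 'a"
  assumes "comm_group M" and "T \<in> iso M M"
  shows "quandle_homology (carrier M) (alexander_op M T) 2 \<cong>
    sum_group (carrier (coinvariants M T))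
      (\<lambda>_. coinvariants (exterior_square (one_minus_image M T))
              (diagonal_action (one_minus_image M T) T)
           \<times>\<times> invariants (one_minus_image M T) T
           \<times>\<times> sum_group (carrier (coinvariants M T) - {\<one>\<^bsub>coinvariants M T\<^esub>})
                (\<lambda>_. integer_group))"
proof -
  interpret M: comm_group M by fact
  interpret alexander M T
    using assms(2) by unfold_locales
  have L: "L = coinvariants (exterior_square NM) (diagonal_action NM T)"
    by (rule NE.wedge_coinvariants_def)
  have "group (invariants NM T)"
    unfolding invariants_def by (rule group.subgroup_imp_group[OF NE.N.is_group NE.one_minus.subgroup_kernel])
  then have "group (L \<times>\<times> invariants NM T \<times>\<times> sum_group S (\<lambda>_. integer_group))"
    by (intro DirProd_group L.is_group) simp_all
  then have "SG \<cong> sum_group (carrier A) (\<lambda>_. L \<times>\<times> invariants NM T \<times>\<times> sum_group S (\<lambda>_. integer_group))"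
    by (intro iso_sum_groupI Z0_iso group_ZG)
  with homology_iso_SG have "quandle_homology (carrier M) op 2 \<cong> sum_group (carrier A) (\<lambda>_. L \<times>\<times> invariants NM T \<times>\<times> sum_group S (\<lambda>_. integer_group))"
    by (rule iso_trans)
  then show ?thesis
    unfolding L one_A[symmetric] op_def .
qed

end
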